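(* Let $N\ge1$. (1) For any $x,y\in\overline\Omega$, $t\in(0,\infty)$, and $s\in(0,\infty)$, $$G(x,y,t+s)=\int_\Omega G(x,z,t)G(z,y,s)\,dz+\int_{\partial\Omega}G(x,z,t)G(z,y,s)\,d\sigma(z).$$ (2) Let $\phi^i$ and $\phi^b$ be nonnegative measurable functions in $\Omega$ and on $\partial\Omega$, respectively, or let $(\phi^i,\phi^b)\in L^q(\Omega)\times L^q(\partial\Omega)$ for some $q\in[1,\infty]$. Set $\phi=(\phi^i,\phi^b)$. Then $$\mathsf{G}(t)\mathsf{G}(s)\phi=\mathsf{G}(t+s)\phi,\qquad t,s\in(0,\infty).$$
   Context: $N\ge1$ is an integer and $\Omega:=\{x=(x',x_N)\in\mathbb R^N: x'\in\mathbb R^{N-1},\ x_N\in(0,\infty)\}$; if $N=1$, then $\Omega=(0,\infty)$ and $\partial\Omega=\{0\}$. $\sigma$ is the surface measure on $\partial\Omega$ if $N\ge2$, and $\sigma(\{0\})=1$ if $N=1$. For $y=(y',y_N)\in\overline\Omega$, $y^*=(y',-y_N)$; $e_N=(0,\dots,0,1)$. $\Gamma_N(x,t):=(4\pi t)^{-N/2}e^{-|x|^2/(4t)}$ for $(x,t)\in\mathbb R^N\times(0,\infty)$. For $(x,y,t)\in\overline\Omega\times\overline\Omega\times(0,\infty)$, $$G(x,y,t):=\Gamma_N(x-y,t)-\Gamma_N(x-y^*,t)-2\int_0^t(\partial_{x_N}\Gamma_N)(x-y^*+\tau e_N,t-\tau)\,d\tau .$$ For $\phi=(\phi^i,\phi^b)$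 with $\phi^i$, $\phi^b$ measurable in $\Omega$ and on $\partial\Omega$, respectively, $$[\mathsf{G}(t)\phi](x):=\int_\Omega G(x,y,t)\phi^i(y)\,dy+\int_{\partial\Omega}G(x,y,t)\phi^b(y)\,d\sigma(y),\qquad (x,t)\in\overline\Omega\times(0,\infty),$$ if it is well-defined (for nonnegative $\phi^i,\phi^b$ the value $+\infty$ is allowed). A function $f$ on $\overline\Omega$ is identified with the pair $(f|_\Omega,f|_{\partial\Omega})$, so that $\mathsf{G}(t)\mathsf{G}(s)\phi$ means $\mathsf{G}(t)$ applied to the pair $((\mathsf{G}(s)\phi)|_\Omega,(\mathsf{G}(s)\phi)|_{\partial\Omega})$; the identity in (2) is pointwise on $\overline\Omega$. *)

theory Defs
  imports "HOL-Analysis.Analysis"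
begin

text \<open>
  The space \<open>real ^ 'n\<close> is N-dimensional Euclidean space with \<open>N = CARD('n)\<close>; an index \<open>k :: 'n\<close>
  names the distinguished (last) coordinate \<open>x\<^sub>N\<close>.
\<close>

definition half_space :: "'n::finite \<Rightarrow> (real ^ 'n) set" where
  "half_space k = {x. 0 < x $ k}"

definition hyperplane_embed :: "'n::finite \<Rightarrow> ('n \<Rightarrow> real) \<Rightarrow> real ^ 'n" where
  "hyperplane_embed k u = (\<chi> i. if i = k then 0 else u i)"

text \<open>
  The surface measure of the flat boundary is the image of (N-1)-dimensional Lebesgue measure under
  \<open>x' \<mapsto> (x', 0)\<close>, completed so that measurable means Lebesgue measurable. For \<open>N = 1\<close>
  the product is over the empty index set, and the boundary point gets mass 1.
\<close>

definition bdry_measure :: "'n::finite \<Rightarrow> (real ^ 'n) measure" where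
  "bdry_measure k =
     completion (distr (Pi\<^sub>M (UNIV - {k}) (\<lambda>_. lborel))
       (restrict_space borel (frontier (half_space k))) (hyperplane_embed k))"

definition reflect :: "'n::finite \<Rightarrow> real ^ 'n \<Rightarrow> real ^ 'n" where
  "reflect k y = (\<chi> i. if i = k then - (y $ i) else y $ i)"

definition heat_kernel :: "real ^ 'n::finite \<Rightarrow> real \<Rightarrow> real" where
  "heat_kernel x t =
     (4 * pi * t) powr (- real CARD('n) / 2) * exp (- (norm x)\<^sup>2 / (4 * t))"

definition normal_deriv_heat_kernel :: "'n::finite \<Rightarrow> real ^ 'n \<Rightarrow> real \<Rightarrow> real" where
  "normal_deriv_heat_kernel k x t = deriv (\<lambda>h. heat_kernel (x + h *\<^sub>R axis k 1) t) 0"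

definition dyn_kernel :: "'n::finite \<Rightarrow> real ^ 'n \<Rightarrow> real ^ 'n \<Rightarrow> real \<Rightarrow> real" where
  "dyn_kernel k x y t =
     heat_kernel (x - y) t - heat_kernel (x - reflect k y) t
     - 2 * (LINT \<tau>:{0<..<t}|lborel.
              normal_deriv_heat_kernel k (x - reflect k y + \<tau> *\<^sub>R axis k 1) (t - \<tau>))"

text \<open>
  The operator \<open>G(t)\<close> comes in two versions: for pairs of \<open>[0, \<infinity>]\<close>-valued functions, where the
  value \<open>\<infinity>\<close> is allowed, and for pairs of real-valued functions. The latter is meaningful
  only where \<open>dyn_op_defined\<close> holds, as the Bochner integral of a non-integrable function is 0.
  In the former, \<open>ennreal\<close> does not truncate; see \<open>dyn_kernel_nonneg\<close> below.
\<close>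

definition dyn_op_nn ::
  "'n::finite \<Rightarrow> real \<Rightarrow> (real ^ 'n \<Rightarrow> ennreal) \<Rightarrow> (real ^ 'n \<Rightarrow> ennreal) \<Rightarrow> real ^ 'n \<Rightarrow> ennreal" where
  "dyn_op_nn k t \<phi>i \<phi>b x =
     (\<integral>\<^sup>+ y. ennreal (dyn_kernel k x y t) * \<phi>i y \<partial>lebesgue_on (half_space k))
     + (\<integral>\<^sup>+ y. ennreal (dyn_kernel k x y t) * \<phi>b y \<partial>bdry_measure k)"

definition dyn_op_defined ::
  "'n::finite \<Rightarrow> real \<Rightarrow> (real ^ 'n \<Rightarrow> real) \<Rightarrow> (real ^ 'n \<Rightarrow> real) \<Rightarrow> real ^ 'n \<Rightarrow> bool" where
  "dyn_op_defined k t \<phi>i \<phi>b x \<longleftrightarrow>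
     integrable (lebesgue_on (half_space k)) (\<lambda>y. dyn_kernel k x y t * \<phi>i y)
     \<and> integrable (bdry_measure k) (\<lambda>y. dyn_kernel k x y t * \<phi>b y)"

definition dyn_op ::
  "'n::finite \<Rightarrow> real \<Rightarrow> (real ^ 'n \<Rightarrow> real) \<Rightarrow> (real ^ 'n \<Rightarrow> real) \<Rightarrow> real ^ 'n \<Rightarrow> real" where
  "dyn_op k t \<phi>i \<phi>b x =
     (\<integral> y. dyn_kernel k x y t * \<phi>i y \<partial>lebesgue_on (half_space k))
     + (\<integral> y. dyn_kernel k x y t * \<phi>b y \<partial>bdry_measure k)"

definition in_Lq :: "ennreal \<Rightarrow> 'a measure \<Rightarrow> ('a \<Rightarrow> real) \<Rightarrow> bool" where
  "in_Lq q M f \<longleftrightarrow> f \<in> borel_measurable M \<and>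
     (if q = \<infinity> then \<exists>C. AE x in M. \<bar>f x\<bar> \<le> C
      else (\<integral>\<^sup>+ x. ennreal (\<bar>f x\<bar> powr enn2real q) \<partial>M) < \<infinity>)"

lemma closure_half_space: "closure (half_space k) = {x. 0 \<le> x $ k}"
  using closure_halfspace_component_gt[of 0 k]
  by (auto simp: half_space_def)

lemma frontier_half_space: "frontier (half_space k) = {x. x $ k = 0}"
proof -
  have "open (half_space k)"
    unfolding half_space_def by (rule open_halfspace_component_gt_cart)
  then show ?thesis
    by (auto simp: frontier_def closure_half_space interior_open) (auto simp: half_space_def)
qed

lemma measurable_hyperplane_embed:
  "hyperplane_embed k \<in> Pi\<^sub>M (UNIV - {k}) (\<lambda>_. lborel)
     \<rightarrow>\<^sub>M restrict_space borel (frontier (half_space k))"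
proof (rule measurable_restrict_space2)
  show "hyperplane_embed k \<in> space (Pi\<^sub>M (UNIV - {k}) (\<lambda>_. lborel)) \<rightarrow> frontier (half_space k)"
    by (auto simp: hyperplane_embed_def frontier_half_space)
  have "(\<lambda>u. hyperplane_embed k u \<bullet> b) \<in> borel_measurable (Pi\<^sub>M (UNIV - {k}) (\<lambda>_. lborel))"
    if b: "b \<in> Basis" for b
  proof -
    obtain i where i: "b = axis i 1" using b by (auto simp: Basis_vec_def)
    show ?thesis
    proof (cases "i = k")
      case False
      then have "(\<lambda>u. u i) \<in> Pi\<^sub>M (UNIV - {k}) (\<lambda>_. lborel) \<rightarrow>\<^sub>M (lborel :: real measure)"
        by (intro measurable_component_singleton) auto
      then show ?thesis using False by (simp add: i hyperplane_embed_def inner_axis)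
    qed (simp add: i hyperplane_embed_def inner_axis)
  qed
  then show "hyperplane_embed k \<in> borel_measurable (Pi\<^sub>M (UNIV - {k}) (\<lambda>_. lborel))"
    by (subst borel_measurable_euclidean_space) auto
qed

lemma bdry_measure_dim1:
  fixes k :: "'n::finite"
  assumes "CARD('n) = 1"
  shows "frontier (half_space k) = {0}" and "emeasure (bdry_measure k) {0} = 1"
proof -
  from assms obtain a :: 'n where "UNIV = {a}" by (auto simp: card_1_singleton_iff)
  then have k: "UNIV = {k}" by (metis UNIV_I singletonD)
  then have "i = k" for i by (metis UNIV_I singletonD)
  then have U: "v = 0 \<longleftrightarrow> v $ k = 0" for v :: "real ^ 'n"
    by (metis vec_eq_iff zero_index)
  show F: "frontier (half_space k) = {0}"
    unfolding frontier_half_space using U by blast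
  have E: "UNIV - {k} = {}" using k by blast
  have H: "hyperplane_embed k u = 0" for u
    by (rule iffD2[OF U]) (simp add: hyperplane_embed_def)
  let ?R = "restrict_space borel (frontier (half_space k))"
  have S: "{0} \<in> sets ?R"
    unfolding F by (simp add: sets_restrict_space_iff)
  have "emeasure (bdry_measure k) {0}
      = emeasure (distr (Pi\<^sub>M (UNIV - {k}) (\<lambda>_. lborel)) ?R (hyperplane_embed k)) {0}"
    unfolding bdry_measure_def using S by simp
  also have "\<dots> = emeasure (Pi\<^sub>M (UNIV - {k}) (\<lambda>_. lborel))
      (hyperplane_embed k -` {0} \<inter> space (Pi\<^sub>M (UNIV - {k}) (\<lambda>_. lborel)))"
    by (rule emeasure_distr[OF measurable_hyperplane_embed S])
  also have "hyperplane_embed k -` {0} = UNIV" using H by blast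
  also have "emeasure (Pi\<^sub>M (UNIV - {k}) (\<lambda>_. lborel :: real measure))
      (UNIV \<inter> space (Pi\<^sub>M (UNIV - {k}) (\<lambda>_. lborel))) = 1"
    unfolding E by (simp add: space_PiM_empty emeasure_PiM_empty)
  finally show "emeasure (bdry_measure k) {0} = 1" .
qed

lemma normal_deriv_heat_kernel_eq:
  fixes x :: "real ^ 'n::finite"
  assumes "0 < t"
  shows "normal_deriv_heat_kernel k x t = - (x $ k) / (2 * t) * heat_kernel x t"
proof -
  have n: "(norm (x + h *\<^sub>R axis k 1))\<^sup>2 = (norm x)\<^sup>2 + 2 * h * (x $ k) + h\<^sup>2" for h
    unfolding power2_norm_eq_inner
    by (simp add: inner_add_left inner_add_right inner_axis inner_axis' power2_eq_square
        distrib_left)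
  have "((\<lambda>h. (4 * pi * t) powr (- real CARD('n) / 2)
            * exp (- ((norm x)\<^sup>2 + 2 * h * (x $ k) + h\<^sup>2) / (4 * t)))
          has_real_derivative - (x $ k) / (2 * t) * heat_kernel x t) (at 0)"
    using assms by (auto intro!: derivative_eq_intros simp: heat_kernel_def field_simps)
  then show ?thesis
    unfolding normal_deriv_heat_kernel_def by (auto simp: heat_kernel_def n intro: DERIV_imp_deriv)
qed

lemma dyn_kernel_nonneg:
  fixes k :: "'n::finite"
  assumes x: "x \<in> closure (half_space k)" and y: "y \<in> closure (half_space k)" and t: "0 < t"
  shows "0 \<le> dyn_kernel k x y t"
proof -
  have xy: "0 \<le> x $ k" "0 \<le> y $ k" using x y by (auto simp: closure_half_space)
  have "norm (x - y) \<le> norm (x - reflect k y)"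
    by (rule norm_le_componentwise_cart) (use xy in \<open>auto simp: reflect_def\<close>)
  then have "(norm (x - y))\<^sup>2 \<le> (norm (x - reflect k y))\<^sup>2"
    by (intro power_mono) auto
  then have 1: "heat_kernel (x - reflect k y) t \<le> heat_kernel (x - y) t"
    using t by (auto simp: heat_kernel_def intro!: mult_left_mono divide_right_mono)
  have "normal_deriv_heat_kernel k (x - reflect k y + \<tau> *\<^sub>R axis k 1) (t - \<tau>) \<le> 0"
    if "\<tau> \<in> {0<..<t}" for \<tau>
  proof -
    let ?z = "x - reflect k y + \<tau> *\<^sub>R axis k 1"
    have "0 \<le> ?z $ k" using that xy by (simp add: reflect_def)
    moreover have "0 \<le> heat_kernel ?z (t - \<tau>)" by (simp add: heat_kernel_def)
    ultimately have "0 \<le> ?z $ k / (2 * (t - \<tau>)) * heat_kernel ?z (t - \<tau>)"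
      using that by (intro mult_nonneg_nonneg divide_nonneg_nonneg) auto
    moreover have "normal_deriv_heat_kernel k ?z (t - \<tau>)
        = - (?z $ k / (2 * (t - \<tau>)) * heat_kernel ?z (t - \<tau>))"
      using that normal_deriv_heat_kernel_eq[of "t - \<tau>" k ?z]
      by (metis diff_gt_0_iff_gt greaterThanLessThan_iff minus_divide_left mult_minus_left)
    ultimately show ?thesis by linarith
  qed
  then have "0 \<le> (LINT \<tau>:{0<..<t}|lborel.
      - normal_deriv_heat_kernel k (x - reflect k y + \<tau> *\<^sub>R axis k 1) (t - \<tau>))"
    unfolding set_lebesgue_integral_def
    by (intro integral_nonneg_AE) (auto simp: indicator_def)
  then have 2: "(LINT \<tau>:{0<..<t}|lborel.
      normal_deriv_heat_kernel k (x - reflect k y + \<tau> *\<^sub>R axis k 1) (t - \<tau>)) \<le> 0"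
    by (simp add: set_lebesgue_integral_def)
  show ?thesis unfolding dyn_kernel_def using 1 2 by linarith
qed

end

theory Submission
  imports Defs "HOL-Probability.Characteristic_Functions" "HOL-Real_Asymp.Real_Asymp"
begin

text \<open>The obstacle is \<open>Psi\<close>: differentiating it under the integral sign, and
  passing to the ends of the time interval, where one of the two Gaussians degenerates, would need
  domination estimates. Instead, the product of two Gaussians in \<open>c\<close> is again Gaussian
  in \<open>c\<close>, so \<open>Psi\<close> and the \<open>hit\<close>-\<open>hit\<close> integral
  have closed forms in the normal distribution function. The derivative is then a finite
  computation, and the end values are limits of \<open>ncdf\<close> at infinity. The boundary
  integral is what makes the computation close up: at \<open>c = 0\<close> both Dirichlet factors
  vanish, so the boundary adds only a product of two hitting densities, the term that the interior
  integral misses in the derivative of \<open>Psi\<close>. All exchanges of integrals take place in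
  [0, \<infinity>]; integrability is settled only afterwards, from bounds on the kernel. For
  \<open>N = 1\<close> the tangential factor is an empty product and its measure a unit mass, so no
  separate case arises.\<close>

text \<open>
  Write \<open>a\<close>, \<open>b\<close> for the normal coordinates of \<open>x\<close>, \<open>y\<close>. Substituting \<open>r = t - \<tau>\<close>, the kernel is
  \<open>T(t) K\<^sub>t(a, b) + \<integral>\<^sub>0\<^sup>t T(r) p\<^sub>r(a + b + t - r) dr\<close>, where \<open>T(r)\<close> is the tangential heat kernel, \<open>K\<close> the
  Dirichlet heat kernel of the half line and \<open>p\<^sub>r(z) = (z / r) \<Gamma>\<^sub>1(z, r)\<close> the hitting density of Brownian
  motion; \<open>r\<close> is the time spent in the interior and \<open>t - r\<close> the time spent on the boundary. By the
  convolution property of \<open>T\<close>, the Chapman--Kolmogorov identity reduces to a one-dimensional identity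
  for each fixed total interior time \<open>\<rho>\<close>. There the interior-boundary double integral is the
  integral of a derivative: the function \<open>\<Psi>(r) = \<integral>\<^sub>0\<^sup>\<infinity> K\<^sub>r(A - r, c) p\<^sub>\<rho>\<^sub>-\<^sub>r(c + B - \<rho> + r) dc\<close> with \<open>A = a + t\<close>,
  \<open>B = b + s\<close> satisfies \<open>- \<Psi>'(r) = \<integral>\<^sub>0\<^sup>\<infinity> p p dc + p p|\<^sub>c\<^sub>=\<^sub>0\<close>, and its boundary values are exactly the
  mixed Dirichlet-hitting terms. The semigroup property follows by Tonelli's theorem; for \<open>L\<^sup>q\<close> data
  it is applied to positive and negative parts.
\<close>

subsection \<open>One-dimensional Gaussian integrals\<close>

definition gauss :: "real \<Rightarrow> real \<Rightarrow> real" where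
  "gauss t z = exp (- z\<^sup>2 / (4 * t)) / sqrt (4 * pi * t)"

text \<open>This is \<open>-2\<close> times the \<open>z\<close>-derivative of
  \<open>gauss t\<close>, the form in which it enters \<open>dyn_kernel\<close>.\<close>

definition hit :: "real \<Rightarrow> real \<Rightarrow> real" where
  "hit t z = z / t * gauss t z"

definition dirichlet :: "real \<Rightarrow> real \<Rightarrow> real \<Rightarrow> real" where
  "dirichlet t a b = gauss t (a - b) - gauss t (a + b)"

definition ncdf :: "real \<Rightarrow> real" where
  "ncdf = cdf std_normal_distribution"

lemma gauss_nonneg: "0 \<le> t \<Longrightarrow> 0 \<le> gauss t z"
  by (simp add: gauss_def)

lemma gauss_minus [simp]: "gauss t (- z) = gauss t z"
  by (simp add: gauss_def)

lemma hit_minus [simp]: "hit t (- z) = - hit t z"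
  by (simp add: hit_def)

lemma hit_nonneg: "0 \<le> t \<Longrightarrow> 0 \<le> z \<Longrightarrow> 0 \<le> hit t z"
  by (simp add: hit_def gauss_nonneg)

lemma dirichlet_nonneg:
  assumes "0 < t" "0 \<le> a" "0 \<le> b"
  shows "0 \<le> dirichlet t a b"
proof -
  have "(a - b)\<^sup>2 \<le> (a + b)\<^sup>2"
    using assms by (simp add: power2_eq_square algebra_simps)
  then show ?thesis
    using assms by (auto simp: dirichlet_def gauss_def intro!: divide_right_mono)
qed

lemma dirichlet_0 [simp]: "dirichlet t 0 b = 0" "dirichlet t a 0 = 0"
  by (simp_all add: dirichlet_def)

lemma borel_measurable_gauss [measurable (raw)]:
  assumes [measurable]: "f \<in> borel_measurable M" "g \<in> borel_measurable M"
  shows "(\<lambda>x. gauss (f x) (g x)) \<in> borel_measurable M"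
  unfolding gauss_def by measurable

lemma borel_measurable_hit [measurable (raw)]:
  assumes [measurable]: "f \<in> borel_measurable M" "g \<in> borel_measurable M"
  shows "(\<lambda>x. hit (f x) (g x)) \<in> borel_measurable M"
  unfolding hit_def by measurable

lemma borel_measurable_dirichlet [measurable (raw)]:
  assumes [measurable]: "f \<in> borel_measurable M" "g \<in> borel_measurable M" "h \<in> borel_measurable M"
  shows "(\<lambda>x. dirichlet (f x) (g x) (h x)) \<in> borel_measurable M"
  unfolding dirichlet_def by measurable

lemma DERIV_gauss:
  assumes "0 < t"
  shows "(gauss t has_real_derivative - z / (2 * t) * gauss t z) (at z)"
  unfolding gauss_def[abs_def]
  by (rule derivative_eq_intros refl | use assms in \<open>simp add: field_simps\<close>)+

lemmas DERIV_gauss_chain [derivative_intros] = DERIV_chain2[OF DERIV_gauss]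

section \<open>The normal distribution function\<close>

text \<open>Subtracting the value at \<open>z - 1\<close> turns the integral over a ray into one
  over a compact interval, where the fundamental theorem of calculus applies.\<close>

lemma DERIV_ncdf: "(ncdf has_real_derivative std_normal_density z) (at z)"
proof -
  interpret N: real_distribution std_normal_distribution
    by (rule real_dist_normal_dist)
  have fin: "N.prob A = (\<integral>x. indicator A x * std_normal_density x \<partial>lborel)"
    if A: "A \<in> sets borel" for A
  proof -
    have "N.prob A = (\<integral>x. indicator A x \<partial>std_normal_distribution)"
      using A by simp
    also have "\<dots> = (\<integral>x. std_normal_density x *\<^sub>R indicator A x \<partial>lborel)"
      using A by (intro integral_density) auto
    finally show ?thesis by (simp add: mult.commute)
  qed
  define F where "F = (\<lambda>x. integral {z - 1..x} std_normal_density)"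
  have cont: "continuous_on UNIV std_normal_density"
    unfolding normal_density_def by (intro continuous_intros) auto
  have "ncdf x = ncdf (z - 1) + F x" if "z - 1 < x" for x
  proof -
    have "ncdf x - ncdf (z - 1) = N.prob {z - 1<..x}"
      unfolding ncdf_def by (rule N.cdf_diff_eq[OF that])
    also have "\<dots> = (\<integral>y. indicator {z - 1<..x} y * std_normal_density y \<partial>lborel)"
      by (rule fin) simp
    also have "\<dots> = (LINT y:{z - 1..x}|lborel. std_normal_density y)"
      unfolding set_lebesgue_integral_def
      by (rule integral_cong_AE) (auto simp: indicator_def intro!: AE_I[where N = "{z - 1}"])
    also have "\<dots> = F x"
      unfolding F_def
      by (rule set_borel_integral_eq_integral(2), unfold set_integrable_def,
          rule borel_integrable_compact) (auto intro: continuous_on_subset[OF cont])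
    finally show ?thesis by simp
  qed
  moreover have "(F has_real_derivative std_normal_density z) (at z)"
  proof -
    have "(F has_real_derivative std_normal_density z) (at z within {z - 1..z + 1})"
      unfolding F_def by (rule integral_has_real_derivative)
        (auto intro: continuous_on_subset[OF cont])
    then show ?thesis by (simp add: at_within_Icc_at)
  qed
  then have "((\<lambda>x. ncdf (z - 1) + F x) has_real_derivative std_normal_density z) (at z)"
    by (auto intro!: derivative_eq_intros)
  ultimately show ?thesis
    by (subst has_field_derivative_cong_eventually[where g = "\<lambda>x. ncdf (z - 1) + F x"])
      (auto intro!: eventually_at_in_open'[of "{z - 1<..}"] elim!: eventually_mono
        simp: eventually_at_filter intro: eventually_mono[OF eventually_nhds_in_open[of "{z - 1<..}"]])
qed

lemmas DERIV_ncdf_chain [derivative_intros] = DERIV_chain2[OF DERIV_ncdf]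

lemma isCont_ncdf: "isCont ncdf z"
  by (rule DERIV_isCont[OF DERIV_ncdf])

lemma ncdf_at_top: "(ncdf \<longlongrightarrow> 1) at_top"
proof -
  interpret N: real_distribution std_normal_distribution
    by (rule real_dist_normal_dist)
  show ?thesis unfolding ncdf_def by (rule N.cdf_lim_at_top_prob)
qed

lemma ncdf_at_bot: "(ncdf \<longlongrightarrow> 0) at_bot"
proof -
  interpret N: real_distribution std_normal_distribution
    by (rule real_dist_normal_dist)
  show ?thesis unfolding ncdf_def by (rule N.cdf_lim_at_bot)
qed

text \<open>The density is even, so \<open>ncdf z + ncdf (- z)\<close> has derivative 0 and equals
  its limit at infinity.\<close>

lemma ncdf_minus: "ncdf (- z) = 1 - ncdf z"
proof -
  define F where "F = (\<lambda>z. ncdf z + ncdf (- z))"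
  have "(F has_real_derivative 0) (at x)" for x
    unfolding F_def by (auto intro!: derivative_eq_intros simp: normal_density_def)
  then have const: "F x = F y" for x y
    by (rule DERIV_isconst_all[OF allI])
  have "(F \<longlongrightarrow> 1 + 0) at_top"
    unfolding F_def
    by (intro tendsto_intros ncdf_at_top filterlim_compose[OF ncdf_at_bot] filterlim_uminus_at_bot_at_top)
  moreover have "F = (\<lambda>_. F z)" using const by blast
  ultimately have "F z = 1"
    using tendsto_unique[of "at_top :: real filter" F 1 "F z"]
    by (metis add.right_neutral tendsto_const trivial_limit_at_top_linorder)
  then show ?thesis by (simp add: F_def)
qed

lemma gauss_tendsto_0:
  assumes "0 < t"
  shows "(gauss t \<longlongrightarrow> 0) at_top"
  unfolding gauss_def using assms by real_asymp

section \<open>Products of two Gaussians and their antiderivatives\<close>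

text \<open>Completing the square in \<open>c\<close>: up to a factor free of \<open>c\<close>, the
  product is a normal density with mean \<open>(\<alpha> * s - \<beta> * r) / (r + s)\<close> and
  variance \<open>2 * r * s / (r + s)\<close>.\<close>

lemma gauss_mult_gauss:
  fixes \<alpha> \<beta> c :: real
  assumes "0 < r" "0 < s"
  shows "gauss r (\<alpha> - c) * gauss s (c + \<beta>)
    = gauss (r + s) (\<alpha> + \<beta>) * (std_normal_density ((c - (\<alpha> * s - \<beta> * r) / (r + s)) / sqrt (2 * r * s / (r + s)))
        / sqrt (2 * r * s / (r + s)))"
proof -
  define v where "v = 2 * r * s / (r + s)"
  define w where "w = (c - (\<alpha> * s - \<beta> * r) / (r + s)) / sqrt v"
  have v: "0 < v" using assms by (simp add: v_def)
  have "- w\<^sup>2 / 2 = - (c - (\<alpha> * s - \<beta> * r) / (r + s))\<^sup>2 / (2 * v)"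
    using v by (simp add: w_def power_divide)
  also have "\<dots> = - (\<alpha> - c)\<^sup>2 / (4 * r) - (c + \<beta>)\<^sup>2 / (4 * s) + (\<alpha> + \<beta>)\<^sup>2 / (4 * (r + s))"
  proof -
    have "r + s \<noteq> 0" "r \<noteq> 0" "s \<noteq> 0" using assms by auto
    then show ?thesis unfolding v_def by (simp add: divide_simps) algebra
  qed
  finally have e: "- (\<alpha> - c)\<^sup>2 / (4 * r) + - (c + \<beta>)\<^sup>2 / (4 * s) = - (\<alpha> + \<beta>)\<^sup>2 / (4 * (r + s)) + - w\<^sup>2 / 2"
    by linarith
  have "sqrt (4 * pi * r) * sqrt (4 * pi * s) = sqrt (4 * pi * (r + s)) * (sqrt (2 * pi) * sqrt v)"
    unfolding real_sqrt_mult[symmetric] using assms by (simp add: v_def field_simps)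
  then have "gauss r (\<alpha> - c) * gauss s (c + \<beta>)
      = exp (- (\<alpha> - c)\<^sup>2 / (4 * r) + - (c + \<beta>)\<^sup>2 / (4 * s)) / (sqrt (4 * pi * (r + s)) * (sqrt (2 * pi) * sqrt v))"
    unfolding gauss_def by (simp only: exp_add times_divide_times_eq)
  also have "\<dots> = gauss (r + s) (\<alpha> + \<beta>) * (std_normal_density w / sqrt v)"
    unfolding e exp_add by (simp add: gauss_def std_normal_density_def)
  finally show ?thesis unfolding w_def v_def .
qed

text \<open>The inequality is recorded as well because \<open>ennreal\<close> sends a negative
  difference to 0; the value of the integral alone would not show that a closed form is
  nonnegative.\<close>

lemma nn_integral_FTC_greaterThan:
  fixes f F :: "real \<Rightarrow> real"
  assumes f: "f \<in> borel_measurable borel"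
    and F: "\<And>x. a \<le> x \<Longrightarrow> (F has_real_derivative f x) (at x)"
    and nonneg: "\<And>x. a \<le> x \<Longrightarrow> 0 \<le> f x"
    and lim: "(F \<longlongrightarrow> T) at_top"
  shows "(\<integral>\<^sup>+x\<in>{a<..}. ennreal (f x) \<partial>lborel) = ennreal (T - F a)" "F a \<le> T"
proof -
  have "(\<integral>\<^sup>+x\<in>{a<..}. ennreal (f x) \<partial>lborel) = (\<integral>\<^sup>+x\<in>{a..}. ennreal (f x) \<partial>lborel)"
    by (intro nn_integral_cong_AE AE_I[where N = "{a}"]) (auto simp: indicator_def split: if_splits)
  also have "\<dots> = ennreal (T - F a)"
    by (rule nn_integral_FTC_atLeast) (use assms in auto)
  finally show "(\<integral>\<^sup>+x\<in>{a<..}. ennreal (f x) \<partial>lborel) = ennreal (T - F a)" .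
  have "F a \<le> F x" if "a \<le> x" for x
    using that by (rule DERIV_nonneg_imp_nondecreasing) (use F nonneg in blast)
  then show "F a \<le> T"
    by (intro tendsto_lowerbound[OF lim]) (auto intro: eventually_mono[OF eventually_ge_at_top[of a]])
qed

text \<open>The standardised position of \<open>c\<close> under the Gaussian proportional to
  \<open>gauss r (\<alpha> - c) * gauss s (c + \<beta>)\<close>.\<close>

definition score :: "real \<Rightarrow> real \<Rightarrow> real \<Rightarrow> real \<Rightarrow> real \<Rightarrow> real" where
  "score r s \<alpha> \<beta> c = (c - (\<alpha> * s - \<beta> * r) / (r + s)) / sqrt (2 * r * s / (r + s))"

lemma score_uminus: "score r s (- \<alpha>) (- \<beta>) 0 = - score r s \<alpha> \<beta> 0"
  by (simp add: score_def diff_divide_distrib ac_simps)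

lemma score_swap: "score s r \<beta> \<alpha> 0 = - score r s \<alpha> \<beta> 0"
  by (simp add: score_def diff_divide_distrib ac_simps)

lemma score_at_top:
  assumes "0 < r" "0 < s"
  shows "filterlim (score r s \<alpha> \<beta>) at_top at_top"
proof -
  have "filterlim (\<lambda>c. (c - m) / q) at_top at_top" if "0 < q" for m q :: real
    using that by real_asymp
  then show ?thesis
    unfolding score_def using assms by simp
qed

lemma ncdf_score_at_top:
  assumes "0 < r" "0 < s"
  shows "((\<lambda>c. ncdf (score r s \<alpha> \<beta> c)) \<longlongrightarrow> 1) at_top"
  using assms by (intro filterlim_compose[OF ncdf_at_top] score_at_top)

lemma DERIV_ncdf_score:
  assumes "0 < r" "0 < s"
  shows "((\<lambda>c. gauss (r + s) (\<alpha> + \<beta>) * ncdf (score r s \<alpha> \<beta> c)) has_real_derivative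
    gauss r (\<alpha> - c) * gauss s (c + \<beta>)) (at c)"
proof -
  have "(score r s \<alpha> \<beta> has_real_derivative 1 / sqrt (2 * r * s / (r + s))) (at c)"
    unfolding score_def[abs_def] by (intro DERIV_cdivide) (auto intro!: derivative_eq_intros)
  from DERIV_cmult[OF DERIV_ncdf_chain[OF this]] show ?thesis
    unfolding gauss_mult_gauss[OF assms] score_def[symmetric] by (rule DERIV_cong) simp
qed

lemma DERIV_gauss_mult_gauss:
  assumes "0 < r" "0 < s"
  shows "((\<lambda>c. gauss r (\<alpha> - c) * gauss s (c + \<beta>)) has_real_derivative
    ((\<alpha> - c) / (2 * r) - (c + \<beta>) / (2 * s)) * (gauss r (\<alpha> - c) * gauss s (c + \<beta>))) (at c)"
proof -
  have "((\<lambda>c. gauss r (\<alpha> - c) * gauss s (c + \<beta>)) has_real_derivative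
    (- (\<alpha> - c) / (2 * r) * gauss r (\<alpha> - c) * (0 - 1)) * gauss s (c + \<beta>)
    + (- (c + \<beta>) / (2 * s) * gauss s (c + \<beta>) * (1 + 0)) * gauss r (\<alpha> - c)) (at c)"
    using assms by (intro derivative_intros)
  then show ?thesis
    by (rule DERIV_cong) (simp add: diff_divide_distrib add_divide_distrib algebra_simps)
qed

lemma gauss_mult_gauss_tendsto_0:
  assumes r: "0 < r" and s: "0 < s"
  shows "((\<lambda>c. (c + d) * (gauss r (\<alpha> - c) * gauss s (c + \<beta>))) \<longlongrightarrow> 0) at_top"
    and "((\<lambda>c. gauss r (\<alpha> - c) * gauss s (c + \<beta>)) \<longlongrightarrow> 0) at_top"
proof -
  have shift: "filterlim (\<lambda>c. c + b) at_top at_top" for b :: real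
    by real_asymp
  have 1: "((\<lambda>c. gauss s (c + \<beta>)) \<longlongrightarrow> 0) at_top"
    by (rule filterlim_compose[OF gauss_tendsto_0[OF s] shift])
  have minus: "gauss r (\<alpha> - c) = gauss r (c + - \<alpha>)" for c
    using gauss_minus[of r "c - \<alpha>"] by simp
  have 2: "((\<lambda>c. gauss r (\<alpha> - c)) \<longlongrightarrow> 0) at_top"
    unfolding minus by (rule filterlim_compose[OF gauss_tendsto_0[OF r] shift])
  show "((\<lambda>c. gauss r (\<alpha> - c) * gauss s (c + \<beta>)) \<longlongrightarrow> 0) at_top"
    using tendsto_mult[OF 2 1] by simp
  have "((\<lambda>z. (z + (\<alpha> + d)) * gauss r z) \<longlongrightarrow> 0) at_top"
    unfolding gauss_def using r by real_asymp
  from filterlim_compose[OF this shift, of "- \<alpha>"]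
  have "((\<lambda>c. (c + d) * gauss r (\<alpha> - c)) \<longlongrightarrow> 0) at_top"
    unfolding minus by (simp add: algebra_simps)
  from tendsto_mult[OF this 1]
  show "((\<lambda>c. (c + d) * (gauss r (\<alpha> - c) * gauss s (c + \<beta>))) \<longlongrightarrow> 0) at_top"
    by (simp add: mult.assoc)
qed

text \<open>Each of the following integrals is evaluated by an explicit antiderivative: a multiple of
  \<open>ncdf (score r s \<alpha> \<beta> c)\<close> plus a polynomial times \<open>gauss r (\<alpha> - c) * gauss s (c + \<beta>)\<close>.\<close>

lemma dirichlet_semigroup:
  assumes r: "0 < r" and s: "0 < s" and a: "0 \<le> a" and b: "0 \<le> b"
  shows "(\<integral>\<^sup>+c\<in>{0<..}. ennreal (dirichlet r a c * dirichlet s c b) \<partial>lborel) = ennreal (dirichlet (r + s) a b)"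
proof -
  define F where "F = (\<lambda>\<alpha> \<beta> c. gauss (r + s) (\<alpha> + \<beta>) * ncdf (score r s \<alpha> \<beta> c))"
  \<comment> \<open>Each Dirichlet factor is a difference of two images; the four terms carry the
    product of their signs.\<close>
  define H where "H = (\<lambda>c. F a (- b) c - F (- a) (- b) c - F a b c + F (- a) b c)"
  have "(\<integral>\<^sup>+c\<in>{0<..}. ennreal (dirichlet r a c * dirichlet s c b) \<partial>lborel)
      = ennreal ((gauss (r + s) (a + - b) * 1 - gauss (r + s) (- a + - b) * 1 - gauss (r + s) (a + b) * 1
          + gauss (r + s) (- a + b) * 1) - H 0)"
  proof (rule nn_integral_FTC_greaterThan(1))
    show "(H has_real_derivative dirichlet r a c * dirichlet s c b) (at c)" for c
    proof (rule DERIV_cong)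
      show "(H has_real_derivative gauss r (a - c) * gauss s (c + - b) - gauss r (- a - c) * gauss s (c + - b)
        - gauss r (a - c) * gauss s (c + b) + gauss r (- a - c) * gauss s (c + b)) (at c)"
        unfolding H_def F_def using r s by (intro derivative_intros DERIV_ncdf_score)
      have "gauss r (- a - c) = gauss r (a + c)"
        using gauss_minus[of r "a + c"] by simp
      then show "gauss r (a - c) * gauss s (c + - b) - gauss r (- a - c) * gauss s (c + - b)
        - gauss r (a - c) * gauss s (c + b) + gauss r (- a - c) * gauss s (c + b)
        = dirichlet r a c * dirichlet s c b"
        by (simp add: dirichlet_def algebra_simps)
    qed
    show "(H \<longlongrightarrow> gauss (r + s) (a + - b) * 1 - gauss (r + s) (- a + - b) * 1 - gauss (r + s) (a + b) * 1
          + gauss (r + s) (- a + b) * 1) at_top"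
      unfolding H_def F_def using r s by (intro tendsto_intros ncdf_score_at_top)
  qed (use assms in \<open>auto intro!: mult_nonneg_nonneg dirichlet_nonneg\<close>)
  moreover have "gauss (r + s) (- a - b) = gauss (r + s) (a + b)"
    "gauss (r + s) (b - a) = gauss (r + s) (a - b)"
    using gauss_minus[of "r + s" "a + b"] gauss_minus[of "r + s" "a - b"] by simp_all
  moreover have "- b - a = - a - b" by simp
  \<comment> \<open>At \<open>c = 0\<close> the four normal probabilities pair off to 1, so
    \<open>H 0\<close> is half of the limit at infinity.\<close>
  moreover have "ncdf (score r s (- a) (- b) 0) = 1 - ncdf (score r s a b 0)"
    "ncdf (score r s (- a) b 0) = 1 - ncdf (score r s a (- b) 0)"
    using score_uminus[of r s a b] score_uminus[of r s a "- b"] by (simp_all add: ncdf_minus)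
  ultimately show ?thesis
    by (simp add: H_def F_def dirichlet_def algebra_simps)
qed

text \<open>Expected hitting density at level \<open>-\<beta>\<close> of a path from \<open>\<alpha>\<close> killed at 0 up to time \<open>r\<close>.\<close>

definition Psi :: "real \<Rightarrow> real \<Rightarrow> real \<Rightarrow> real \<Rightarrow> real" where
  "Psi r s \<alpha> \<beta> = hit (r + s) (\<alpha> + \<beta>) * ncdf (- score r s \<alpha> \<beta> 0)
     + hit (r + s) (\<alpha> - \<beta>) * ncdf (- score r s (- \<alpha>) \<beta> 0)"

lemma dirichlet_hit_integral:
  assumes r: "0 < r" and s: "0 < s" and \<alpha>: "0 \<le> \<alpha>" and \<beta>: "0 \<le> \<beta>"
  shows "(\<integral>\<^sup>+c\<in>{0<..}. ennreal (dirichlet r \<alpha> c * hit s (c + \<beta>)) \<partial>lborel) = ennreal (Psi r s \<alpha> \<beta>)"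
    and "0 \<le> Psi r s \<alpha> \<beta>"
proof -
  \<comment> \<open>The linear factor \<open>(c + \<beta>) / s\<close> is the constant
    \<open>(\<alpha> + \<beta>) / (r + s)\<close> minus \<open>2 * r / (r + s)\<close> times the
    logarithmic derivative of the Gaussian product; this fixes both coefficients.\<close>
  define F where "F = (\<lambda>\<alpha> c. (\<alpha> + \<beta>) / (r + s) * (gauss (r + s) (\<alpha> + \<beta>) * ncdf (score r s \<alpha> \<beta> c))
    - 2 * r / (r + s) * (gauss r (\<alpha> - c) * gauss s (c + \<beta>)))"
  have F: "(F \<alpha> has_real_derivative gauss r (\<alpha> - c) * hit s (c + \<beta>)) (at c)" for \<alpha> c
  proof -
    have "(\<alpha> + \<beta>) / (r + s) - 2 * r / (r + s) * ((\<alpha> - c) / (2 * r) - (c + \<beta>) / (2 * s)) = (c + \<beta>) / s"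
      using r s by (simp add: divide_simps add_pos_pos[THEN less_imp_neq[THEN not_sym]]) algebra
    then have "(\<alpha> + \<beta>) / (r + s) * X - 2 * r / (r + s) * (((\<alpha> - c) / (2 * r) - (c + \<beta>) / (2 * s)) * X)
        = (c + \<beta>) / s * X" for X
      by (metis (no_types) left_diff_distrib mult.assoc)
    moreover have "(F \<alpha> has_real_derivative (\<alpha> + \<beta>) / (r + s) * (gauss r (\<alpha> - c) * gauss s (c + \<beta>))
      - 2 * r / (r + s) * (((\<alpha> - c) / (2 * r) - (c + \<beta>) / (2 * s)) * (gauss r (\<alpha> - c) * gauss s (c + \<beta>)))) (at c)"
      unfolding F_def using r s
      by (intro DERIV_cmult DERIV_diff DERIV_ncdf_score DERIV_gauss_mult_gauss)
    ultimately have "(F \<alpha> has_real_derivative (c + \<beta>) / s * (gauss r (\<alpha> - c) * gauss s (c + \<beta>))) (at c)"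
      by (simp only:)
    then show ?thesis by (rule DERIV_cong) (simp add: hit_def)
  qed
  \<comment> \<open>Since \<open>gauss\<close> is even, the image at \<open>- \<alpha>\<close>
    cancels the Gaussian products at \<open>c = 0\<close>, and \<open>Psi\<close> contains normal
    probabilities only.\<close>
  define H where "H = (\<lambda>c. F \<alpha> c - F (- \<alpha>) c)"
  define T where "T = ((\<alpha> + \<beta>) / (r + s) * (gauss (r + s) (\<alpha> + \<beta>) * 1) - 2 * r / (r + s) * 0)
    - ((- \<alpha> + \<beta>) / (r + s) * (gauss (r + s) (- \<alpha> + \<beta>) * 1) - 2 * r / (r + s) * 0)"
  have H: "(H has_real_derivative dirichlet r \<alpha> c * hit s (c + \<beta>)) (at c)" for c
  proof -
    have "gauss r (- \<alpha> - c) = gauss r (\<alpha> + c)"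
      using gauss_minus[of r "\<alpha> + c"] by (simp add: algebra_simps)
    then show ?thesis
      unfolding H_def
      by (intro DERIV_cong[OF DERIV_diff[OF F[of \<alpha> c] F[of "- \<alpha>" c]]]) (simp add: dirichlet_def left_diff_distrib)
  qed
  have T: "(H \<longlongrightarrow> T) at_top"
    unfolding H_def F_def T_def using r s
    by (intro tendsto_intros ncdf_score_at_top gauss_mult_gauss_tendsto_0)
  have nn: "0 \<le> dirichlet r \<alpha> c * hit s (c + \<beta>)" if "0 \<le> c" for c
    using that assms by (intro mult_nonneg_nonneg dirichlet_nonneg hit_nonneg) auto
  have "gauss (r + s) (\<beta> - \<alpha>) = gauss (r + s) (\<alpha> - \<beta>)"
    using gauss_minus[of "r + s" "\<alpha> - \<beta>"] by simp
  then have "T - H 0 = Psi r s \<alpha> \<beta>"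
    by (simp add: T_def H_def F_def Psi_def hit_def ncdf_minus diff_divide_distrib add_divide_distrib algebra_simps)
  then show "(\<integral>\<^sup>+c\<in>{0<..}. ennreal (dirichlet r \<alpha> c * hit s (c + \<beta>)) \<partial>lborel) = ennreal (Psi r s \<alpha> \<beta>)"
    and "0 \<le> Psi r s \<alpha> \<beta>"
    using nn_integral_FTC_greaterThan[of "\<lambda>c. dirichlet r \<alpha> c * hit s (c + \<beta>)" 0 H T, OF _ H nn T] by auto
qed

text \<open>Exchanging \<open>(r, \<alpha>)\<close> with \<open>(s, \<beta>)\<close> changes the
  sign of \<open>score\<close> in the direct terms, whose probabilities therefore add up to 1. In
  the image terms the probabilities agree while \<open>hit\<close> changes sign, so these cancel.
  This evaluates the hitting-then-Dirichlet integral by means of the Dirichlet-then-hitting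
  one.\<close>

lemma Psi_swap: "Psi r s \<alpha> \<beta> + Psi s r \<beta> \<alpha> = hit (r + s) (\<alpha> + \<beta>)"
proof -
  have "score s r (- \<beta>) \<alpha> 0 = score r s (- \<alpha>) \<beta> 0"
    using score_swap[of s r "- \<beta>" \<alpha>] score_uminus[of r s "- \<alpha>" \<beta>] by simp
  moreover have "hit (s + r) (\<beta> - \<alpha>) = - hit (r + s) (\<alpha> - \<beta>)"
    using hit_minus[of "r + s" "\<alpha> - \<beta>"] by (simp add: add.commute)
  ultimately show ?thesis
    unfolding Psi_def score_swap[of s r \<beta> \<alpha>] ncdf_minus by (simp add: add.commute algebra_simps)
qed

text \<open>Closed form of the integral of \<open>hit r (\<alpha> + c) * hit s (c + \<beta>)\<close>
  over \<open>c > 0\<close>. The first summand is the Gaussian tail, the second the value at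
  \<open>c = 0\<close> of the polynomial part of the antiderivative.\<close>

definition hit_hit :: "real \<Rightarrow> real \<Rightarrow> real \<Rightarrow> real \<Rightarrow> real" where
  "hit_hit r s \<alpha> \<beta> =
     2 / (r + s) * (1 - (\<alpha> - \<beta>)\<^sup>2 / (2 * (r + s))) * (gauss (r + s) (\<alpha> - \<beta>) * ncdf (- score r s (- \<alpha>) \<beta> 0))
     + 2 / (r + s) * ((\<alpha> * s + \<beta> * r) / (r + s) + (\<alpha> - \<beta>) * (r - s) / (r + s)) * (gauss r \<alpha> * gauss s \<beta>)"

lemma hit_hit_integral:
  assumes r: "0 < r" and s: "0 < s" and \<alpha>: "0 \<le> \<alpha>" and \<beta>: "0 \<le> \<beta>"
  shows "(\<integral>\<^sup>+c\<in>{0<..}. ennreal (hit r (\<alpha> + c) * hit s (c + \<beta>)) \<partial>lborel) = ennreal (hit_hit r s \<alpha> \<beta>)"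
    and "0 \<le> hit_hit r s \<alpha> \<beta>"
proof -
  \<comment> \<open>The antiderivative is sought as \<open>\<kappa>\<close> times the normal part
    minus a multiple of \<open>(c + \<delta>) * g c\<close>. Comparing coefficients with
    \<open>(\<alpha> + c) * (c + \<beta>) / (r * s)\<close>, the square of \<open>c\<close> gives
    the factor \<open>2 / (r + s)\<close>, the linear term gives \<open>\<delta>\<close> and the
    constant term gives \<open>\<kappa>\<close>.\<close>
  define \<kappa> where "\<kappa> = 2 / (r + s) * (1 - (\<alpha> - \<beta>)\<^sup>2 / (2 * (r + s)))"
  define \<delta> where "\<delta> = (\<alpha> * s + \<beta> * r) / (r + s) + (\<alpha> - \<beta>) * (r - s) / (r + s)"
  define g where "g = (\<lambda>c. gauss r (- \<alpha> - c) * gauss s (c + \<beta>))"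
  define H where "H = (\<lambda>c. \<kappa> * (gauss (r + s) (- \<alpha> + \<beta>) * ncdf (score r s (- \<alpha>) \<beta> c))
    - 2 / (r + s) * ((c + \<delta>) * g c))"
  have gd: "(g has_real_derivative ((- \<alpha> - c) / (2 * r) - (c + \<beta>) / (2 * s)) * g c) (at c)" for c
    unfolding g_def by (rule DERIV_gauss_mult_gauss[OF r s])
  have H: "(H has_real_derivative hit r (\<alpha> + c) * hit s (c + \<beta>)) (at c)" for c
  proof -
    have "((\<lambda>c. (c + \<delta>) * g c) has_real_derivative
        (c + \<delta>) * (((- \<alpha> - c) / (2 * r) - (c + \<beta>) / (2 * s)) * g c) + 1 * g c) (at c)"
      by (auto intro!: derivative_eq_intros gd)
    then have "(H has_real_derivative \<kappa> * g c
      - 2 / (r + s) * ((c + \<delta>) * (((- \<alpha> - c) / (2 * r) - (c + \<beta>) / (2 * s)) * g c) + 1 * g c)) (at c)"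
      unfolding H_def using DERIV_ncdf_score[OF r s, of "- \<alpha>" \<beta> c]
      by (intro DERIV_cmult DERIV_diff) (simp_all add: g_def)
    then have "(H has_real_derivative
        (\<kappa> - 2 / (r + s) * ((c + \<delta>) * ((- \<alpha> - c) / (2 * r) - (c + \<beta>) / (2 * s)) + 1)) * g c) (at c)"
      by (rule DERIV_cong) (simp only: left_diff_distrib distrib_right mult.assoc)
    moreover have "\<kappa> - 2 / (r + s) * ((c + \<delta>) * ((- \<alpha> - c) / (2 * r) - (c + \<beta>) / (2 * s)) + 1)
        = (\<alpha> + c) * (c + \<beta>) / (r * s)"
      unfolding \<kappa>_def \<delta>_def
      using r s by (simp add: divide_simps add_pos_pos[THEN less_imp_neq[THEN not_sym]]) algebra
    moreover have "g c = gauss r (\<alpha> + c) * gauss s (c + \<beta>)"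
      using gauss_minus[of r "\<alpha> + c"] by (simp add: g_def)
    ultimately have "(H has_real_derivative
        (\<alpha> + c) * (c + \<beta>) / (r * s) * (gauss r (\<alpha> + c) * gauss s (c + \<beta>))) (at c)"
      by (simp only:)
    then show ?thesis by (rule DERIV_cong) (simp add: hit_def)
  qed
  define T where "T = \<kappa> * (gauss (r + s) (- \<alpha> + \<beta>) * 1) - 2 / (r + s) * 0"
  have T: "(H \<longlongrightarrow> T) at_top"
    unfolding H_def T_def g_def using r s
    by (intro tendsto_intros ncdf_score_at_top gauss_mult_gauss_tendsto_0)
  have nn: "0 \<le> hit r (\<alpha> + c) * hit s (c + \<beta>)" if "0 \<le> c" for c
    using that assms by (intro mult_nonneg_nonneg hit_nonneg) auto
  have "gauss (r + s) (\<beta> - \<alpha>) = gauss (r + s) (\<alpha> - \<beta>)"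
    using gauss_minus[of "r + s" "\<alpha> - \<beta>"] by simp
  then have "T - H 0 = hit_hit r s \<alpha> \<beta>"
    unfolding hit_hit_def \<kappa>_def[symmetric] \<delta>_def[symmetric]
    by (simp add: T_def H_def g_def ncdf_minus algebra_simps)
  then show "(\<integral>\<^sup>+c\<in>{0<..}. ennreal (hit r (\<alpha> + c) * hit s (c + \<beta>)) \<partial>lborel) = ennreal (hit_hit r s \<alpha> \<beta>)"
    and "0 \<le> hit_hit r s \<alpha> \<beta>"
    using nn_integral_FTC_greaterThan[of "\<lambda>c. hit r (\<alpha> + c) * hit s (c + \<beta>)" 0 H T, OF _ H nn T] by auto
qed

section \<open>Derivative and limits of \<open>Psi\<close> at fixed total time\<close>

lemma DERIV_hit:
  assumes "0 < t"
  shows "(hit t has_real_derivative (1 - z\<^sup>2 / (2 * t)) / t * gauss t z) (at z)"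
proof -
  have "((\<lambda>z. z / t * gauss t z) has_real_derivative 1 / t * gauss t z + - z / (2 * t) * gauss t z * 1 * (z / t)) (at z)"
    using assms by (intro derivative_intros DERIV_cdivide) auto
  then show ?thesis
    unfolding hit_def[abs_def] by (rule DERIV_cong) (use assms in \<open>simp add: field_simps power2_eq_square\<close>)
qed

text \<open>With the denominator of the mean absorbed into the root, a fixed sum
  \<open>r + s\<close> leaves a polynomial over the root of a polynomial, which is easy to
  differentiate and shows the behaviour at both ends.\<close>

lemma minus_score_0:
  assumes "0 < r" "0 < s"
  shows "- score r s \<alpha> \<beta> 0 = (\<alpha> * s - \<beta> * r) / sqrt (2 * r * s * (r + s))"
proof -
  have "sqrt (2 * r * s * (r + s)) = sqrt (2 * r * s / (r + s) * (r + s)\<^sup>2)"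
    using assms by (simp add: power2_eq_square)
  also have "\<dots> = sqrt (2 * r * s / (r + s)) * (r + s)"
    using assms by (subst real_sqrt_mult) simp
  finally show ?thesis by (simp add: score_def mult.commute)
qed

text \<open>The case \<open>c = 0\<close> of \<open>gauss_mult_gauss\<close>. It turns each
  derivative of \<open>ncdf\<close> in \<open>Psi\<close> back into a product of Gaussians at the
  boundary.\<close>

lemma gauss_mult_std_normal_density:
  assumes "0 < r" "0 < s"
  shows "gauss (r + s) (\<alpha> + \<beta>) * std_normal_density ((\<alpha> * s - \<beta> * r) / sqrt (2 * r * s * (r + s)))
    / sqrt (2 * r * s * (r + s)) = gauss r \<alpha> * gauss s \<beta> / (r + s)"
proof -
  have "sqrt (2 * r * s * (r + s)) = sqrt (2 * r * s / (r + s) * (r + s)\<^sup>2)"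
    using assms by (simp add: power2_eq_square)
  also have "\<dots> = sqrt (2 * r * s / (r + s)) * (r + s)"
    using assms by (subst real_sqrt_mult) simp
  finally have *: "sqrt (2 * r * s * (r + s)) = sqrt (2 * r * s / (r + s)) * (r + s)" .
  have "std_normal_density (- score r s \<alpha> \<beta> 0) = std_normal_density (score r s \<alpha> \<beta> 0)"
    by (simp add: std_normal_density_def)
  then show ?thesis
    unfolding minus_score_0[OF assms, symmetric]
    using gauss_mult_gauss[OF assms, of \<alpha> 0 \<beta>] by (simp add: * score_def)
qed

text \<open>Comparison of the coefficients of \<open>gauss r \<alpha> * gauss s \<beta>\<close> in
  \<open>DERIV_Psi\<close>: the left side collects the derivatives of the two \<open>ncdf\<close>
  factors, the right side the boundary part of \<open>hit_hit\<close> and the product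
  \<open>hit r \<alpha> * hit s \<beta>\<close>. Denominators are cleared with \<open>r + s\<close>
  kept as one symbol, which leaves the polynomial identity \<open>key\<close>.\<close>

lemma DERIV_Psi_algebra:
  fixes \<alpha> \<beta> r s :: real
  assumes "0 < r" "0 < s"
  shows "(\<alpha> + \<beta>) / (r + s) * (1 / (r + s)) * (- (\<alpha> + r + (\<beta> + s)) - (\<alpha> * s - \<beta> * r) * (s - r) / (2 * r * s))
      + (\<alpha> - \<beta>) / (r + s) * (1 / (r + s)) * ((\<alpha> + r - (\<beta> + s) + 2 * (r + s) - 4 * r) - (- \<alpha> * s - \<beta> * r) * (s - r) / (2 * r * s))
      = - (2 / (r + s) * ((\<alpha> * s + \<beta> * r) / (r + s) + (\<alpha> - \<beta>) * (r - s) / (r + s)) + \<alpha> * \<beta> / (r * s))"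
proof -
  define R where "R = r + s"
  have nz: "R \<noteq> 0" "r \<noteq> 0" "s \<noteq> 0" using assms by (auto simp: R_def)
  have "(\<alpha> + \<beta>) * (- (\<alpha> + r + (\<beta> + s)) * (2 * r * s) - (\<alpha> * s - \<beta> * r) * (s - r))
      + (\<alpha> - \<beta>) * ((\<alpha> + r - (\<beta> + s) + 2 * R - 4 * r) * (2 * r * s) - (- \<alpha> * s - \<beta> * r) * (s - r))
      = - (4 * r * s * (\<alpha> * s + \<beta> * r + (\<alpha> - \<beta>) * (r - s)) + 2 * \<alpha> * \<beta> * R\<^sup>2)"
    unfolding R_def by algebra
  note key = this
  have 1: "x / R * (1 / R) * (p - q / (2 * r * s)) = x * (p * (2 * r * s) - q) / (2 * r * s * R\<^sup>2)" for x p q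
    using nz by (simp add: field_simps power2_eq_square)
  have 2: "- (2 / R * (p / R + q / R) + \<alpha> * \<beta> / (r * s))
      = - (4 * r * s * (p + q) + 2 * \<alpha> * \<beta> * R\<^sup>2) / (2 * r * s * R\<^sup>2)" for p q
    using nz by (simp add: field_simps power2_eq_square)
  show ?thesis
    unfolding R_def[symmetric] 1 2 unfolding add_divide_distrib[symmetric] key ..
qed
text \<open>Along the line \<open>\<alpha> + r = A\<close>, \<open>\<beta> + s = B\<close>, \<open>r + s = R\<close> the two factors of the integral in
  \<open>dirichlet_hit_integral\<close> solve a forward and a backward heat equation with drift, so that only boundary
  terms and the \<open>hit\<close>-\<open>hit\<close> interaction survive in the derivative. The closed form of \<open>Psi\<close> makes
  this a direct computation.\<close>

lemma DERIV_Psi: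
  assumes r: "0 < r" "r < R"
  shows "((\<lambda>r. Psi r (R - r) (A - r) (B - (R - r))) has_real_derivative
    - (hit_hit r (R - r) (A - r) (B - (R - r)) + hit r (A - r) * hit (R - r) (B - (R - r)))) (at r)"
proof -
  define s where "s = R - r"
  define \<alpha> where "\<alpha> = A - r"
  define \<beta> where "\<beta> = B - s"
  \<comment> \<open>By \<open>minus_score_0\<close> the arguments of \<open>ncdf\<close> are
    \<open>N1 / sqrt V\<close> for the starting point \<open>A - r\<close> and
    \<open>N2 / sqrt V\<close> for its image. The sum of the two positions is constantly
    \<open>A + B - R\<close>, so the direct \<open>hit\<close> factor does not move; the image
    factor depends on their difference \<open>D\<close>.\<close>
  define V where "V = (\<lambda>r. 2 * r * (R - r) * R)"
  define N1 where "N1 = (\<lambda>r. (A - r) * (R - r) - (B - (R - r)) * r)"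
  define N2 where "N2 = (\<lambda>r. - (A - r) * (R - r) - (B - (R - r)) * r)"
  define D where "D = (\<lambda>r. (A - r) - (B - (R - r)))"
  have R: "0 < R" and s: "0 < s" and Rrs: "R = r + s" using r by (auto simp: s_def)
  have V: "V r = 2 * r * s * (r + s)" by (simp add: V_def s_def)
  have Vpos: "0 < V r" unfolding V using r s by simp
  have Psi: "Psi x (R - x) (A - x) (B - (R - x))
      = hit R (A + B - R) * ncdf (N1 x / sqrt (V x)) + hit R (D x) * ncdf (N2 x / sqrt (V x))"
    if "x \<in> {0<..<R}" for x
    using that unfolding Psi_def by (simp add: minus_score_0 N1_def N2_def D_def V_def algebra_simps)
  define dV where "dV = 2 * R * (s - r)"
  have dV: "(V has_real_derivative dV) (at r)"
    unfolding V_def dV_def s_def by (auto intro!: derivative_eq_intros simp: algebra_simps)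
  have quot: "((\<lambda>x. ncdf (N x / sqrt (V x))) has_real_derivative
      std_normal_density (N r / sqrt (V r)) / sqrt (V r) * (dN - N r * (s - r) / (2 * r * s))) (at r)"
    if N: "(N has_real_derivative dN) (at r)" for N dN
  proof -
    have "((\<lambda>x. sqrt (V x)) has_real_derivative inverse (sqrt (V r)) / 2 * dV) (at r)"
      using Vpos by (intro DERIV_chain2[OF DERIV_real_sqrt dV])
    from DERIV_divide[OF N this] have "((\<lambda>x. N x / sqrt (V x)) has_real_derivative
        (dN * sqrt (V r) - N r * (inverse (sqrt (V r)) / 2 * dV)) / (sqrt (V r) * sqrt (V r))) (at r)"
      using Vpos by simp
    moreover have "(dN * sqrt (V r) - N r * (inverse (sqrt (V r)) / 2 * dV)) / (sqrt (V r) * sqrt (V r))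
        = (dN - N r * (dV / (2 * V r))) / sqrt (V r)"
      using Vpos by (simp add: field_simps)
    moreover have "dV / (2 * V r) = (s - r) / (2 * r * s)"
      unfolding dV_def V Rrs[symmetric] using r s R by (simp add: field_simps)
    ultimately have "((\<lambda>x. N x / sqrt (V x)) has_real_derivative
        (dN - N r * ((s - r) / (2 * r * s))) / sqrt (V r)) (at r)"
      by simp
    from DERIV_ncdf_chain[OF this] show ?thesis
      by (rule DERIV_cong) simp
  qed
  have dN1: "(N1 has_real_derivative - (A + B)) (at r)"
    unfolding N1_def by (auto intro!: derivative_eq_intros simp: algebra_simps)
  have dN2: "(N2 has_real_derivative (A - B + 2 * R - 4 * r)) (at r)"
    unfolding N2_def by (auto intro!: derivative_eq_intros simp: algebra_simps)
  have dD: "(D has_real_derivative - 2) (at r)"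
    unfolding D_def by (auto intro!: derivative_eq_intros)
  \<comment> \<open>The derivatives of \<open>ncdf\<close> all become multiples of \<open>E\<close>.
    Terms with \<open>w\<close> (defined below) arise only from differentiating
    \<open>hit R (D x)\<close>, and they match the Gaussian tail in \<open>hit_hit\<close>; so the
    two kinds can be compared separately.\<close>
  define E where "E = gauss r \<alpha> * gauss s \<beta>"
  have D: "D r = \<alpha> - \<beta>" by (simp add: D_def \<alpha>_def \<beta>_def s_def)
  have AB: "A + B - R = \<alpha> + \<beta>" by (simp add: \<alpha>_def \<beta>_def s_def)
  have N1: "N1 r = \<alpha> * s - \<beta> * r" and N2: "N2 r = - \<alpha> * s - \<beta> * r"
    by (simp_all add: N1_def N2_def \<alpha>_def \<beta>_def s_def)
  have E1: "gauss R (\<alpha> + \<beta>) * std_normal_density (N1 r / sqrt (V r)) / sqrt (V r) = E / R"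
    using gauss_mult_std_normal_density[OF r(1) s, of \<alpha> \<beta>] by (simp add: N1 V E_def Rrs)
  have "gauss R (\<alpha> - \<beta>) = gauss R (- \<alpha> + \<beta>)"
    using gauss_minus[of R "\<alpha> - \<beta>"] by simp
  then have E2: "gauss R (\<alpha> - \<beta>) * std_normal_density (N2 r / sqrt (V r)) / sqrt (V r) = E / R"
    using gauss_mult_std_normal_density[OF r(1) s, of "- \<alpha>" \<beta>] by (simp add: N2 V E_def Rrs)
  define w where "w = ncdf (N2 r / sqrt (V r))"
  have d1: "((\<lambda>x. hit R (A + B - R) * ncdf (N1 x / sqrt (V x))) has_real_derivative
      (\<alpha> + \<beta>) / R * (E / R) * (- (A + B) - N1 r * (s - r) / (2 * r * s))) (at r)"
    by (rule DERIV_cong[OF DERIV_cmult[OF quot[OF dN1]]]) (simp add: AB hit_def E1[symmetric])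
  have dhit: "((\<lambda>x. hit R (D x)) has_real_derivative
      (1 - (\<alpha> - \<beta>)\<^sup>2 / (2 * R)) / R * gauss R (\<alpha> - \<beta>) * - 2) (at r)"
    using DERIV_chain2[OF DERIV_hit[OF R] dD] by (simp only: D)
  have d2: "((\<lambda>x. hit R (D x) * ncdf (N2 x / sqrt (V x))) has_real_derivative
      (1 - (\<alpha> - \<beta>)\<^sup>2 / (2 * R)) / R * gauss R (\<alpha> - \<beta>) * - 2 * w
      + (\<alpha> - \<beta>) / R * (E / R) * ((A - B + 2 * R - 4 * r) - N2 r * (s - r) / (2 * r * s))) (at r)"
    by (rule DERIV_cong[OF DERIV_mult[OF dhit quot[OF dN2]]]) (simp add: D w_def hit_def E2[symmetric] ac_simps)
  have hh: "hit_hit r s \<alpha> \<beta> = 2 / R * (1 - (\<alpha> - \<beta>)\<^sup>2 / (2 * R)) * (gauss R (\<alpha> - \<beta>) * w)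
     + 2 / R * ((\<alpha> * s + \<beta> * r) / R + (\<alpha> - \<beta>) * (r - s) / R) * E"
    unfolding hit_hit_def minus_score_0[OF r(1) s] w_def N2 V E_def Rrs by simp
  have pp: "hit r \<alpha> * hit s \<beta> = \<alpha> * \<beta> / (r * s) * E"
    by (simp add: hit_def E_def)
  have "(\<alpha> + \<beta>) / R * (1 / R) * (- (A + B) - N1 r * (s - r) / (2 * r * s))
      + (\<alpha> - \<beta>) / R * (1 / R) * ((A - B + 2 * R - 4 * r) - N2 r * (s - r) / (2 * r * s))
      = - (2 / R * ((\<alpha> * s + \<beta> * r) / R + (\<alpha> - \<beta>) * (r - s) / R) + \<alpha> * \<beta> / (r * s))"
  proof -
    have "A = \<alpha> + r" "B = \<beta> + s" by (simp_all add: \<alpha>_def \<beta>_def)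
    moreover have "r + s \<noteq> 0" "r \<noteq> 0" "s \<noteq> 0" using r s by auto
    ultimately show ?thesis
      unfolding N1 N2 Rrs by (simp only: DERIV_Psi_algebra[OF r(1) s])
  qed
  note key = this
  have scale: "x / R * (E / R) * p = x / R * (1 / R) * p * E" for x p
    by simp
  have "(\<alpha> + \<beta>) / R * (E / R) * (- (A + B) - N1 r * (s - r) / (2 * r * s))
      + (\<alpha> - \<beta>) / R * (E / R) * ((A - B + 2 * R - 4 * r) - N2 r * (s - r) / (2 * r * s))
      = - (2 / R * ((\<alpha> * s + \<beta> * r) / R + (\<alpha> - \<beta>) * (r - s) / R) * E + \<alpha> * \<beta> / (r * s) * E)"
    unfolding scale distrib_right[symmetric] key by (rule mult_minus_left)
  then have "(\<alpha> + \<beta>) / R * (E / R) * (- (A + B) - N1 r * (s - r) / (2 * r * s))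
      + (- x + (\<alpha> - \<beta>) / R * (E / R) * ((A - B + 2 * R - 4 * r) - N2 r * (s - r) / (2 * r * s)))
      = - (x + 2 / R * ((\<alpha> * s + \<beta> * r) / R + (\<alpha> - \<beta>) * (r - s) / R) * E + \<alpha> * \<beta> / (r * s) * E)" for x
    by linarith
  moreover have "(1 - (\<alpha> - \<beta>)\<^sup>2 / (2 * R)) / R * gauss R (\<alpha> - \<beta>) * - 2 * w
      = - (2 / R * (1 - (\<alpha> - \<beta>)\<^sup>2 / (2 * R)) * (gauss R (\<alpha> - \<beta>) * w))"
    by simp
  ultimately have total: "(\<alpha> + \<beta>) / R * (E / R) * (- (A + B) - N1 r * (s - r) / (2 * r * s))
      + ((1 - (\<alpha> - \<beta>)\<^sup>2 / (2 * R)) / R * gauss R (\<alpha> - \<beta>) * - 2 * w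
        + (\<alpha> - \<beta>) / R * (E / R) * ((A - B + 2 * R - 4 * r) - N2 r * (s - r) / (2 * r * s)))
      = - (hit_hit r s \<alpha> \<beta> + hit r \<alpha> * hit s \<beta>)"
    unfolding hh pp by (simp only:)
  have "((\<lambda>r. Psi r (R - r) (A - r) (B - (R - r))) has_real_derivative
      - (hit_hit r s \<alpha> \<beta> + hit r \<alpha> * hit s \<beta>)) (at r)"
  \<comment> \<open>The form with \<open>N1\<close>, \<open>N2\<close> and \<open>V\<close> agrees
    with \<open>Psi\<close> for \<open>0 < x < R\<close> only; a neighbourhood of \<open>r\<close>
    is enough.\<close>
  proof (rule has_field_derivative_transform_within_open)
    show "((\<lambda>x. hit R (A + B - R) * ncdf (N1 x / sqrt (V x)) + hit R (D x) * ncdf (N2 x / sqrt (V x)))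
        has_real_derivative - (hit_hit r s \<alpha> \<beta> + hit r \<alpha> * hit s \<beta>)) (at r)"
      using DERIV_add[OF d1 d2] by (simp only: total)
    show "open {0<..<R}" "r \<in> {0<..<R}" using r by auto
  qed (simp add: Psi)
  then show ?thesis by (simp add: s_def \<alpha>_def \<beta>_def)
qed

text \<open>\<open>V\<close> vanishes at both ends, so the arguments of \<open>ncdf\<close> diverge
  with the signs of the numerators. At 0 these are \<open>A * R\<close> and \<open>- A * R\<close>,
  which keeps the direct term and removes the image; at \<open>R\<close> both equal
  \<open>- B * R\<close>, which removes everything.\<close>

lemma Psi_limits:
  assumes R: "0 < R"
  shows Psi_at_right: "0 < A \<Longrightarrow> ((\<lambda>r. Psi r (R - r) (A - r) (B - (R - r))) \<longlongrightarrow> hit R (A + B - R)) (at_right 0)"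
    and Psi_at_left: "0 < B \<Longrightarrow> ((\<lambda>r. Psi r (R - r) (A - r) (B - (R - r))) \<longlongrightarrow> 0) (at_left R)"
proof -
  define V where "V = (\<lambda>r. 2 * r * (R - r) * R)"
  define N1 where "N1 = (\<lambda>r. (A - r) * (R - r) - (B - (R - r)) * r)"
  define N2 where "N2 = (\<lambda>r. - (A - r) * (R - r) - (B - (R - r)) * r)"
  define D where "D = (\<lambda>r. (A - r) - (B - (R - r)))"
  have Psi: "Psi x (R - x) (A - x) (B - (R - x))
      = hit R (A + B - R) * ncdf (N1 x * inverse (sqrt (V x))) + hit R (D x) * ncdf (N2 x * inverse (sqrt (V x)))"
    if "0 < x" "x < R" for x
    using that unfolding Psi_def
    by (simp add: minus_score_0 N1_def N2_def D_def V_def algebra_simps divide_inverse)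
  have Vpos: "0 < V r" if "0 < r" "r < R" for r
    using that R by (simp add: V_def)
  have cD: "isCont (\<lambda>x. hit R (D x)) x" for x
    unfolding hit_def gauss_def D_def using R by (intro continuous_intros) auto
  have cN: "isCont N1 x" "isCont N2 x" for x
    unfolding N1_def N2_def by (intro continuous_intros)+
  have lim: "(f \<longlongrightarrow> f x) (at x within S)" if "isCont f x" for f :: "real \<Rightarrow> real" and x S
    by (rule tendsto_within_subset[OF that[unfolded isCont_def]]) simp
  have cV: "((\<lambda>x. sqrt (V x)) \<longlongrightarrow> sqrt (V x)) (at x within S)" for x S
    unfolding V_def by (rule lim) (intro continuous_intros)
  have ev0: "eventually (\<lambda>r. 0 < r \<and> r < R) (at_right 0)"
    unfolding eventually_at_right_field using R by blast
  have evR: "eventually (\<lambda>r. 0 < r \<and> r < R) (at_left R)"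
    unfolding eventually_at_left_field using R by blast
  have inv0: "filterlim (\<lambda>r. inverse (sqrt (V r))) at_top (at_right 0)"
    by (rule filterlim_inverse_at_top) (use cV[of 0 "{0<..}"] ev0 Vpos in \<open>auto simp: V_def elim!: eventually_mono\<close>)
  have invR: "filterlim (\<lambda>r. inverse (sqrt (V r))) at_top (at_left R)"
    by (rule filterlim_inverse_at_top) (use cV[of R "{..<R}"] evR Vpos in \<open>auto simp: V_def elim!: eventually_mono\<close>)
  have pos: "((\<lambda>x. ncdf (N x * inverse (sqrt (V x)))) \<longlongrightarrow> 1) F"
    if "filterlim (\<lambda>r. inverse (sqrt (V r))) at_top F" "(N \<longlongrightarrow> c) F" "0 < c" for N c F
    by (rule filterlim_compose[OF ncdf_at_top]) (rule filterlim_tendsto_pos_mult_at_top[OF that(2,3,1)])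
  have neg: "((\<lambda>x. ncdf (N x * inverse (sqrt (V x)))) \<longlongrightarrow> 0) F"
    if "filterlim (\<lambda>r. inverse (sqrt (V r))) at_top F" "(N \<longlongrightarrow> c) F" "c < 0" for N c F
    by (rule filterlim_compose[OF ncdf_at_bot]) (rule filterlim_tendsto_neg_mult_at_bot[OF that(2,3,1)])
  show "((\<lambda>r. Psi r (R - r) (A - r) (B - (R - r))) \<longlongrightarrow> hit R (A + B - R)) (at_right 0)" if A: "0 < A"
  proof -
    have "((\<lambda>x. hit R (A + B - R) * ncdf (N1 x * inverse (sqrt (V x))) + hit R (D x) * ncdf (N2 x * inverse (sqrt (V x))))
        \<longlongrightarrow> hit R (A + B - R) * 1 + hit R (D 0) * 0) (at_right 0)"
      using A R
      by (intro tendsto_intros pos[OF inv0 lim[OF cN(1)]] neg[OF inv0 lim[OF cN(2)]] lim[OF cD])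
        (auto simp: N1_def N2_def)
    then show ?thesis
      by (rule Lim_transform_eventually[rotated, THEN tendsto_eq_rhs, rotated])
        (use ev0 in \<open>auto simp: Psi elim!: eventually_mono\<close>)
  qed
  show "((\<lambda>r. Psi r (R - r) (A - r) (B - (R - r))) \<longlongrightarrow> 0) (at_left R)" if B: "0 < B"
  proof -
    have "((\<lambda>x. hit R (A + B - R) * ncdf (N1 x * inverse (sqrt (V x))) + hit R (D x) * ncdf (N2 x * inverse (sqrt (V x))))
        \<longlongrightarrow> hit R (A + B - R) * 0 + hit R (D R) * 0) (at_left R)"
      using B R
      by (intro tendsto_intros neg[OF invR lim[OF cN(1)]] neg[OF invR lim[OF cN(2)]] lim[OF cD])
        (auto simp: N1_def N2_def)
    then show ?thesis
      by (rule Lim_transform_eventually[rotated, THEN tendsto_eq_rhs, rotated])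
        (use evR in \<open>auto simp: Psi elim!: eventually_mono\<close>)
  qed
qed

section \<open>The identity for a fixed interior time\<close>

text \<open>By \<open>DERIV_Psi\<close> the integrand is the derivative of \<open>- Psi\<close>. The
  interval may reach 0 or \<open>R\<close>, where only one-sided limits are at hand, so
  \<open>L\<close> and \<open>U\<close> enter as hypotheses. The bounds on \<open>A\<close> and
  \<open>B\<close> keep both positions nonnegative; the resulting sign of the integrand yields its
  integrability.\<close>

lemma interaction_integral:
  assumes lu: "0 \<le> l" "l < u" "u \<le> R" and A: "u \<le> A" and B: "R - l \<le> B"
    and L: "((\<lambda>r. Psi r (R - r) (A - r) (B - (R - r))) \<longlongrightarrow> L) (at_right l)"
    and U: "((\<lambda>r. Psi r (R - r) (A - r) (B - (R - r))) \<longlongrightarrow> U) (at_left u)"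
  shows "(\<integral>\<^sup>+r\<in>{l<..<u}. ennreal (hit_hit r (R - r) (A - r) (B - (R - r)) + hit r (A - r) * hit (R - r) (B - (R - r))) \<partial>lborel)
      = ennreal (L - U)" and "U \<le> L"
proof -
  define f where "f = (\<lambda>r. hit_hit r (R - r) (A - r) (B - (R - r)) + hit r (A - r) * hit (R - r) (B - (R - r)))"
  define F where "F = (\<lambda>r. - Psi r (R - r) (A - r) (B - (R - r)))"
  have f_nonneg: "0 \<le> f r" if "l < r" "r < u" for r
    unfolding f_def using that lu A B
    by (intro add_nonneg_nonneg mult_nonneg_nonneg hit_nonneg hit_hit_integral(2)) auto
  have F: "(F has_real_derivative f r) (at r)" if "l < r" "r < u" for r
    unfolding F_def f_def using that lu
    by (intro DERIV_cong[OF DERIV_minus[OF DERIV_Psi]]) auto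
  have f_cont: "isCont f r" if "l < r" "r < u" for r
  proof -
    have "0 < r" "r < R" using that lu by auto
    then show ?thesis
      unfolding f_def hit_hit_def hit_def gauss_def score_def
      by (intro continuous_intros isCont_o2[OF _ isCont_ncdf]) auto
  qed
  have FTC: "set_integrable lborel (einterval l u) f" "(LBINT x=l..u. f x) = - U - (- L)"
    by (rule interval_integral_FTC_nonneg[where F = F];
        use lu L U F f_cont f_nonneg in \<open>auto simp: ereal_tendsto_simps F_def intro!: tendsto_minus\<close>)+
  have "(LINT x:{l<..<u}|lborel. f x) = L - U"
    using FTC(2) lu by (simp add: interval_lebesgue_integral_def einterval_def greaterThanLessThan_def greaterThan_def lessThan_def Collect_conj_eq)
  moreover have int: "set_integrable lborel {l<..<u} f"
    using FTC(1) by (simp add: einterval_def greaterThanLessThan_def greaterThan_def lessThan_def Collect_conj_eq)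
  ultimately have "(\<integral>\<^sup>+r. ennreal (indicator {l<..<u} r *\<^sub>R f r) \<partial>lborel) = ennreal (L - U)"
    unfolding set_lebesgue_integral_def set_integrable_def
    by (subst nn_integral_eq_integral) (auto simp: indicator_def f_nonneg)
  then show "(\<integral>\<^sup>+r\<in>{l<..<u}. ennreal (f r) \<partial>lborel) = ennreal (L - U)"
    by (rule trans[rotated]) (auto simp: indicator_def intro!: nn_integral_cong)
  have "0 \<le> (LINT x:{l<..<u}|lborel. f x)"
    unfolding set_lebesgue_integral_def by (intro integral_nonneg_AE) (auto simp: indicator_def f_nonneg)
  then show "U \<le> L" using \<open>(LINT x:{l<..<u}|lborel. f x) = L - U\<close> by simp
qed

text \<open>The three summands are \<open>U\<close>, \<open>P - L\<close> and \<open>L - U\<close>,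
  where \<open>U\<close> and \<open>L\<close> are the values of \<open>S\<close> at the ends of the
  range of \<open>r\<close> and \<open>P\<close> is the right-hand side; the sum telescopes. Of the
  interior time \<open>\<rho>\<close>, the part \<open>r\<close> falls into the first period and
  \<open>\<rho> - r\<close> into the second, whence the range of \<open>r\<close>.\<close>

lemma chapman_kolmogorov_fixed_time:
  fixes a b t s \<rho> :: real
  assumes a: "0 \<le> a" and b: "0 \<le> b" and t: "0 < t" and s: "0 < s" and \<rho>: "0 < \<rho>" "\<rho> < t + s"
  shows "(if t < \<rho> then \<integral>\<^sup>+c\<in>{0<..}. ennreal (dirichlet t a c * hit (\<rho> - t) (c + (b + s + t - \<rho>))) \<partial>lborel else 0)
    + (if s < \<rho> then \<integral>\<^sup>+c\<in>{0<..}. ennreal (hit (\<rho> - s) ((a + t + s - \<rho>) + c) * dirichlet s c b) \<partial>lborel else 0)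
    + (\<integral>\<^sup>+r\<in>{max 0 (\<rho> - s)<..<min t \<rho>}.
        (\<integral>\<^sup>+c\<in>{0<..}. ennreal (hit r ((a + t - r) + c) * hit (\<rho> - r) (c + (b + s - (\<rho> - r)))) \<partial>lborel)
        + ennreal (hit r (a + t - r) * hit (\<rho> - r) (b + s - (\<rho> - r))) \<partial>lborel)
    = ennreal (hit \<rho> (a + b + t + s - \<rho>))"
proof -
  define A where "A = a + t"
  define B where "B = b + s"
  define S where "S = (\<lambda>r. Psi r (\<rho> - r) (A - r) (B - (\<rho> - r)))"
  define l where "l = max 0 (\<rho> - s)"
  define u where "u = min t \<rho>"
  define P where "P = hit \<rho> (a + b + t + s - \<rho>)"
  \<comment> \<open>If \<open>s < \<rho>\<close>, the lower end \<open>\<rho> - s\<close> is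
    positive and \<open>S\<close> is continuous there. Otherwise it is 0, where the limit is all of
    \<open>P\<close>, in accordance with the absent second summand. \<open>U\<close> is analogous,
    with limit 0.\<close>
  define L where "L = (if s < \<rho> then S (\<rho> - s) else P)"
  define U where "U = (if t < \<rho> then S t else 0)"
  have lu: "0 \<le> l" "l < u" "u \<le> \<rho>" using assms by (auto simp: l_def u_def)
  have AB: "u \<le> A" "\<rho> - l \<le> B" using assms by (auto simp: l_def u_def A_def B_def)
  have S_lim: "(S \<longlongrightarrow> S r) (at r within X)" if "0 < r" "r < \<rho>" for r X
    unfolding S_def
    by (rule tendsto_within_subset[OF DERIV_isCont[OF DERIV_Psi[OF that], unfolded isCont_def]]) simp
  have "(S \<longlongrightarrow> L) (at_right l)"
    using S_lim[of "\<rho> - s" "{\<rho> - s<..}"] Psi_at_right[OF \<rho>(1), of A B] a t s \<rho>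
    by (auto simp: L_def l_def S_def P_def A_def B_def max_def algebra_simps)
  moreover have "(S \<longlongrightarrow> U) (at_left u)"
    using S_lim[of t "{..<t}"] Psi_at_left[OF \<rho>(1), of B A] b t s \<rho>
    by (auto simp: U_def u_def S_def A_def B_def min_def)
  ultimately have I: "(\<integral>\<^sup>+r\<in>{l<..<u}. ennreal (hit_hit r (\<rho> - r) (A - r) (B - (\<rho> - r)) + hit r (A - r) * hit (\<rho> - r) (B - (\<rho> - r))) \<partial>lborel)
      = ennreal (L - U)" "U \<le> L"
    using interaction_integral[OF lu AB, of L U] by (simp_all add: S_def)
  have 1: "(\<integral>\<^sup>+c\<in>{0<..}. ennreal (hit r ((a + t - r) + c) * hit (\<rho> - r) (c + (b + s - (\<rho> - r)))) \<partial>lborel)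
        + ennreal (hit r (a + t - r) * hit (\<rho> - r) (b + s - (\<rho> - r)))
      = ennreal (hit_hit r (\<rho> - r) (A - r) (B - (\<rho> - r)) + hit r (A - r) * hit (\<rho> - r) (B - (\<rho> - r)))"
    if "r \<in> {l<..<u}" for r
  proof -
    have *: "0 < r" "0 < \<rho> - r" "0 \<le> A - r" "0 \<le> B - (\<rho> - r)" using that lu AB by auto
    then show ?thesis
      using hit_hit_integral[OF *]
      by (subst ennreal_plus) (auto simp: A_def B_def intro!: mult_nonneg_nonneg hit_nonneg)
  qed
  have 2: "(if t < \<rho> then \<integral>\<^sup>+c\<in>{0<..}. ennreal (dirichlet t a c * hit (\<rho> - t) (c + (b + s + t - \<rho>))) \<partial>lborel else 0)
      = ennreal U" and U: "0 \<le> U"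
    using dirichlet_hit_integral[of t "\<rho> - t" a "b + s + t - \<rho>"] assms
    by (auto simp: U_def S_def A_def B_def algebra_simps)
  have 3: "(if s < \<rho> then \<integral>\<^sup>+c\<in>{0<..}. ennreal (hit (\<rho> - s) ((a + t + s - \<rho>) + c) * dirichlet s c b) \<partial>lborel else 0)
      = ennreal (P - L) \<and> L \<le> P"
  proof (cases "s < \<rho>")
    case True
    \<comment> \<open>Symmetry of the Dirichlet kernel reads the hitting-then-Dirichlet integral
      backwards in time, as a \<open>Psi\<close> with exchanged arguments.\<close>
    have sym: "dirichlet s c b = dirichlet s b c" for c
      unfolding dirichlet_def using gauss_minus[of s "c - b"] by (simp add: add.commute)
    have "Psi s (\<rho> - s) b (a + t + s - \<rho>) = P - L"
      using Psi_swap[of s "\<rho> - s" b "a + t + s - \<rho>"] True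
      by (simp add: P_def L_def S_def A_def B_def algebra_simps)
    then show ?thesis
      using dirichlet_hit_integral[of s "\<rho> - s" b "a + t + s - \<rho>"] assms True
      by (simp add: sym mult.commute add.commute)
  qed (simp add: L_def)
  have "(\<integral>\<^sup>+r\<in>{l<..<u}. (\<integral>\<^sup>+c\<in>{0<..}. ennreal (hit r ((a + t - r) + c) * hit (\<rho> - r) (c + (b + s - (\<rho> - r)))) \<partial>lborel)
        + ennreal (hit r (a + t - r) * hit (\<rho> - r) (b + s - (\<rho> - r))) \<partial>lborel) = ennreal (L - U)"
    unfolding I(1)[symmetric] by (rule set_nn_integral_cong) (simp_all only: refl Int_iff 1)
  then show ?thesis
    unfolding 2 l_def[symmetric] u_def[symmetric] P_def[symmetric]
    using 3 I(2) U by (simp add: ennreal_plus[symmetric] del: ennreal_plus)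
qed

section \<open>Integration over the normal coordinate and the interior times\<close>

lemma nn_integral_lborel_shift:
  fixes f :: "real \<Rightarrow> ennreal"
  assumes "f \<in> borel_measurable borel"
  shows "(\<integral>\<^sup>+x. f (x - c) \<partial>lborel) = (\<integral>\<^sup>+x. f x \<partial>lborel)"
  using nn_integral_real_affine[of f 1 "- c"] assms by simp

text \<open>\<open>g\<close> stands for the tangential factor as a function of the time \<open>\<rho>\<close> spent in the interior.\<close>

lemma chapman_kolmogorov_normal:
  fixes g :: "real \<Rightarrow> ennreal"
  assumes g[measurable]: "g \<in> borel_measurable borel"
    and a: "0 \<le> a" and b: "0 \<le> b" and t: "0 < t" and s: "0 < s"
  defines "Q \<equiv> \<lambda>c. g (t + s) * ennreal (dirichlet t a c * dirichlet s c b)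
    + (\<integral>\<^sup>+v\<in>{0<..<s}. g (t + v) * ennreal (dirichlet t a c * hit v (c + b + s - v)) \<partial>lborel)
    + (\<integral>\<^sup>+r\<in>{0<..<t}. g (r + s) * ennreal (hit r (a + c + t - r) * dirichlet s c b) \<partial>lborel)
    + (\<integral>\<^sup>+r\<in>{0<..<t}. (\<integral>\<^sup>+v\<in>{0<..<s}.
        g (r + v) * ennreal (hit r (a + c + t - r) * hit v (c + b + s - v)) \<partial>lborel) \<partial>lborel)"
  shows "(\<integral>\<^sup>+c\<in>{0<..}. Q c \<partial>lborel) + Q 0 = g (t + s) * ennreal (dirichlet (t + s) a b)
    + (\<integral>\<^sup>+\<rho>\<in>{0<..<t + s}. g \<rho> * ennreal (hit \<rho> (a + b + t + s - \<rho>)) \<partial>lborel)"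
proof -
  define Q1 where "Q1 = (\<lambda>c. g (t + s) * ennreal (dirichlet t a c * dirichlet s c b))"
  define Q2 where "Q2 = (\<lambda>c. \<integral>\<^sup>+v\<in>{0<..<s}. g (t + v) * ennreal (dirichlet t a c * hit v (c + b + s - v)) \<partial>lborel)"
  define Q3 where "Q3 = (\<lambda>c. \<integral>\<^sup>+r\<in>{0<..<t}. g (r + s) * ennreal (hit r (a + c + t - r) * dirichlet s c b) \<partial>lborel)"
  define Q4 where "Q4 = (\<lambda>c. \<integral>\<^sup>+r\<in>{0<..<t}. (\<integral>\<^sup>+v\<in>{0<..<s}.
        g (r + v) * ennreal (hit r (a + c + t - r) * hit v (c + b + s - v)) \<partial>lborel) \<partial>lborel)"
  have Q: "Q = (\<lambda>c. Q1 c + Q2 c + Q3 c + Q4 c)"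
    by (simp add: Q_def Q1_def Q2_def Q3_def Q4_def)
  have [measurable]: "Q1 \<in> borel_measurable borel" "Q2 \<in> borel_measurable borel"
    "Q3 \<in> borel_measurable borel" "Q4 \<in> borel_measurable borel"
    unfolding Q1_def Q2_def Q3_def Q4_def by measurable
  have split: "(\<integral>\<^sup>+c\<in>{0<..}. Q c \<partial>lborel) = (\<integral>\<^sup>+c\<in>{0<..}. Q1 c \<partial>lborel) + (\<integral>\<^sup>+c\<in>{0<..}. Q2 c \<partial>lborel)
      + (\<integral>\<^sup>+c\<in>{0<..}. Q3 c \<partial>lborel) + (\<integral>\<^sup>+c\<in>{0<..}. Q4 c \<partial>lborel)"
    unfolding Q by (simp add: distrib_right nn_integral_add)
  \<comment> \<open>At \<open>c = 0\<close> every term with a Dirichlet factor vanishes.\<close>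
  have Q0: "Q 0 = Q4 0"
    by (simp add: Q Q1_def Q2_def Q3_def)

  have 1: "(\<integral>\<^sup>+c\<in>{0<..}. Q1 c \<partial>lborel) = g (t + s) * ennreal (dirichlet (t + s) a b)"
    unfolding Q1_def using dirichlet_semigroup[OF t s a b]
    by (simp add: mult.assoc nn_integral_cmult)

  \<comment> \<open>The whole first period is interior time here, so \<open>\<rho> = t + v\<close>
    is the total; \<open>I3\<close> mirrors this with \<open>\<rho> = r + s\<close>.\<close>
  define I2 where "I2 = (\<lambda>\<rho>. \<integral>\<^sup>+c\<in>{0<..}. ennreal (dirichlet t a c * hit (\<rho> - t) (c + (b + s + t - \<rho>))) \<partial>lborel)"
  have [measurable]: "I2 \<in> borel_measurable borel" unfolding I2_def by measurable
  have "(\<integral>\<^sup>+c\<in>{0<..}. Q2 c \<partial>lborel) = (\<integral>\<^sup>+c. \<integral>\<^sup>+v. g (t + v) * indicator {0<..<s} v *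
      (ennreal (dirichlet t a c * hit v (c + b + s - v)) * indicator {0<..} c) \<partial>lborel \<partial>lborel)"
    unfolding Q2_def by (subst nn_integral_multc[symmetric]) (auto simp: ac_simps intro!: nn_integral_cong)
  also have "\<dots> = (\<integral>\<^sup>+v. \<integral>\<^sup>+c. g (t + v) * indicator {0<..<s} v *
      (ennreal (dirichlet t a c * hit v (c + b + s - v)) * indicator {0<..} c) \<partial>lborel \<partial>lborel)"
    by (rule lborel_pair.Fubini') measurable
  also have "\<dots> = (\<integral>\<^sup>+v. g (t + v) * indicator {0<..<s} v * I2 (t + v) \<partial>lborel)"
    unfolding I2_def by (subst nn_integral_cmult) (auto simp: algebra_simps)
  also have "\<dots> = (\<integral>\<^sup>+\<rho>. g (t + (\<rho> - t)) * indicator {0<..<s} (\<rho> - t) * I2 (t + (\<rho> - t)) \<partial>lborel)"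
    by (rule nn_integral_lborel_shift[symmetric]) measurable
  also have "\<dots> = (\<integral>\<^sup>+\<rho>\<in>{0<..<t + s}. g \<rho> * (if t < \<rho> then I2 \<rho> else 0) \<partial>lborel)"
    using t by (intro nn_integral_cong) (auto simp: indicator_def)
  finally have 2: "(\<integral>\<^sup>+c\<in>{0<..}. Q2 c \<partial>lborel) = (\<integral>\<^sup>+\<rho>\<in>{0<..<t + s}. g \<rho> * (if t < \<rho> then I2 \<rho> else 0) \<partial>lborel)" .

  define I3 where "I3 = (\<lambda>\<rho>. \<integral>\<^sup>+c\<in>{0<..}. ennreal (hit (\<rho> - s) ((a + t + s - \<rho>) + c) * dirichlet s c b) \<partial>lborel)"
  have [measurable]: "I3 \<in> borel_measurable borel" unfolding I3_def by measurable
  have "(\<integral>\<^sup>+c\<in>{0<..}. Q3 c \<partial>lborel) = (\<integral>\<^sup>+c. \<integral>\<^sup>+r. g (r + s) * indicator {0<..<t} r *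
      (ennreal (hit r (a + c + t - r) * dirichlet s c b) * indicator {0<..} c) \<partial>lborel \<partial>lborel)"
    unfolding Q3_def by (subst nn_integral_multc[symmetric]) (auto simp: ac_simps intro!: nn_integral_cong)
  also have "\<dots> = (\<integral>\<^sup>+r. \<integral>\<^sup>+c. g (r + s) * indicator {0<..<t} r *
      (ennreal (hit r (a + c + t - r) * dirichlet s c b) * indicator {0<..} c) \<partial>lborel \<partial>lborel)"
    by (rule lborel_pair.Fubini') measurable
  also have "\<dots> = (\<integral>\<^sup>+r. g (r + s) * indicator {0<..<t} r * I3 (r + s) \<partial>lborel)"
    unfolding I3_def by (subst nn_integral_cmult) (auto simp: algebra_simps)
  also have "\<dots> = (\<integral>\<^sup>+\<rho>. g ((\<rho> - s) + s) * indicator {0<..<t} (\<rho> - s) * I3 ((\<rho> - s) + s) \<partial>lborel)"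
    by (rule nn_integral_lborel_shift[symmetric]) measurable
  also have "\<dots> = (\<integral>\<^sup>+\<rho>\<in>{0<..<t + s}. g \<rho> * (if s < \<rho> then I3 \<rho> else 0) \<partial>lborel)"
    using s by (intro nn_integral_cong) (auto simp: indicator_def)
  finally have 3: "(\<integral>\<^sup>+c\<in>{0<..}. Q3 c \<partial>lborel) = (\<integral>\<^sup>+\<rho>\<in>{0<..<t + s}. g \<rho> * (if s < \<rho> then I3 \<rho> else 0) \<partial>lborel)" .

  \<comment> \<open>The boundary contribution \<open>Q4 0\<close> is merged with the interior
    integral, as the fixed-time identity needs the two together.\<close>
  define W where "W = (\<lambda>r v. (\<integral>\<^sup>+c\<in>{0<..}. ennreal (hit r ((a + t - r) + c) * hit v (c + (b + s - v))) \<partial>lborel)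
        + ennreal (hit r (a + t - r) * hit v (b + s - v)))"
  have [measurable (raw)]: "(\<lambda>x. W (f x) (h x)) \<in> borel_measurable M"
    if [measurable]: "f \<in> borel_measurable M" "h \<in> borel_measurable M" for f h and M :: "'z measure"
    unfolding W_def by measurable
  \<comment> \<open>Under \<open>v = \<rho> - r\<close> the conditions \<open>0 < r < t\<close> and
    \<open>0 < v < s\<close> become this range of \<open>r\<close>.\<close>
  define I4 where "I4 = (\<lambda>\<rho>. \<integral>\<^sup>+r\<in>{max 0 (\<rho> - s)<..<min t \<rho>}. W r (\<rho> - r) \<partial>lborel)"
  have "(\<lambda>\<rho>. \<integral>\<^sup>+r. W r (\<rho> - r) * indicator {0<..<t} r * indicator {0<..<s} (\<rho> - r) \<partial>lborel) \<in> borel_measurable borel"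
    by measurable
  also have I4: "(\<lambda>\<rho>. \<integral>\<^sup>+r. W r (\<rho> - r) * indicator {0<..<t} r * indicator {0<..<s} (\<rho> - r) \<partial>lborel) = I4"
    unfolding I4_def by (intro ext nn_integral_cong) (auto simp: indicator_def)
  finally have [measurable]: "I4 \<in> borel_measurable borel" .
  have "(\<integral>\<^sup>+c\<in>{0<..}. Q4 c \<partial>lborel) + Q4 0 = (\<integral>\<^sup>+r. \<integral>\<^sup>+v. g (r + v) * indicator {0<..<t} r * indicator {0<..<s} v * W r v \<partial>lborel \<partial>lborel)"
  proof -
    have "(\<integral>\<^sup>+c\<in>{0<..}. Q4 c \<partial>lborel) = (\<integral>\<^sup>+c. \<integral>\<^sup>+r. \<integral>\<^sup>+v. g (r + v) * indicator {0<..<t} r * indicator {0<..<s} v *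
      (ennreal (hit r (a + c + t - r) * hit v (c + b + s - v)) * indicator {0<..} c) \<partial>lborel \<partial>lborel \<partial>lborel)"
      unfolding Q4_def
      by (simp add: nn_integral_multc[symmetric]) (auto simp: ac_simps intro!: nn_integral_cong)
    also have "\<dots> = (\<integral>\<^sup>+r. \<integral>\<^sup>+c. \<integral>\<^sup>+v. g (r + v) * indicator {0<..<t} r * indicator {0<..<s} v *
      (ennreal (hit r (a + c + t - r) * hit v (c + b + s - v)) * indicator {0<..} c) \<partial>lborel \<partial>lborel \<partial>lborel)"
      by (rule lborel_pair.Fubini') measurable
    also have "\<dots> = (\<integral>\<^sup>+r. \<integral>\<^sup>+v. \<integral>\<^sup>+c. g (r + v) * indicator {0<..<t} r * indicator {0<..<s} v *
      (ennreal (hit r (a + c + t - r) * hit v (c + b + s - v)) * indicator {0<..} c) \<partial>lborel \<partial>lborel \<partial>lborel)"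
      by (intro nn_integral_cong lborel_pair.Fubini') measurable
    also have "\<dots> = (\<integral>\<^sup>+r. \<integral>\<^sup>+v. g (r + v) * indicator {0<..<t} r * indicator {0<..<s} v *
      (\<integral>\<^sup>+c\<in>{0<..}. ennreal (hit r ((a + t - r) + c) * hit v (c + (b + s - v))) \<partial>lborel) \<partial>lborel \<partial>lborel)"
      by (subst nn_integral_cmult) (auto simp: algebra_simps)
    moreover have "Q4 0 = (\<integral>\<^sup>+r. \<integral>\<^sup>+v. g (r + v) * indicator {0<..<t} r * indicator {0<..<s} v *
      ennreal (hit r (a + t - r) * hit v (b + s - v)) \<partial>lborel \<partial>lborel)"
      unfolding Q4_def
      by (simp add: nn_integral_multc[symmetric]) (auto simp: ac_simps intro!: nn_integral_cong)
    ultimately show ?thesis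
      by (simp add: W_def distrib_left nn_integral_add)
  qed
  also have "\<dots> = (\<integral>\<^sup>+r. \<integral>\<^sup>+\<rho>. g (r + (\<rho> - r)) * indicator {0<..<t} r * indicator {0<..<s} (\<rho> - r) * W r (\<rho> - r) \<partial>lborel \<partial>lborel)"
    by (intro nn_integral_cong nn_integral_lborel_shift[symmetric]) measurable
  also have "\<dots> = (\<integral>\<^sup>+\<rho>. \<integral>\<^sup>+r. g (r + (\<rho> - r)) * indicator {0<..<t} r * indicator {0<..<s} (\<rho> - r) * W r (\<rho> - r) \<partial>lborel \<partial>lborel)"
    by (rule lborel_pair.Fubini') measurable
  also have "\<dots> = (\<integral>\<^sup>+\<rho>. \<integral>\<^sup>+r. g \<rho> * (W r (\<rho> - r) * indicator {0<..<t} r * indicator {0<..<s} (\<rho> - r)) \<partial>lborel \<partial>lborel)"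
    by (simp add: ac_simps)
  also have "\<dots> = (\<integral>\<^sup>+\<rho>. g \<rho> * I4 \<rho> \<partial>lborel)"
    unfolding I4[symmetric] by (simp add: nn_integral_cmult)
  also have "\<dots> = (\<integral>\<^sup>+\<rho>\<in>{0<..<t + s}. g \<rho> * I4 \<rho> \<partial>lborel)"
  proof (rule nn_integral_cong)
    fix \<rho> :: real
    show "g \<rho> * I4 \<rho> = g \<rho> * I4 \<rho> * indicator {0<..<t + s} \<rho>"
    proof (cases "\<rho> \<in> {0<..<t + s}")
      case False
      then have "{max 0 (\<rho> - s)<..<min t \<rho>} = {}" by auto
      then show ?thesis by (simp add: I4_def)
    qed simp
  qed
  finally have 4: "(\<integral>\<^sup>+c\<in>{0<..}. Q4 c \<partial>lborel) + Q4 0 = (\<integral>\<^sup>+\<rho>\<in>{0<..<t + s}. g \<rho> * I4 \<rho> \<partial>lborel)" .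

  have "(\<integral>\<^sup>+\<rho>\<in>{0<..<t + s}. g \<rho> * (if t < \<rho> then I2 \<rho> else 0) \<partial>lborel)
      + (\<integral>\<^sup>+\<rho>\<in>{0<..<t + s}. g \<rho> * (if s < \<rho> then I3 \<rho> else 0) \<partial>lborel)
      + (\<integral>\<^sup>+\<rho>\<in>{0<..<t + s}. g \<rho> * I4 \<rho> \<partial>lborel)
    = (\<integral>\<^sup>+\<rho>\<in>{0<..<t + s}. g \<rho> * ((if t < \<rho> then I2 \<rho> else 0) + (if s < \<rho> then I3 \<rho> else 0) + I4 \<rho>) \<partial>lborel)"
    by (simp add: distrib_left distrib_right nn_integral_add)
  also have "\<dots> = (\<integral>\<^sup>+\<rho>\<in>{0<..<t + s}. g \<rho> * ennreal (hit \<rho> (a + b + t + s - \<rho>)) \<partial>lborel)"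
  proof (rule set_nn_integral_cong[OF refl refl])
    fix \<rho> assume "\<rho> \<in> space lborel \<inter> {0<..<t + s}"
    then show "g \<rho> * ((if t < \<rho> then I2 \<rho> else 0) + (if s < \<rho> then I3 \<rho> else 0) + I4 \<rho>)
        = g \<rho> * ennreal (hit \<rho> (a + b + t + s - \<rho>))"
      using chapman_kolmogorov_fixed_time[OF a b t s, of \<rho>] unfolding I2_def I3_def I4_def W_def by simp
  qed
  finally show ?thesis
    unfolding split Q0 1 2 3 4[symmetric] by (simp add: 4 add.assoc)
qed

subsection \<open>Representation and bounds of the kernel\<close>

definition tangential :: "'n::finite \<Rightarrow> real ^ 'n \<Rightarrow> real ^ 'n \<Rightarrow> real \<Rightarrow> real" where
  "tangential k x y r = (\<Prod>i\<in>UNIV - {k}. gauss r (x $ i - y $ i))"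

lemma tangential_nonneg: "0 \<le> r \<Longrightarrow> 0 \<le> tangential k x y r"
  unfolding tangential_def by (intro prod_nonneg gauss_nonneg ballI)

lemma borel_measurable_vec_nth [measurable (raw)]:
  fixes f :: "'a \<Rightarrow> real ^ 'n::finite"
  assumes [measurable]: "f \<in> borel_measurable M"
  shows "(\<lambda>x. f x $ i) \<in> borel_measurable M"
  unfolding cart_eq_inner_axis by measurable

lemma borel_measurable_tangential [measurable (raw)]:
  assumes [measurable]: "f \<in> borel_measurable M" "g \<in> borel_measurable M" "h \<in> borel_measurable M"
  shows "(\<lambda>z. tangential k (f z) (g z) (h z)) \<in> borel_measurable M"
  unfolding tangential_def by measurable

lemma heat_kernel_eq_prod:
  fixes x :: "real ^ 'n::finite"
  assumes "0 < t"
  shows "heat_kernel x t = (\<Prod>i\<in>UNIV. gauss t (x $ i))"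
proof -
  have "(4 * pi * t) powr (- real CARD('n) / 2) = 1 / sqrt (4 * pi * t) ^ CARD('n)"
  proof -
    have "(4 * pi * t) powr (- real CARD('n) / 2) = ((4 * pi * t) powr (- 1 / 2)) powr real CARD('n)"
      by (simp add: powr_powr)
    also have "(4 * pi * t) powr (- 1 / 2) = inverse (sqrt (4 * pi * t))"
      using assms by (simp add: powr_minus powr_half_sqrt)
    finally show ?thesis using assms by (simp add: powr_realpow inverse_eq_divide power_divide)
  qed
  moreover have "exp (- (norm x)\<^sup>2 / (4 * t)) = (\<Prod>i\<in>UNIV. exp (- (x $ i)\<^sup>2 / (4 * t)))"
    by (simp add: exp_sum[symmetric] norm_vec_def L2_set_def sum_nonneg sum_divide_distrib sum_negf)
  ultimately show ?thesis
    by (simp add: heat_kernel_def gauss_def prod_dividef)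
qed

lemma heat_kernel_eq_tangential:
  fixes x y z :: "real ^ 'n::finite"
  assumes "0 < t" and "\<And>i. i \<noteq> k \<Longrightarrow> z $ i = x $ i - y $ i"
  shows "heat_kernel z t = tangential k x y t * gauss t (z $ k)"
proof -
  have "(\<Prod>i\<in>UNIV. gauss t (z $ i)) = gauss t (z $ k) * (\<Prod>i\<in>UNIV - {k}. gauss t (z $ i))"
    by (rule prod.remove) auto
  moreover have "(\<Prod>i\<in>UNIV - {k}. gauss t (z $ i)) = tangential k x y t"
    unfolding tangential_def using assms(2) by (intro prod.cong) auto
  ultimately show ?thesis by (simp add: heat_kernel_eq_prod[OF assms(1)] mult.commute)
qed

section \<open>Bounds uniform in time and space\<close>

lemma power_le_fact_mult_exp:
  fixes x :: real
  assumes "0 \<le> x"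
  shows "x ^ p \<le> fact p * exp x"
proof -
  have "(\<Sum>n\<in>{p}. x ^ n /\<^sub>R fact n) \<le> (\<Sum>n. x ^ n /\<^sub>R fact n)"
    by (rule sum_le_suminf[OF summable_exp_generic]) (use assms in auto)
  also have "\<dots> = exp x" unfolding exp_def ..
  finally have "inverse (fact p) * x ^ p \<le> exp x" by simp
  then have "fact p * (inverse (fact p) * x ^ p) \<le> fact p * exp x"
    by (rule mult_left_mono) simp
  moreover have "fact p * (inverse (fact p) * x ^ p) = x ^ p" by simp
  ultimately show ?thesis by (simp only:)
qed

text \<open>Even powers are controlled by one term of the exponential series in
  \<open>w^2 / 4\<close>; a general power follows from
  \<open>w^p \<le> 1 + w^(2 * p)\<close>.\<close>

lemma power_exp_bound: "\<exists>C. \<forall>w\<ge>0. w ^ p * exp (- w\<^sup>2 / 4) \<le> (C::real)"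
proof (intro exI allI impI)
  fix w :: real assume w: "0 \<le> w"
  have "(w\<^sup>2 / 4) ^ p \<le> fact p * exp (w\<^sup>2 / 4)"
    by (rule power_le_fact_mult_exp) simp
  then have "4 ^ p * (w\<^sup>2 / 4) ^ p \<le> 4 ^ p * (fact p * exp (w\<^sup>2 / 4))"
    by (rule mult_left_mono) simp
  then have "w ^ (2 * p) \<le> 4 ^ p * fact p * exp (w\<^sup>2 / 4)"
    by (simp only: power_mult_distrib[symmetric] power_mult mult.assoc) simp
  moreover have "w ^ p \<le> 1 + w ^ (2 * p)"
  proof -
    have "0 \<le> (w ^ p - 1)\<^sup>2" "0 \<le> w ^ p" using w by auto
    then have "w ^ p \<le> 1 + (w ^ p)\<^sup>2" by (simp add: power2_diff)
    then show ?thesis by (simp add: power_mult[symmetric] mult.commute)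
  qed
  moreover have "1 \<le> exp (w\<^sup>2 / 4)" by simp
  ultimately have "w ^ p \<le> (1 + 4 ^ p * fact p) * exp (w\<^sup>2 / 4)"
    unfolding distrib_right by linarith
  then have "w ^ p * exp (- w\<^sup>2 / 4) \<le> (1 + 4 ^ p * fact p) * exp (w\<^sup>2 / 4) * exp (- w\<^sup>2 / 4)"
    by (rule mult_right_mono) simp
  also have "\<dots> = 1 + 4 ^ p * fact p"
    by (simp add: mult.assoc exp_add[symmetric])
  finally show "w ^ p * exp (- w\<^sup>2 / 4) \<le> 1 + 4 ^ p * fact p" .
qed

text \<open>Near \<open>r = 0\<close> the spatial argument stays away from 0, so that the Gaussian beats the
  negative powers of \<open>r\<close>.\<close>

lemma power_exp_time_bound:
  assumes t: "(0::real) < t"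
  shows "\<exists>C. \<forall>r z. 0 < r \<longrightarrow> r < t \<longrightarrow> t - r \<le> z \<longrightarrow>
    (z / sqrt r) ^ p * exp (- z\<^sup>2 / (4 * r)) / sqrt r ^ q \<le> C"
proof -
  obtain C1 C2 where C1: "\<And>w. 0 \<le> w \<Longrightarrow> w ^ (p + q) * exp (- w\<^sup>2 / 4) \<le> (C1::real)"
    and C2: "\<And>w. 0 \<le> w \<Longrightarrow> w ^ p * exp (- w\<^sup>2 / 4) \<le> (C2::real)"
    using power_exp_bound by meson
  have C_nonneg: "0 \<le> C1" "0 \<le> C2"
    using order_trans[OF _ C1[of 1]] order_trans[OF _ C2[of 1]] by auto
  have "(z / sqrt r) ^ p * exp (- z\<^sup>2 / (4 * r)) / sqrt r ^ q
      \<le> (2 / t) ^ q * C1 + C2 / sqrt (t / 2) ^ q"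
    if r: "0 < r" "r < t" and z: "t - r \<le> z" for r z
  proof -
    define w where "w = z / sqrt r"
    have z0: "0 \<le> z" using r z by linarith
    have w: "0 \<le> w" and e: "- w\<^sup>2 / 4 = - z\<^sup>2 / (4 * r)" using r z0 by (auto simp: w_def power_divide)
    show ?thesis
    \<comment> \<open>For \<open>r < t / 2\<close> the position satisfies
      \<open>z \<ge> t / 2\<close>, so each factor \<open>1 / sqrt r\<close> costs at most
      \<open>2 / t * w\<close>, and the power \<open>p + q\<close> of \<open>w\<close> is bounded.
      For larger \<open>r\<close> the denominator is bounded below.\<close>
    proof (cases "r < t / 2")
      case True
      then have "t / 2 \<le> z" using z by linarith
      then have "1 / sqrt r \<le> 2 / t * w" using t r by (simp add: w_def field_simps)
      then have "(1 / sqrt r) ^ q \<le> (2 / t * w) ^ q" using r by (intro power_mono) auto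
      then have "w ^ p * exp (- w\<^sup>2 / 4) * (1 / sqrt r) ^ q \<le> w ^ p * exp (- w\<^sup>2 / 4) * (2 / t * w) ^ q"
        using w by (intro mult_left_mono) auto
      also have "\<dots> = (2 / t) ^ q * (w ^ (p + q) * exp (- w\<^sup>2 / 4))"
        by (simp only: power_mult_distrib power_add ac_simps)
      also have "\<dots> \<le> (2 / t) ^ q * C1" using t w by (intro mult_left_mono C1) auto
      also have "w ^ p * exp (- w\<^sup>2 / 4) * (1 / sqrt r) ^ q = w ^ p * exp (- w\<^sup>2 / 4) / sqrt r ^ q"
        by (simp add: power_divide)
      finally have "w ^ p * exp (- w\<^sup>2 / 4) / sqrt r ^ q \<le> (2 / t) ^ q * C1" .
      moreover have "0 \<le> C2 / sqrt (t / 2) ^ q" using C_nonneg t by simp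
      ultimately show ?thesis unfolding w_def[symmetric] e[symmetric] by linarith
    next
      case False
      then have "sqrt (t / 2) ^ q \<le> sqrt r ^ q" using t by (intro power_mono) auto
      then have "w ^ p * exp (- w\<^sup>2 / 4) / sqrt r ^ q \<le> C2 / sqrt (t / 2) ^ q"
        using C2[OF w(1)] C_nonneg t by (intro frac_le) auto
      moreover have "0 \<le> (2 / t) ^ q * C1" using C_nonneg t by simp
      ultimately show ?thesis unfolding w_def[symmetric] e[symmetric] by linarith
    qed
  qed
  then show ?thesis by blast
qed

lemma sqrt_four_pi_ge: "0 \<le> r \<Longrightarrow> sqrt r \<le> sqrt (4 * pi * r)"
proof -
  assume "0 \<le> r"
  moreover have "1 \<le> 4 * pi" using pi_gt3 by simp
  ultimately have "1 * r \<le> 4 * pi * r" by (intro mult_right_mono)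
  then show ?thesis by simp
qed

lemma gauss_le: "0 < r \<Longrightarrow> gauss r z \<le> exp (- z\<^sup>2 / (4 * r)) / sqrt r"
  unfolding gauss_def by (intro divide_left_mono sqrt_four_pi_ge) auto

lemma gauss_le':
  assumes "0 < r"
  shows "gauss r z \<le> 1 / sqrt r"
proof -
  have "exp (- z\<^sup>2 / (4 * r)) \<le> 1" using assms by simp
  then have "exp (- z\<^sup>2 / (4 * r)) / sqrt r \<le> 1 / sqrt r"
    using assms by (intro divide_right_mono) auto
  then show ?thesis using gauss_le[OF assms, of z] by linarith
qed

lemma tangential_le:
  fixes x y :: "real ^ 'n::finite"
  assumes "0 < r" shows "tangential k x y r \<le> 1 / sqrt r ^ (CARD('n) - 1)"
proof -
  have "tangential k x y r \<le> (\<Prod>i\<in>UNIV - {k}. 1 / sqrt r)"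
    unfolding tangential_def using assms by (intro prod_mono conjI gauss_nonneg gauss_le') auto
  also have "\<dots> = 1 / sqrt r ^ (CARD('n) - 1)"
    by (simp add: card_Diff_singleton power_one_over)
  finally show ?thesis .
qed

lemma gauss_hit_bound:
  assumes t: "0 < t"
  shows "\<exists>C. \<forall>r z. 0 < r \<longrightarrow> r < t \<longrightarrow> t - r \<le> z \<longrightarrow> gauss r z \<le> C \<and> hit r z / sqrt r ^ n \<le> C"
proof -
  obtain C1 where C1: "\<And>r z. 0 < r \<Longrightarrow> r < t \<Longrightarrow> t - r \<le> z \<Longrightarrow>
      (z / sqrt r) ^ 0 * exp (- z\<^sup>2 / (4 * r)) / sqrt r ^ 1 \<le> C1"
    using power_exp_time_bound[OF t, of 0 1] by blast
  \<comment> \<open>\<open>hit r z\<close> has size \<open>z / sqrt r\<close> times the exponential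
    over \<open>sqrt r ^ 2\<close>, one root from \<open>z / r\<close> and one from the Gaussian
    prefactor; hence \<open>n + 2\<close>.\<close>
  obtain C2 where C2: "\<And>r z. 0 < r \<Longrightarrow> r < t \<Longrightarrow> t - r \<le> z \<Longrightarrow>
      (z / sqrt r) ^ 1 * exp (- z\<^sup>2 / (4 * r)) / sqrt r ^ (n + 2) \<le> C2"
    using power_exp_time_bound[OF t, of 1 "n + 2"] by blast
  have "gauss r z \<le> max C1 C2 \<and> hit r z / sqrt r ^ n \<le> max C1 C2"
    if r: "0 < r" "r < t" and z: "t - r \<le> z" for r z
  proof
    show "gauss r z \<le> max C1 C2" using gauss_le[OF r(1), of z] C1[OF r z] by simp
    have "hit r z / sqrt r ^ n \<le> z / r * (exp (- z\<^sup>2 / (4 * r)) / sqrt r) / sqrt r ^ n"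
      unfolding hit_def using r z by (intro divide_right_mono mult_left_mono gauss_le) auto
    also have "\<dots> = (z / sqrt r) ^ 1 * exp (- z\<^sup>2 / (4 * r)) / sqrt r ^ (n + 2)"
      using r by (simp add: power_add power2_eq_square)
    finally show "hit r z / sqrt r ^ n \<le> max C1 C2" using C2[OF r z] by simp
  qed
  then show ?thesis by blast
qed

text \<open>The tangential factor may blow up like \<open>1 / sqrt r ^ (N - 1)\<close>; the bound on
  \<open>hit\<close> with \<open>n = N - 1\<close> absorbs it, uniformly in space. This yields
  integrability in time and boundedness of the kernel.\<close>

lemma tangential_hit_bound:
  assumes t: "0 < t"
  shows "\<exists>C\<ge>0. \<forall>(x :: real ^ 'n::finite) y r z. 0 < r \<longrightarrow> r < t \<longrightarrow> t - r \<le> z \<longrightarrow> tangential k x y r * hit r z \<le> C"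
proof -
  obtain C where C: "\<And>r z. 0 < r \<Longrightarrow> r < t \<Longrightarrow> t - r \<le> z \<Longrightarrow> hit r z / sqrt r ^ (CARD('n) - 1) \<le> C"
    using gauss_hit_bound[OF t] by meson
  have "tangential k x y r * hit r z \<le> max C 0"
    if r: "0 < r" "r < t" and z: "t - r \<le> z" for x y :: "real ^ 'n" and r z
  proof -
    have "tangential k x y r * hit r z \<le> 1 / sqrt r ^ (CARD('n) - 1) * hit r z"
      using r z by (intro mult_right_mono tangential_le hit_nonneg) auto
    then show ?thesis using C[OF r z] by simp
  qed
  then show ?thesis by (intro exI[of _ "max C 0"]) auto
qed

lemma dyn_kernel_representation:
  fixes k :: "'n::finite"
  assumes x: "x \<in> closure (half_space k)" and y: "y \<in> closure (half_space k)" and t: "0 < t"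
  shows "ennreal (dyn_kernel k x y t) = ennreal (tangential k x y t * dirichlet t (x $ k) (y $ k))
    + (\<integral>\<^sup>+r\<in>{0<..<t}. ennreal (tangential k x y r * hit r (x $ k + y $ k + t - r)) \<partial>lborel)"
proof -
  define a where "a = x $ k"
  define b where "b = y $ k"
  have ab: "0 \<le> a" "0 \<le> b" using x y by (auto simp: closure_half_space a_def b_def)
  define f where "f = (\<lambda>\<tau>. indicator {0<..<t} \<tau> * (tangential k x y (t - \<tau>) * hit (t - \<tau>) (a + b + \<tau>)))"
  have [measurable]: "f \<in> borel_measurable borel" unfolding f_def by measurable
  have f0: "0 \<le> f \<tau>" for \<tau>
    unfolding f_def using ab by (auto simp: indicator_def intro!: mult_nonneg_nonneg tangential_nonneg hit_nonneg)
  obtain C where C0: "0 \<le> C" and C: "\<And>(x :: real ^ 'n) y r z. 0 < r \<Longrightarrow> r < t \<Longrightarrow> t - r \<le> z \<Longrightarrow> tangential k x y r * hit r z \<le> C"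
    using tangential_hit_bound[OF t, of k] by blast
  \<comment> \<open>Integrability has to be shown first: a Bochner integral of a non-integrable
    \<open>f\<close> would be 0 by default and differ from the nonnegative integral in the
    claim.\<close>
  have "(\<integral>\<^sup>+\<tau>. ennreal (f \<tau>) \<partial>lborel) \<le> (\<integral>\<^sup>+\<tau>. ennreal C * indicator {0<..<t} \<tau> \<partial>lborel)"
    unfolding f_def using ab
    by (intro nn_integral_mono) (auto simp: indicator_def intro!: ennreal_leI C)
  also have "\<dots> < \<infinity>"
    using t by (simp add: nn_integral_cmult_indicator ennreal_mult_less_top)
  finally have int: "integrable lborel f"
    using f0 by (intro integrableI_nonneg) auto
  \<comment> \<open>The factor \<open>- 1/2\<close> comes from differentiating the Gaussian and
    cancels the \<open>- 2\<close> in \<open>dyn_kernel\<close>.\<close>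
  have "(LINT \<tau>:{0<..<t}|lborel. normal_deriv_heat_kernel k (x - reflect k y + \<tau> *\<^sub>R axis k 1) (t - \<tau>))
      = (\<integral>\<tau>. - (1/2) * f \<tau> \<partial>lborel)"
    unfolding set_lebesgue_integral_def
  proof (intro Bochner_Integration.integral_cong refl)
    fix \<tau> :: real
    show "indicator {0<..<t} \<tau> *\<^sub>R normal_deriv_heat_kernel k (x - reflect k y + \<tau> *\<^sub>R axis k 1) (t - \<tau>) = - (1/2) * f \<tau>"
    proof (cases "\<tau> \<in> {0<..<t}")
      case True
      let ?z = "x - reflect k y + \<tau> *\<^sub>R axis k 1"
      have "?z $ k = a + b + \<tau>" by (simp add: reflect_def a_def b_def)
      moreover have "heat_kernel ?z (t - \<tau>) = tangential k x y (t - \<tau>) * gauss (t - \<tau>) (?z $ k)"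
        using True by (intro heat_kernel_eq_tangential) (auto simp: reflect_def axis_def)
      ultimately have "normal_deriv_heat_kernel k ?z (t - \<tau>)
          = - (a + b + \<tau>) / (2 * (t - \<tau>)) * (tangential k x y (t - \<tau>) * gauss (t - \<tau>) (a + b + \<tau>))"
        using True normal_deriv_heat_kernel_eq[of "t - \<tau>" k ?z] by simp
      also have "- c / (2 * d) * (p * q) = - (1/2) * (p * (c / d * q))" for c d p q :: real
        by simp
      finally show ?thesis
        using True by (simp add: f_def hit_def)
    qed (simp add: f_def)
  qed
  also have "\<dots> = - (1/2) * (\<integral>\<tau>. f \<tau> \<partial>lborel)" by simp
  finally have "dyn_kernel k x y t = heat_kernel (x - y) t - heat_kernel (x - reflect k y) t + (\<integral>\<tau>. f \<tau> \<partial>lborel)"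
    by (simp add: dyn_kernel_def)
  also have "heat_kernel (x - y) t - heat_kernel (x - reflect k y) t = tangential k x y t * dirichlet t a b"
  proof -
    have "heat_kernel (x - y) t = tangential k x y t * gauss t ((x - y) $ k)"
      "heat_kernel (x - reflect k y) t = tangential k x y t * gauss t ((x - reflect k y) $ k)"
      using t by (intro heat_kernel_eq_tangential; simp add: reflect_def)+
    then show ?thesis by (simp add: dirichlet_def reflect_def a_def b_def right_diff_distrib)
  qed
  finally have "ennreal (dyn_kernel k x y t) = ennreal (tangential k x y t * dirichlet t a b) + ennreal (\<integral>\<tau>. f \<tau> \<partial>lborel)"
    using t ab f0 by (simp add: ennreal_plus integral_nonneg_AE tangential_nonneg dirichlet_nonneg)
  also have "ennreal (\<integral>\<tau>. f \<tau> \<partial>lborel) = (\<integral>\<^sup>+\<tau>. ennreal (f \<tau>) \<partial>lborel)"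
    by (rule nn_integral_eq_integral[symmetric]) (use int f0 in auto)
  also have "\<dots> = (\<integral>\<^sup>+r. ennreal (f (t - r)) \<partial>lborel)"
    using nn_integral_real_affine[of "\<lambda>\<tau>. ennreal (f \<tau>)" "-1" t] by simp
  also have "\<dots> = (\<integral>\<^sup>+r\<in>{0<..<t}. ennreal (tangential k x y r * hit r (a + b + t - r)) \<partial>lborel)"
    by (intro nn_integral_cong) (auto simp: f_def indicator_def algebra_simps)
  finally show ?thesis by (simp add: a_def b_def)
qed

lemma dyn_kernel_bounded:
  fixes k :: "'n::finite"
  assumes t: "0 < t"
  shows "\<exists>C\<ge>0. \<forall>x \<in> closure (half_space k). \<forall>y \<in> closure (half_space k). dyn_kernel k x y t \<le> C"
proof -
  obtain C where C0: "0 \<le> C" and C: "\<And>(x :: real ^ 'n) y r z. 0 < r \<Longrightarrow> r < t \<Longrightarrow> t - r \<le> z \<Longrightarrow> tangential k x y r * hit r z \<le> C"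
    using tangential_hit_bound[OF t, of k] by blast
  define B where "B = 1 / sqrt t ^ (CARD('n) - 1) * (1 / sqrt t)"
  have B0: "0 \<le> B" using t by (simp add: B_def)
  have "dyn_kernel k x y t \<le> B + C * t"
    if x: "x \<in> closure (half_space k)" and y: "y \<in> closure (half_space k)" for x y
  proof -
    have xy: "0 \<le> x $ k" "0 \<le> y $ k" using x y by (auto simp: closure_half_space)
    have "dirichlet t (x $ k) (y $ k) \<le> 1 / sqrt t"
      using gauss_le'[OF t, of "x $ k - y $ k"] gauss_nonneg[of t "x $ k + y $ k"] t by (simp add: dirichlet_def)
    then have "tangential k x y t * dirichlet t (x $ k) (y $ k) \<le> B"
      unfolding B_def using t xy
      by (intro mult_mono tangential_le dirichlet_nonneg) auto
    moreover have "(\<integral>\<^sup>+r\<in>{0<..<t}. ennreal (tangential k x y r * hit r (x $ k + y $ k + t - r)) \<partial>lborel)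
        \<le> (\<integral>\<^sup>+r. ennreal C * indicator {0<..<t} r \<partial>lborel)"
      using xy by (intro nn_integral_mono) (auto simp: indicator_def intro!: ennreal_leI C)
    then have "(\<integral>\<^sup>+r\<in>{0<..<t}. ennreal (tangential k x y r * hit r (x $ k + y $ k + t - r)) \<partial>lborel) \<le> ennreal (C * t)"
      using t C0 by (simp add: nn_integral_cmult_indicator ennreal_mult)
    ultimately have "ennreal (dyn_kernel k x y t) \<le> ennreal B + ennreal (C * t)"
      unfolding dyn_kernel_representation[OF x y t] by (intro add_mono ennreal_leI)
    also have "\<dots> = ennreal (B + C * t)" using B0 C0 t by simp
    finally show ?thesis using B0 C0 t by (subst (asm) ennreal_le_iff) auto
  qed
  then show ?thesis using B0 C0 t by (intro exI[of _ "B + C * t"]) auto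
qed

text \<open>On the range of integration the derivative is replaced by its explicit formula, which is
  jointly measurable in space and time; then the parameter integral is measurable too.\<close>

lemma borel_measurable_dyn_kernel [measurable (raw)]:
  fixes k :: "'n::finite"
  assumes [measurable]: "f \<in> borel_measurable M" "g \<in> borel_measurable M"
  shows "(\<lambda>z. dyn_kernel k (f z) (g z) t) \<in> borel_measurable M"
proof -
  have reflect: "reflect k y = y - (2 * y $ k) *\<^sub>R axis k 1" for y
    by (simp add: vec_eq_iff reflect_def axis_def)
  have [measurable]: "reflect k \<in> borel_measurable borel"
    unfolding reflect[abs_def] by measurable
  have "(LINT \<tau>:{0<..<t}|lborel. normal_deriv_heat_kernel k (x - reflect k y + \<tau> *\<^sub>R axis k 1) (t - \<tau>))
      = (\<integral>\<tau>. indicator {0<..<t} \<tau> * (- ((x - reflect k y + \<tau> *\<^sub>R axis k 1) $ k) / (2 * (t - \<tau>))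
          * heat_kernel (x - reflect k y + \<tau> *\<^sub>R axis k 1) (t - \<tau>)) \<partial>lborel)" for x y
    unfolding set_lebesgue_integral_def
    by (intro Bochner_Integration.integral_cong) (auto simp: normal_deriv_heat_kernel_eq indicator_def)
  note LINT_eq = this
  have [measurable (raw)]: "(\<lambda>z. heat_kernel (f z :: real ^ 'n) (h z)) \<in> borel_measurable M"
    if [measurable]: "f \<in> borel_measurable M" "h \<in> borel_measurable M" for f h and M :: "'z measure"
    unfolding heat_kernel_def by measurable
  show ?thesis
    unfolding dyn_kernel_def LINT_eq by measurable
qed

subsection \<open>The half space as a product\<close>

definition emb :: "'n::finite \<Rightarrow> ('n \<Rightarrow> real) \<Rightarrow> real \<Rightarrow> real ^ 'n" where
  "emb k u c = (\<chi> i. if i = k then c else u i)"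

abbreviation tangential_measure :: "'n::finite \<Rightarrow> ('n \<Rightarrow> real) measure" where
  "tangential_measure k \<equiv> Pi\<^sub>M (UNIV - {k}) (\<lambda>_. lborel)"

lemma emb_nth: "emb k u c $ i = (if i = k then c else u i)"
  by (simp add: emb_def)

lemma hyperplane_embed_eq_emb: "hyperplane_embed k u = emb k u 0"
  by (simp add: hyperplane_embed_def emb_def)

lemma borel_measurable_vecI:
  fixes f :: "'a \<Rightarrow> real ^ 'n::finite"
  assumes "\<And>i. (\<lambda>x. f x $ i) \<in> borel_measurable M"
  shows "f \<in> borel_measurable M"
  using assms by (subst borel_measurable_euclidean_space) (auto simp: Basis_vec_def inner_axis)

lemma measurable_emb [measurable (raw)]:
  assumes f: "f \<in> M \<rightarrow>\<^sub>M tangential_measure k" and g: "g \<in> borel_measurable M"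
  shows "(\<lambda>x. emb k (f x) (g x)) \<in> borel_measurable M"
proof (rule borel_measurable_vecI)
  fix i
  show "(\<lambda>x. emb k (f x) (g x) $ i) \<in> borel_measurable M"
  proof (cases "i = k")
    case False
    have "(\<lambda>x. f x i) \<in> M \<rightarrow>\<^sub>M lborel"
      by (rule measurable_compose[OF f measurable_component_singleton]) (use False in simp)
    then show ?thesis using False by (simp add: emb_nth)
  qed (simp add: emb_nth g)
qed

interpretation lborel_product: product_sigma_finite "\<lambda>_. lborel :: real measure"
  by standard

lemma sigma_finite_tangential_measure: "sigma_finite_measure (tangential_measure k)"
  by (rule lborel_product.sigma_finite) simp

text \<open>Lebesgue measure is determined by its values on boxes, and the preimage of a box is a
  product of intervals.\<close>

lemma lborel_vec_eq_distr:
  "(lborel :: (real ^ 'n::finite) measure) = distr (Pi\<^sub>M UNIV (\<lambda>_. lborel)) borel (\<lambda>f. \<chi> i. f i)"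
proof (rule lborel_eqI)
  fix l u :: "real ^ 'n"
  assume le: "\<And>b. b \<in> Basis \<Longrightarrow> l \<bullet> b \<le> u \<bullet> b"
  have "l \<bullet> axis i 1 \<le> u \<bullet> axis i 1" for i by (rule le) (auto simp: Basis_vec_def)
  then have le': "l $ i \<le> u $ i" for i by (simp add: inner_axis)
  have m: "(\<lambda>f. \<chi> i. f i) \<in> Pi\<^sub>M UNIV (\<lambda>_. lborel) \<rightarrow>\<^sub>M (borel :: (real ^ 'n) measure)"
    by (rule borel_measurable_vecI) (simp add: measurable_component_singleton)
  have "(\<lambda>f. \<chi> i. f i) -` box l u \<inter> space (Pi\<^sub>M UNIV (\<lambda>_. lborel)) = Pi\<^sub>E UNIV (\<lambda>i. {l $ i<..<u $ i})"
    by (auto simp: space_PiM PiE_def Pi_def mem_box_cart extensional_def)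
  then have "emeasure (distr (Pi\<^sub>M UNIV (\<lambda>_. lborel)) borel (\<lambda>f. \<chi> i. f i)) (box l u)
      = emeasure (Pi\<^sub>M UNIV (\<lambda>_. lborel :: real measure)) (Pi\<^sub>E UNIV (\<lambda>i :: 'n. {l $ i<..<u $ i}))"
    using m by (subst emeasure_distr) auto
  also have "\<dots> = (\<Prod>i\<in>UNIV. emeasure lborel {l $ i<..<u $ i})"
    by (rule lborel_product.emeasure_PiM) auto
  also have "\<dots> = (\<Prod>i\<in>UNIV. ennreal (u $ i - l $ i))"
    using le' by simp
  also have "\<dots> = ennreal (\<Prod>i\<in>UNIV. u $ i - l $ i)"
    using le' by (simp add: prod_ennreal)
  also have "(\<Prod>i\<in>UNIV. u $ i - l $ i) = (\<Prod>b\<in>Basis. (u - l) \<bullet> b)"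
  proof -
    have B: "Basis = range (\<lambda>i. axis i (1::real) :: real ^ 'n)" by (auto simp: Basis_vec_def)
    have "inj (\<lambda>i. axis i (1::real) :: real ^ 'n)" by (auto simp: inj_def axis_eq_axis)
    then show ?thesis unfolding B by (simp add: prod.reindex inner_axis)
  qed
  finally show "emeasure (distr (Pi\<^sub>M UNIV (\<lambda>_. lborel)) borel (\<lambda>f. \<chi> i. f i)) (box l u)
      = (\<Prod>b\<in>Basis. (u - l) \<bullet> b)" .
qed simp

lemma nn_integral_lborel_vec_split:
  fixes f :: "real ^ 'n::finite \<Rightarrow> ennreal"
  assumes [measurable]: "f \<in> borel_measurable borel"
  shows "(\<integral>\<^sup>+x. f x \<partial>lborel) = (\<integral>\<^sup>+c. \<integral>\<^sup>+u. f (emb k u c) \<partial>tangential_measure k \<partial>lborel)"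
proof -
  have m[measurable]: "(\<lambda>f. \<chi> i. f i) \<in> Pi\<^sub>M UNIV (\<lambda>_. lborel) \<rightarrow>\<^sub>M (borel :: (real ^ 'n) measure)"
    by (rule borel_measurable_vecI) (simp add: measurable_component_singleton)
  have "(\<integral>\<^sup>+x. f x \<partial>lborel) = (\<integral>\<^sup>+u. f (\<chi> i. u i) \<partial>Pi\<^sub>M UNIV (\<lambda>_. lborel))"
    by (subst lborel_vec_eq_distr) (rule nn_integral_distr, auto)
  also have "(UNIV :: 'n set) = insert k (UNIV - {k})" by auto
  also have "(\<integral>\<^sup>+u. f (\<chi> i. u i) \<partial>Pi\<^sub>M (insert k (UNIV - {k})) (\<lambda>_. lborel))
      = (\<integral>\<^sup>+c. \<integral>\<^sup>+u. f (\<chi> i. (u(k := c)) i) \<partial>tangential_measure k \<partial>lborel)"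
  proof (rule lborel_product.product_nn_integral_insert_rev)
    have "insert k (UNIV - {k}) = UNIV" by auto
    then show "(\<lambda>u. f (\<chi> i. u i)) \<in> borel_measurable (Pi\<^sub>M (insert k (UNIV - {k})) (\<lambda>_. lborel))"
      by simp
  qed auto
  finally show ?thesis by (simp add: emb_def fun_upd_def)
qed

text \<open>Lebesgue measure on \<open>(0, \<infinity>)\<close> plus a unit mass at 0 is the image of Lebesgue measure on
  \<open>(-1, \<infinity>)\<close> under \<open>max 0\<close>. Hence the sum of the interior and the boundary integral is a single
  integral against a \<open>\<sigma>\<close>-finite measure.\<close>

definition clamp :: "'n::finite \<Rightarrow> real ^ 'n \<Rightarrow> real ^ 'n" where
  "clamp k x = (\<chi> i. if i = k then max 0 (x $ k) else x $ i)"

definition closed_integral :: "'n::finite \<Rightarrow> (real ^ 'n \<Rightarrow> ennreal) \<Rightarrow> ennreal" where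
  "closed_integral k f = (\<integral>\<^sup>+x\<in>{x. - 1 < x $ k}. f (clamp k x) \<partial>lborel)"

lemma clamp_in_closure: "clamp k x \<in> closure (half_space k)"
  by (simp add: closure_half_space clamp_def)

lemma measurable_clamp [measurable]: "clamp k \<in> borel \<rightarrow>\<^sub>M borel"
proof (rule borel_measurable_vecI)
  show "(\<lambda>x. clamp k x $ i) \<in> borel_measurable borel" for i
    by (cases "i = k") (simp_all add: clamp_def)
qed

lemma closed_integral_cong:
  assumes "\<And>x. x \<in> closure (half_space k) \<Longrightarrow> f x = g x"
  shows "closed_integral k f = closed_integral k g"
  unfolding closed_integral_def by (simp add: assms clamp_in_closure)

lemma borel_measurable_closed_integral [measurable (raw)]:
  assumes [measurable]: "(\<lambda>(x, y). f x y) \<in> borel_measurable (M \<Otimes>\<^sub>M borel)"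
  shows "(\<lambda>x. closed_integral k (f x)) \<in> borel_measurable M"
  unfolding closed_integral_def by measurable

lemma closed_integral_cmult:
  assumes [measurable]: "f \<in> borel_measurable borel"
  shows "closed_integral k (\<lambda>x. c * f x) = c * closed_integral k f"
  unfolding closed_integral_def by (simp add: mult.assoc nn_integral_cmult)

text \<open>One application of Tonelli's theorem to \<open>lborel\<close> covers all four
  combinations of interior and boundary.\<close>

lemma closed_integral_swap:
  assumes [measurable]: "(\<lambda>(x, y). f x y) \<in> borel_measurable (borel \<Otimes>\<^sub>M borel)"
  shows "closed_integral k (\<lambda>x. closed_integral k (f x)) = closed_integral k (\<lambda>y. closed_integral k (\<lambda>x. f x y))"
proof -
  have "closed_integral k (\<lambda>x. closed_integral k (f x)) = (\<integral>\<^sup>+x. \<integral>\<^sup>+y. f (clamp k x) (clamp k y)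
      * indicator {x. - 1 < x $ k} y * indicator {x. - 1 < x $ k} x \<partial>lborel \<partial>lborel)"
    unfolding closed_integral_def by (simp add: nn_integral_multc)
  also have "\<dots> = (\<integral>\<^sup>+y. \<integral>\<^sup>+x. f (clamp k x) (clamp k y)
      * indicator {x. - 1 < x $ k} y * indicator {x. - 1 < x $ k} x \<partial>lborel \<partial>lborel)"
    by (rule lborel_pair.Fubini') measurable
  also have "\<dots> = (\<integral>\<^sup>+y. \<integral>\<^sup>+x. (f (clamp k x) (clamp k y) * indicator {x. - 1 < x $ k} x)
      * indicator {x. - 1 < x $ k} y \<partial>lborel \<partial>lborel)"
    by (simp add: ac_simps)
  also have "\<dots> = closed_integral k (\<lambda>y. closed_integral k (\<lambda>x. f x y))"
    unfolding closed_integral_def by (simp add: nn_integral_multc)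
  finally show ?thesis .
qed

lemma closed_integral_split:
  assumes [measurable]: "f \<in> borel_measurable borel"
  shows "closed_integral k f = (\<integral>\<^sup>+c\<in>{0<..}. (\<integral>\<^sup>+u. f (emb k u c) \<partial>tangential_measure k) \<partial>lborel)
    + (\<integral>\<^sup>+u. f (emb k u 0) \<partial>tangential_measure k)"
proof -
  interpret T: sigma_finite_measure "tangential_measure k" by (rule sigma_finite_tangential_measure)
  define F where "F = (\<lambda>c. \<integral>\<^sup>+u. f (emb k u c) \<partial>tangential_measure k)"
  have [measurable]: "F \<in> borel_measurable borel" unfolding F_def by measurable
  have "clamp k (emb k u c) = emb k u (max 0 c)" for u c
    by (simp add: clamp_def emb_def vec_eq_iff)
  moreover have "closed_integral k f
      = (\<integral>\<^sup>+c. \<integral>\<^sup>+u. f (clamp k (emb k u c)) * indicator {x. - 1 < x $ k} (emb k u c) \<partial>tangential_measure k \<partial>lborel)"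
    unfolding closed_integral_def by (rule nn_integral_lborel_vec_split) measurable
  moreover have "indicator {x. - 1 < x $ k} (emb k u c) = (indicator {-1<..} c :: ennreal)" for u c
    by (simp add: indicator_def emb_nth)
  ultimately have "closed_integral k f = (\<integral>\<^sup>+c. F (max 0 c) * indicator {-1<..} c \<partial>lborel)"
    unfolding F_def by (simp add: nn_integral_multc)
  \<comment> \<open>The strip \<open>-1 < c \<le> 0\<close> has length 1 and is sent to
    \<open>c = 0\<close>, so the boundary value is counted exactly once.\<close>
  also have "\<dots> = (\<integral>\<^sup>+c. F c * indicator {0<..} c + F 0 * indicator {-1<..0} c \<partial>lborel)"
    by (intro nn_integral_cong) (auto simp: indicator_def)
  also have "\<dots> = (\<integral>\<^sup>+c\<in>{0<..}. F c \<partial>lborel) + F 0"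
    by (simp add: nn_integral_add nn_integral_cmult_indicator)
  finally show ?thesis by (simp add: F_def)
qed

lemma half_space_borel [measurable]: "half_space k \<in> sets borel"
  unfolding half_space_def by measurable

lemma closed_integral_eq_sum:
  assumes [measurable]: "f \<in> borel_measurable borel"
  shows "(\<integral>\<^sup>+y. f y \<partial>lebesgue_on (half_space k)) + (\<integral>\<^sup>+y. f y \<partial>bdry_measure k) = closed_integral k f"
proof -
  interpret T: sigma_finite_measure "tangential_measure k" by (rule sigma_finite_tangential_measure)
  have "(\<integral>\<^sup>+y. f y \<partial>lebesgue_on (half_space k)) = (\<integral>\<^sup>+y\<in>half_space k. f y \<partial>lborel)"
    by (subst nn_integral_restrict_space) (auto simp: nn_integral_completion)
  also have "\<dots> = (\<integral>\<^sup>+c. \<integral>\<^sup>+u. f (emb k u c) * indicator (half_space k) (emb k u c) \<partial>tangential_measure k \<partial>lborel)"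
    by (rule nn_integral_lborel_vec_split) measurable
  also have "\<dots> = (\<integral>\<^sup>+c. \<integral>\<^sup>+u. f (emb k u c) * indicator {0<..} c \<partial>tangential_measure k \<partial>lborel)"
    by (simp add: indicator_def emb_nth half_space_def)
  also have "\<dots> = (\<integral>\<^sup>+c\<in>{0<..}. (\<integral>\<^sup>+u. f (emb k u c) \<partial>tangential_measure k) \<partial>lborel)"
    by (simp add: nn_integral_multc)
  finally have "(\<integral>\<^sup>+y. f y \<partial>lebesgue_on (half_space k))
      = (\<integral>\<^sup>+c\<in>{0<..}. (\<integral>\<^sup>+u. f (emb k u c) \<partial>tangential_measure k) \<partial>lborel)" .
  moreover have "(\<integral>\<^sup>+y. f y \<partial>bdry_measure k) = (\<integral>\<^sup>+u. f (emb k u 0) \<partial>tangential_measure k)"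
    unfolding bdry_measure_def nn_integral_completion
    by (subst nn_integral_distr[OF measurable_hyperplane_embed])
      (auto simp: hyperplane_embed_eq_emb intro!: measurable_restrict_space1)
  ultimately show ?thesis by (simp add: closed_integral_split)
qed

subsection \<open>The Chapman--Kolmogorov identity\<close>

lemma gauss_eq_normal_density: "0 < t \<Longrightarrow> gauss t z = normal_density 0 (sqrt (2 * t)) z"
  by (simp add: gauss_def normal_density_def)

text \<open>\<open>gauss t\<close> is the centred normal density of variance \<open>2 * t\<close>,
  and variances add under convolution; translating by \<open>y\<close> centres the second
  factor.\<close>

lemma gauss_convolution:
  assumes r: "0 < r" and s: "0 < s"
  shows "(\<integral>\<^sup>+u. ennreal (gauss r (x - u) * gauss s (u - y)) \<partial>lborel) = ennreal (gauss (r + s) (x - y))"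
proof -
  have "(\<integral>\<^sup>+u. ennreal (gauss r (x - u) * gauss s (u - y)) \<partial>lborel)
      = (\<integral>\<^sup>+u. ennreal (gauss r (x - (y + u)) * gauss s ((y + u) - y)) \<partial>lborel)"
    using nn_integral_real_affine[of "\<lambda>u. ennreal (gauss r (x - u) * gauss s (u - y))" 1 y] by simp
  also have "\<dots> = (\<integral>\<^sup>+u. ennreal (normal_density 0 (sqrt (2 * r)) ((x - y) - u) * normal_density 0 (sqrt (2 * s)) u) \<partial>lborel)"
    using r s by (simp add: gauss_eq_normal_density diff_diff_eq)
  also have "\<dots> = ennreal (normal_density 0 (sqrt ((sqrt (2 * r))\<^sup>2 + (sqrt (2 * s))\<^sup>2)) (x - y))"
    using fun_cong[OF conv_normal_density_zero_mean[of "sqrt (2 * r)" "sqrt (2 * s)"]] r s by simp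
  also have "\<dots> = ennreal (gauss (r + s) (x - y))"
    using r s by (simp add: gauss_eq_normal_density distrib_left)
  finally show ?thesis .
qed

lemma gauss_mass:
  assumes r: "0 < r"
  shows "(\<integral>\<^sup>+u. ennreal (gauss r (x - u)) \<partial>lborel) = 1"
proof -
  have "(\<integral>\<^sup>+u. ennreal (gauss r (x - u)) \<partial>lborel) = (\<integral>\<^sup>+u. ennreal (gauss r u) \<partial>lborel)"
    using nn_integral_real_affine[of "\<lambda>u. ennreal (gauss r u)" "-1" x] by simp
  also have "\<dots> = (\<integral>\<^sup>+u. ennreal (normal_density 0 (sqrt (2 * r)) u) \<partial>lborel)"
    using r by (simp add: gauss_eq_normal_density)
  also have "\<dots> = ennreal (\<integral>u. normal_density 0 (sqrt (2 * r)) u \<partial>lborel)"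
    using r by (intro nn_integral_eq_integral integrable_normal_density) auto
  also have "\<dots> = 1"
    using r by (simp add: integral_normal_density)
  finally show ?thesis .
qed

lemma tangential_convolution:
  assumes r: "0 < r" and s: "0 < s"
  shows "(\<integral>\<^sup>+u. ennreal (tangential k x (emb k u c) r) * ennreal (tangential k (emb k u c) y s) \<partial>tangential_measure k)
    = ennreal (tangential k x y (r + s))"
proof -
  have "ennreal (tangential k x (emb k u c) r) * ennreal (tangential k (emb k u c) y s)
      = (\<Prod>i\<in>UNIV - {k}. ennreal (gauss r (x $ i - u i) * gauss s (u i - y $ i)))" for u
  proof -
    have "tangential k x (emb k u c) r * tangential k (emb k u c) y s
        = (\<Prod>i\<in>UNIV - {k}. gauss r (x $ i - u i) * gauss s (u i - y $ i))"
      unfolding tangential_def prod.distrib[symmetric] by (intro prod.cong) (auto simp: emb_nth)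
    then show ?thesis
      using r s by (simp add: ennreal_mult[symmetric] prod_ennreal tangential_nonneg gauss_nonneg)
  qed
  then have "(\<integral>\<^sup>+u. ennreal (tangential k x (emb k u c) r) * ennreal (tangential k (emb k u c) y s) \<partial>tangential_measure k)
    = (\<Prod>i\<in>UNIV - {k}. \<integral>\<^sup>+v. ennreal (gauss r (x $ i - v) * gauss s (v - y $ i)) \<partial>lborel)"
    by (simp add: lborel_product.product_nn_integral_prod[of _ "\<lambda>i v. ennreal (gauss r (x $ i - v) * gauss s (v - y $ i))"])
  also have "\<dots> = ennreal (tangential k x y (r + s))"
    using r s by (simp add: gauss_convolution prod_ennreal gauss_nonneg tangential_def)
  finally show ?thesis .
qed

lemma tangential_mass:
  assumes r: "0 < r"
  shows "(\<integral>\<^sup>+u. ennreal (tangential k x (emb k u c) r) \<partial>tangential_measure k) = 1"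
proof -
  have "ennreal (tangential k x (emb k u c) r) = (\<Prod>i\<in>UNIV - {k}. ennreal (gauss r (x $ i - u i)))" for u
  proof -
    have "tangential k x (emb k u c) r = (\<Prod>i\<in>UNIV - {k}. gauss r (x $ i - u i))"
      unfolding tangential_def by (intro prod.cong) (auto simp: emb_nth)
    then show ?thesis using r by (simp add: prod_ennreal gauss_nonneg)
  qed
  then show ?thesis
    using r by (simp add: lborel_product.product_nn_integral_prod[of _ "\<lambda>i v. ennreal (gauss r (x $ i - v))"] gauss_mass)
qed

text \<open>Expanding both kernels gives four products of tangential factors. Integrating them over
  a slice of constant normal coordinate leaves \<open>g\<close> at the sum of the two interior
  times, which is the integrand \<open>Q\<close> of
  \<open>chapman_kolmogorov_normal\<close>.\<close>

lemma chapman_kolmogorov: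
  fixes k :: "'n::finite"
  assumes x: "x \<in> closure (half_space k)" and y: "y \<in> closure (half_space k)" and t: "0 < t" and s: "0 < s"
  shows "closed_integral k (\<lambda>z. ennreal (dyn_kernel k x z t) * ennreal (dyn_kernel k z y s))
    = ennreal (dyn_kernel k x y (t + s))"
proof -
  interpret T: sigma_finite_measure "tangential_measure k" by (rule sigma_finite_tangential_measure)
  interpret TL: pair_sigma_finite "tangential_measure k" "lborel :: real measure" ..
  define a where "a = x $ k"
  define b where "b = y $ k"
  define g where "g = (\<lambda>r. ennreal (tangential k x y r))"
  have ab: "0 \<le> a" "0 \<le> b" using x y by (auto simp: closure_half_space a_def b_def)
  define Q where "Q = (\<lambda>c. g (t + s) * ennreal (dirichlet t a c * dirichlet s c b)
    + (\<integral>\<^sup>+v\<in>{0<..<s}. g (t + v) * ennreal (dirichlet t a c * hit v (c + b + s - v)) \<partial>lborel)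
    + (\<integral>\<^sup>+r\<in>{0<..<t}. g (r + s) * ennreal (hit r (a + c + t - r) * dirichlet s c b) \<partial>lborel)
    + (\<integral>\<^sup>+r\<in>{0<..<t}. (\<integral>\<^sup>+v\<in>{0<..<s}.
        g (r + v) * ennreal (hit r (a + c + t - r) * hit v (c + b + s - v)) \<partial>lborel) \<partial>lborel))"
  have slice: "(\<integral>\<^sup>+u. ennreal (dyn_kernel k x (emb k u c) t) * ennreal (dyn_kernel k (emb k u c) y s) \<partial>tangential_measure k) = Q c"
    if c: "0 \<le> c" for c
  proof -
    define A where "A = (\<lambda>u r. ennreal (tangential k x (emb k u c) r))"
    define B where "B = (\<lambda>u r. ennreal (tangential k (emb k u c) y r))"
    have [measurable (raw)]: "(\<lambda>z. A (f z) (h z)) \<in> borel_measurable M" "(\<lambda>z. B (f z) (h z)) \<in> borel_measurable M"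
      if [measurable]: "f \<in> M \<rightarrow>\<^sub>M tangential_measure k" "h \<in> borel_measurable M" for f h and M :: "'z measure"
      unfolding A_def B_def by measurable
    have AB: "(\<integral>\<^sup>+u. A u r * B u v \<partial>tangential_measure k) = g (r + v)" if "0 < r" "0 < v" for r v
      unfolding A_def B_def g_def using that by (rule tangential_convolution)
    define p where "p = ennreal (dirichlet t a c)"
    define q where "q = ennreal (dirichlet s c b)"
    \<comment> \<open>\<open>P\<close> and \<open>R\<close> include the time cutoffs, so that all
      time integrals run over the line and commute freely with the tangential one.\<close>
    define P where "P = (\<lambda>r. ennreal (hit r (a + c + t - r)) * indicator {0<..<t} r)"
    define R where "R = (\<lambda>v. ennreal (hit v (c + b + s - v)) * indicator {0<..<s} v)"
    have [measurable]: "P \<in> borel_measurable borel" "R \<in> borel_measurable borel"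
      unfolding P_def R_def by measurable
    have emb_cl: "emb k u c \<in> closure (half_space k)" for u using c by (simp add: closure_half_space emb_nth)
    have K1: "ennreal (dyn_kernel k x (emb k u c) t) = A u t * p + (\<integral>\<^sup>+r. A u r * P r \<partial>lborel)" for u
    proof -
      have "(\<integral>\<^sup>+r\<in>{0<..<t}. ennreal (tangential k x (emb k u c) r * hit r (a + c + t - r)) \<partial>lborel) = (\<integral>\<^sup>+r. A u r * P r \<partial>lborel)"
        using ab c by (intro nn_integral_cong) (auto simp: A_def P_def indicator_def ennreal_mult tangential_nonneg hit_nonneg)
      moreover have "ennreal (tangential k x (emb k u c) t * dirichlet t a c) = A u t * p"
        using t ab c by (simp add: A_def p_def ennreal_mult tangential_nonneg dirichlet_nonneg)
      ultimately show ?thesis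
        using dyn_kernel_representation[OF x emb_cl t, of u] by (simp add: a_def emb_nth)
    qed
    have K2: "ennreal (dyn_kernel k (emb k u c) y s) = B u s * q + (\<integral>\<^sup>+v. B u v * R v \<partial>lborel)" for u
    proof -
      have "(\<integral>\<^sup>+v\<in>{0<..<s}. ennreal (tangential k (emb k u c) y v * hit v (c + b + s - v)) \<partial>lborel) = (\<integral>\<^sup>+v. B u v * R v \<partial>lborel)"
        using ab c by (intro nn_integral_cong) (auto simp: B_def R_def indicator_def ennreal_mult tangential_nonneg hit_nonneg)
      moreover have "ennreal (tangential k (emb k u c) y s * dirichlet s c b) = B u s * q"
        using s ab c by (simp add: B_def q_def ennreal_mult tangential_nonneg dirichlet_nonneg)
      ultimately show ?thesis
        using dyn_kernel_representation[OF emb_cl y s, of u] by (simp add: b_def emb_nth)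
    qed
    have "(\<integral>\<^sup>+u. ennreal (dyn_kernel k x (emb k u c) t) * ennreal (dyn_kernel k (emb k u c) y s) \<partial>tangential_measure k)
        = (\<integral>\<^sup>+u. A u t * B u s * (p * q) + (\<integral>\<^sup>+v. A u t * B u v * (p * R v) \<partial>lborel)
          + (\<integral>\<^sup>+r. A u r * B u s * (P r * q) \<partial>lborel)
          + (\<integral>\<^sup>+r. \<integral>\<^sup>+v. A u r * B u v * (P r * R v) \<partial>lborel \<partial>lborel) \<partial>tangential_measure k)"
    proof (rule nn_integral_cong)
      fix u assume [measurable]: "u \<in> space (tangential_measure k)"
      have [measurable]: "A u \<in> borel_measurable borel" "B u \<in> borel_measurable borel"
        unfolding A_def B_def by measurable
      have 1: "(\<integral>\<^sup>+v. A u t * B u v * (p * R v) \<partial>lborel) = A u t * p * (\<integral>\<^sup>+v. B u v * R v \<partial>lborel)"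
        by (subst nn_integral_cmult[symmetric]) (auto simp: ac_simps)
      have 2: "(\<integral>\<^sup>+r. A u r * B u s * (P r * q) \<partial>lborel) = (\<integral>\<^sup>+r. A u r * P r \<partial>lborel) * (B u s * q)"
        by (subst nn_integral_multc[symmetric]) (auto simp: ac_simps)
      have "(\<integral>\<^sup>+r. \<integral>\<^sup>+v. A u r * B u v * (P r * R v) \<partial>lborel \<partial>lborel)
          = (\<integral>\<^sup>+r. (A u r * P r) * (\<integral>\<^sup>+v. B u v * R v \<partial>lborel) \<partial>lborel)"
        by (subst nn_integral_cmult[symmetric]) (auto simp: ac_simps)
      then have 3: "(\<integral>\<^sup>+r. \<integral>\<^sup>+v. A u r * B u v * (P r * R v) \<partial>lborel \<partial>lborel)
          = (\<integral>\<^sup>+r. A u r * P r \<partial>lborel) * (\<integral>\<^sup>+v. B u v * R v \<partial>lborel)"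
        by (simp add: nn_integral_multc)
      show "ennreal (dyn_kernel k x (emb k u c) t) * ennreal (dyn_kernel k (emb k u c) y s)
        = A u t * B u s * (p * q) + (\<integral>\<^sup>+v. A u t * B u v * (p * R v) \<partial>lborel)
          + (\<integral>\<^sup>+r. A u r * B u s * (P r * q) \<partial>lborel)
          + (\<integral>\<^sup>+r. \<integral>\<^sup>+v. A u r * B u v * (P r * R v) \<partial>lborel \<partial>lborel)"
        unfolding K1 K2 1 2 3 by (simp add: distrib_left distrib_right ac_simps)
    qed
    also have "\<dots> = (\<integral>\<^sup>+u. A u t * B u s * (p * q) \<partial>tangential_measure k)
        + (\<integral>\<^sup>+u. \<integral>\<^sup>+v. A u t * B u v * (p * R v) \<partial>lborel \<partial>tangential_measure k)
        + (\<integral>\<^sup>+u. \<integral>\<^sup>+r. A u r * B u s * (P r * q) \<partial>lborel \<partial>tangential_measure k)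
        + (\<integral>\<^sup>+u. \<integral>\<^sup>+r. \<integral>\<^sup>+v. A u r * B u v * (P r * R v) \<partial>lborel \<partial>lborel \<partial>tangential_measure k)"
      by (simp add: nn_integral_add)
    also have "(\<integral>\<^sup>+u. A u t * B u s * (p * q) \<partial>tangential_measure k) = g (t + s) * ennreal (dirichlet t a c * dirichlet s c b)"
      using t s ab c by (simp add: nn_integral_multc AB p_def q_def ennreal_mult dirichlet_nonneg)
    also have "(\<integral>\<^sup>+u. \<integral>\<^sup>+v. A u t * B u v * (p * R v) \<partial>lborel \<partial>tangential_measure k)
        = (\<integral>\<^sup>+v. \<integral>\<^sup>+u. A u t * B u v * (p * R v) \<partial>tangential_measure k \<partial>lborel)"
      by (rule TL.Fubini'[symmetric]) measurable
    also have "\<dots> = (\<integral>\<^sup>+v\<in>{0<..<s}. g (t + v) * ennreal (dirichlet t a c * hit v (c + b + s - v)) \<partial>lborel)"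
      using t ab c
      by (intro nn_integral_cong) (auto simp: nn_integral_multc AB R_def p_def indicator_def ennreal_mult dirichlet_nonneg hit_nonneg)
    also have "(\<integral>\<^sup>+u. \<integral>\<^sup>+r. A u r * B u s * (P r * q) \<partial>lborel \<partial>tangential_measure k)
        = (\<integral>\<^sup>+r. \<integral>\<^sup>+u. A u r * B u s * (P r * q) \<partial>tangential_measure k \<partial>lborel)"
      by (rule TL.Fubini'[symmetric]) measurable
    also have "\<dots> = (\<integral>\<^sup>+r\<in>{0<..<t}. g (r + s) * ennreal (hit r (a + c + t - r) * dirichlet s c b) \<partial>lborel)"
      using s ab c
      by (intro nn_integral_cong) (auto simp: nn_integral_multc AB P_def q_def indicator_def ennreal_mult dirichlet_nonneg hit_nonneg)
    also have "(\<integral>\<^sup>+u. \<integral>\<^sup>+r. \<integral>\<^sup>+v. A u r * B u v * (P r * R v) \<partial>lborel \<partial>lborel \<partial>tangential_measure k)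
        = (\<integral>\<^sup>+r. \<integral>\<^sup>+u. \<integral>\<^sup>+v. A u r * B u v * (P r * R v) \<partial>lborel \<partial>tangential_measure k \<partial>lborel)"
      by (rule TL.Fubini'[symmetric]) measurable
    also have "\<dots> = (\<integral>\<^sup>+r. \<integral>\<^sup>+v. \<integral>\<^sup>+u. A u r * B u v * (P r * R v) \<partial>tangential_measure k \<partial>lborel \<partial>lborel)"
      by (intro nn_integral_cong TL.Fubini'[symmetric]) measurable
    also have "\<dots> = (\<integral>\<^sup>+r. \<integral>\<^sup>+v. (g (r + v) * ennreal (hit r (a + c + t - r) * hit v (c + b + s - v))
        * indicator {0<..<s} v) * indicator {0<..<t} r \<partial>lborel \<partial>lborel)"
      using ab c
      by (intro nn_integral_cong) (auto simp: nn_integral_multc AB P_def R_def indicator_def ennreal_mult hit_nonneg)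
    also have "\<dots> = (\<integral>\<^sup>+r\<in>{0<..<t}. (\<integral>\<^sup>+v\<in>{0<..<s}.
        g (r + v) * ennreal (hit r (a + c + t - r) * hit v (c + b + s - v)) \<partial>lborel) \<partial>lborel)"
      unfolding g_def by (simp add: nn_integral_multc)
    finally show ?thesis unfolding Q_def .
  qed
  have "(\<integral>\<^sup>+c\<in>{0<..}. (\<integral>\<^sup>+u. ennreal (dyn_kernel k x (emb k u c) t) * ennreal (dyn_kernel k (emb k u c) y s)
      \<partial>tangential_measure k) \<partial>lborel) = (\<integral>\<^sup>+c\<in>{0<..}. Q c \<partial>lborel)"
    by (rule set_nn_integral_cong) (simp_all add: slice)
  then have "closed_integral k (\<lambda>z. ennreal (dyn_kernel k x z t) * ennreal (dyn_kernel k z y s))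
      = (\<integral>\<^sup>+c\<in>{0<..}. Q c \<partial>lborel) + Q 0"
    by (simp add: closed_integral_split slice)
  also have "\<dots> = g (t + s) * ennreal (dirichlet (t + s) a b)
    + (\<integral>\<^sup>+\<rho>\<in>{0<..<t + s}. g \<rho> * ennreal (hit \<rho> (a + b + t + s - \<rho>)) \<partial>lborel)"
    unfolding Q_def by (rule chapman_kolmogorov_normal[OF _ ab t s]) (simp add: g_def)
  also have "g (t + s) * ennreal (dirichlet (t + s) a b) = ennreal (tangential k x y (t + s) * dirichlet (t + s) a b)"
    using t s ab by (simp add: g_def ennreal_mult tangential_nonneg dirichlet_nonneg)
  also have "(\<integral>\<^sup>+\<rho>\<in>{0<..<t + s}. g \<rho> * ennreal (hit \<rho> (a + b + t + s - \<rho>)) \<partial>lborel)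
      = (\<integral>\<^sup>+\<rho>\<in>{0<..<t + s}. ennreal (tangential k x y \<rho> * hit \<rho> (a + b + (t + s) - \<rho>)) \<partial>lborel)"
    using ab by (intro nn_integral_cong) (auto simp: g_def indicator_def ennreal_mult tangential_nonneg hit_nonneg add.assoc)
  finally show ?thesis
    using dyn_kernel_representation[OF x y, of "t + s"] t s by (simp add: a_def b_def)
qed

text \<open>The tangential variables integrate to 1, so only normal integrals remain: the Dirichlet
  part is dominated by a Gaussian, and the hitting part is estimated after integrating over
  \<open>c\<close> first.\<close>

lemma closed_integral_dyn_kernel_finite:
  fixes k :: "'n::finite"
  assumes x: "x \<in> closure (half_space k)" and t: "0 < t"
  shows "closed_integral k (\<lambda>y. ennreal (dyn_kernel k x y t)) < \<infinity>"
proof -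
  interpret T: sigma_finite_measure "tangential_measure k" by (rule sigma_finite_tangential_measure)
  interpret TL: pair_sigma_finite "tangential_measure k" "lborel :: real measure" ..
  define a where "a = x $ k"
  have a: "0 \<le> a" using x by (auto simp: closure_half_space a_def)
  obtain C where C: "\<And>r z. 0 < r \<Longrightarrow> r < t \<Longrightarrow> t - r \<le> z \<Longrightarrow> gauss r z \<le> C"
      "\<And>r z. 0 < r \<Longrightarrow> r < t \<Longrightarrow> t - r \<le> z \<Longrightarrow> hit r z \<le> C"
    using gauss_hit_bound[OF t, of 0] by auto
  define H where "H = (\<lambda>c. \<integral>\<^sup>+r\<in>{0<..<t}. ennreal (hit r (a + c + t - r)) \<partial>lborel)"
  have slice: "(\<integral>\<^sup>+u. ennreal (dyn_kernel k x (emb k u c) t) \<partial>tangential_measure k) = ennreal (dirichlet t a c) + H c"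
    if c: "0 \<le> c" for c
  proof -
    have emb_cl: "emb k u c \<in> closure (half_space k)" for u using c by (simp add: closure_half_space emb_nth)
    have "(\<integral>\<^sup>+u. ennreal (dyn_kernel k x (emb k u c) t) \<partial>tangential_measure k)
        = (\<integral>\<^sup>+u. ennreal (tangential k x (emb k u c) t) * ennreal (dirichlet t a c)
          + (\<integral>\<^sup>+r. ennreal (tangential k x (emb k u c) r) * (ennreal (hit r (a + c + t - r)) * indicator {0<..<t} r) \<partial>lborel) \<partial>tangential_measure k)"
    proof (rule nn_integral_cong)
      fix u
      have "(\<integral>\<^sup>+r\<in>{0<..<t}. ennreal (tangential k x (emb k u c) r * hit r (a + c + t - r)) \<partial>lborel)
          = (\<integral>\<^sup>+r. ennreal (tangential k x (emb k u c) r) * (ennreal (hit r (a + c + t - r)) * indicator {0<..<t} r) \<partial>lborel)"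
        using a c by (intro nn_integral_cong) (auto simp: indicator_def ennreal_mult tangential_nonneg hit_nonneg)
      then show "ennreal (dyn_kernel k x (emb k u c) t) = ennreal (tangential k x (emb k u c) t) * ennreal (dirichlet t a c)
          + (\<integral>\<^sup>+r. ennreal (tangential k x (emb k u c) r) * (ennreal (hit r (a + c + t - r)) * indicator {0<..<t} r) \<partial>lborel)"
        using dyn_kernel_representation[OF x emb_cl t, of u] t a c
        by (simp add: a_def emb_nth ennreal_mult tangential_nonneg dirichlet_nonneg)
    qed
    also have "\<dots> = (\<integral>\<^sup>+u. ennreal (tangential k x (emb k u c) t) * ennreal (dirichlet t a c) \<partial>tangential_measure k)
        + (\<integral>\<^sup>+u. \<integral>\<^sup>+r. ennreal (tangential k x (emb k u c) r) * (ennreal (hit r (a + c + t - r)) * indicator {0<..<t} r) \<partial>lborel \<partial>tangential_measure k)"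
      by (rule nn_integral_add) measurable
    also have "(\<integral>\<^sup>+u. ennreal (tangential k x (emb k u c) t) * ennreal (dirichlet t a c) \<partial>tangential_measure k) = ennreal (dirichlet t a c)"
      using t by (simp add: nn_integral_multc tangential_mass)
    also have "(\<integral>\<^sup>+u. \<integral>\<^sup>+r. ennreal (tangential k x (emb k u c) r) * (ennreal (hit r (a + c + t - r)) * indicator {0<..<t} r) \<partial>lborel \<partial>tangential_measure k)
        = (\<integral>\<^sup>+r. \<integral>\<^sup>+u. ennreal (tangential k x (emb k u c) r) * (ennreal (hit r (a + c + t - r)) * indicator {0<..<t} r) \<partial>tangential_measure k \<partial>lborel)"
      by (rule TL.Fubini'[symmetric]) measurable
    also have "\<dots> = H c"
      unfolding H_def by (intro nn_integral_cong) (auto simp: nn_integral_multc tangential_mass indicator_def)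
    finally show ?thesis .
  qed
  have [measurable]: "H \<in> borel_measurable borel" unfolding H_def by measurable
  have "(\<integral>\<^sup>+c\<in>{0<..}. ennreal (dirichlet t a c) \<partial>lborel) \<le> (\<integral>\<^sup>+c. ennreal (gauss t (a - c)) \<partial>lborel)"
    using t by (intro nn_integral_mono) (auto simp: dirichlet_def indicator_def gauss_nonneg intro!: ennreal_leI)
  then have 1: "(\<integral>\<^sup>+c\<in>{0<..}. ennreal (dirichlet t a c) \<partial>lborel) < \<infinity>"
    using t by (simp add: gauss_mass le_less_trans[OF _ ennreal_one_less_top])
  \<comment> \<open>\<open>hit\<close> is \<open>-2\<close> times a derivative in the position, so
    the integral over \<open>c\<close> is a Gaussian value, bounded uniformly in \<open>r\<close>
    because \<open>a + t - r \<ge> t - r\<close>.\<close>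
  have hit_c: "(\<integral>\<^sup>+c\<in>{0<..}. ennreal (hit r (a + c + t - r)) \<partial>lborel) = ennreal (2 * gauss r (a + t - r))"
    if r: "0 < r" "r < t" for r
  proof -
    have "(\<integral>\<^sup>+c\<in>{0<..}. ennreal (hit r (a + c + t - r)) \<partial>lborel) = ennreal (0 - (- 2 * gauss r (a + 0 + t - r)))"
    proof (rule nn_integral_FTC_greaterThan(1))
      show "((\<lambda>c. - 2 * gauss r (a + c + t - r)) has_real_derivative hit r (a + c + t - r)) (at c)" for c
        by (rule DERIV_cong[OF DERIV_cmult[OF DERIV_gauss_chain[OF r(1)]]])
          (use r in \<open>auto intro!: derivative_eq_intros simp: hit_def field_simps\<close>)
      have "filterlim (\<lambda>c. a + c + t - r) at_top at_top" by real_asymp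
      from tendsto_mult[OF tendsto_const[of "- 2"] filterlim_compose[OF gauss_tendsto_0[OF r(1)] this]]
      show "((\<lambda>c. - 2 * gauss r (a + c + t - r)) \<longlongrightarrow> 0) at_top" by simp
    qed (use r a in \<open>auto intro!: hit_nonneg\<close>)
    then show ?thesis by simp
  qed
  have "(\<integral>\<^sup>+c\<in>{0<..}. H c \<partial>lborel) = (\<integral>\<^sup>+c. \<integral>\<^sup>+r. ennreal (hit r (a + c + t - r)) * indicator {0<..<t} r * indicator {0<..} c \<partial>lborel \<partial>lborel)"
    unfolding H_def by (simp add: nn_integral_multc)
  also have "\<dots> = (\<integral>\<^sup>+r. \<integral>\<^sup>+c. ennreal (hit r (a + c + t - r)) * indicator {0<..<t} r * indicator {0<..} c \<partial>lborel \<partial>lborel)"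
    by (rule lborel_pair.Fubini') measurable
  also have "\<dots> \<le> (\<integral>\<^sup>+r. ennreal (2 * C) * indicator {0<..<t} r \<partial>lborel)"
  proof (rule nn_integral_mono)
    fix r
    show "(\<integral>\<^sup>+c. ennreal (hit r (a + c + t - r)) * indicator {0<..<t} r * indicator {0<..} c \<partial>lborel)
        \<le> ennreal (2 * C) * indicator {0<..<t} r"
    proof (cases "r \<in> {0<..<t}")
      case True
      then have "(\<integral>\<^sup>+c. ennreal (hit r (a + c + t - r)) * indicator {0<..<t} r * indicator {0<..} c \<partial>lborel)
          = ennreal (2 * gauss r (a + t - r))"
        using hit_c[of r] by simp
      also have "\<dots> \<le> ennreal (2 * C)"
        using True a C(1)[of r "a + t - r"] by (intro ennreal_leI) auto
      finally show ?thesis using True by simp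
    qed simp
  qed
  also have "\<dots> < \<infinity>"
    using t by (simp add: nn_integral_cmult_indicator ennreal_mult_less_top)
  finally have 2: "(\<integral>\<^sup>+c\<in>{0<..}. H c \<partial>lborel) < \<infinity>" .
  have "H 0 \<le> (\<integral>\<^sup>+r. ennreal C * indicator {0<..<t} r \<partial>lborel)"
    unfolding H_def using a C(2) by (intro nn_integral_mono) (auto simp: indicator_def intro!: ennreal_leI)
  also have "\<dots> < \<infinity>"
    using t by (simp add: nn_integral_cmult_indicator ennreal_mult_less_top)
  finally have 3: "H 0 < \<infinity>" .
  have "(\<integral>\<^sup>+c\<in>{0<..}. (\<integral>\<^sup>+u. ennreal (dyn_kernel k x (emb k u c) t) \<partial>tangential_measure k) \<partial>lborel)
      = (\<integral>\<^sup>+c\<in>{0<..}. ennreal (dirichlet t a c) + H c \<partial>lborel)"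
    by (rule set_nn_integral_cong) (simp_all add: slice)
  then have "closed_integral k (\<lambda>y. ennreal (dyn_kernel k x y t))
      = (\<integral>\<^sup>+c\<in>{0<..}. ennreal (dirichlet t a c) + H c \<partial>lborel) + H 0"
    by (simp add: closed_integral_split slice)
  also have "\<dots> = (\<integral>\<^sup>+c\<in>{0<..}. ennreal (dirichlet t a c) \<partial>lborel) + (\<integral>\<^sup>+c\<in>{0<..}. H c \<partial>lborel) + H 0"
    by (simp add: distrib_right nn_integral_add)
  finally show ?thesis using 1 2 3 by simp
qed

subsection \<open>The semigroup property\<close>

lemma half_space_subset_closure: "half_space k \<subseteq> closure (half_space k)"
  by (rule closure_subset)

lemma frontier_subset_closure: "frontier (half_space k) \<subseteq> closure (half_space k)"
  by (simp add: frontier_def)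

lemma space_bdry_measure: "space (bdry_measure k) = frontier (half_space k)"
  by (simp add: bdry_measure_def space_restrict_space)

lemma space_lebesgue_on_half_space: "space (lebesgue_on (half_space k)) = half_space k"
  by (simp add: space_restrict_space)

lemma measurable_lebesgue_on_half_space:
  "f \<in> borel \<rightarrow>\<^sub>M N \<Longrightarrow> f \<in> lebesgue_on (half_space k) \<rightarrow>\<^sub>M N"
  by (intro measurable_restrict_space1 measurable_completion) simp

lemma measurable_bdry_measure:
  "f \<in> borel \<rightarrow>\<^sub>M N \<Longrightarrow> f \<in> bdry_measure k \<rightarrow>\<^sub>M N"
  unfolding bdry_measure_def
  by (intro measurable_completion) (simp add: measurable_restrict_space1 cong: measurable_cong_sets)

text \<open>The data are measurable only for completed measures, whereas Tonelli's theorem is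
  applied to Borel functions. Half space and frontier are disjoint, so representatives of the two
  data can be glued into one Borel function on the whole space.\<close>

lemma borel_representative:
  fixes \<phi>i \<phi>b :: "real ^ 'n::finite \<Rightarrow> ennreal"
  assumes i: "\<phi>i \<in> borel_measurable (lebesgue_on (half_space k))"
    and b: "\<phi>b \<in> borel_measurable (bdry_measure k)"
  obtains \<phi> where "\<phi> \<in> borel_measurable borel"
    "AE y in lebesgue_on (half_space k). \<phi>i y = \<phi> y" "AE y in bdry_measure k. \<phi>b y = \<phi> y"
proof -
  let ?F = "frontier (half_space k)"
  let ?D = "distr (tangential_measure k) (restrict_space borel ?F) (hyperplane_embed k)"
  have F [measurable]: "?F \<in> sets borel" unfolding frontier_half_space by measurable
  have "(\<lambda>y. \<phi>i y * indicator (half_space k) y) \<in> borel_measurable (completion lborel)"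
    using i by (subst (asm) borel_measurable_restrict_space_iff_ennreal) auto
  from completion_ex_borel_measurable[OF this] obtain f where f [measurable]: "f \<in> borel_measurable borel"
    and f_eq: "AE y in lborel. \<phi>i y * indicator (half_space k) y = f y" by auto
  obtain g where g: "g \<in> borel_measurable ?D" and g_eq: "AE y in ?D. \<phi>b y = g y"
    using completion_ex_borel_measurable[OF b[unfolded bdry_measure_def]] by auto
  have "g \<in> borel_measurable (restrict_space borel ?F)" using g by simp
  then have g' [measurable]: "(\<lambda>y. g y * indicator ?F y) \<in> borel_measurable borel"
    by (subst (asm) borel_measurable_restrict_space_iff_ennreal) auto
  define \<phi> where "\<phi> = (\<lambda>y. if y \<in> half_space k then f y else g y * indicator ?F y)"
  show thesis
  proof (rule that[of \<phi>])
    show "\<phi> \<in> borel_measurable borel" unfolding \<phi>_def by measurable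
    have "AE y in lebesgue. \<phi>i y * indicator (half_space k) y = f y"
      using f_eq by (rule AE_completion)
    then have "AE y in lebesgue. y \<in> half_space k \<longrightarrow> \<phi>i y = \<phi> y"
      by (rule eventually_mono) (auto simp: \<phi>_def)
    then show "AE y in lebesgue_on (half_space k). \<phi>i y = \<phi> y"
      by (subst AE_restrict_space_iff) auto
    have on_F: "\<phi> y = g y" if "y \<in> ?F" for y
    proof -
      have "y \<notin> half_space k" using that unfolding frontier_half_space by (simp add: half_space_def)
      then show ?thesis using that by (simp add: \<phi>_def)
    qed
    have "AE y in ?D. \<phi>b y = \<phi> y"
      using g_eq AE_space by eventually_elim (simp add: on_F space_restrict_space)
    then show "AE y in bdry_measure k. \<phi>b y = \<phi> y"
      unfolding bdry_measure_def by (rule AE_completion)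
  qed
qed

lemma dyn_op_nn_eq_closed_integral:
  assumes [measurable]: "\<phi> \<in> borel_measurable borel"
    and i: "AE y in lebesgue_on (half_space k). \<phi>i y = \<phi> y" and b: "AE y in bdry_measure k. \<phi>b y = \<phi> y"
  shows "dyn_op_nn k t \<phi>i \<phi>b x = closed_integral k (\<lambda>y. ennreal (dyn_kernel k x y t) * \<phi> y)"
proof -
  have "(\<integral>\<^sup>+y. ennreal (dyn_kernel k x y t) * \<phi>i y \<partial>lebesgue_on (half_space k))
      = (\<integral>\<^sup>+y. ennreal (dyn_kernel k x y t) * \<phi> y \<partial>lebesgue_on (half_space k))"
    by (rule nn_integral_cong_AE, use i in eventually_elim) simp
  moreover have "(\<integral>\<^sup>+y. ennreal (dyn_kernel k x y t) * \<phi>b y \<partial>bdry_measure k)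
      = (\<integral>\<^sup>+y. ennreal (dyn_kernel k x y t) * \<phi> y \<partial>bdry_measure k)"
    by (rule nn_integral_cong_AE, use b in eventually_elim) simp
  ultimately show ?thesis
    unfolding dyn_op_nn_def by (simp add: closed_integral_eq_sum)
qed

lemma dyn_op_nn_borel:
  fixes \<phi>i \<phi>b :: "real ^ 'n::finite \<Rightarrow> ennreal"
  assumes i: "\<phi>i \<in> borel_measurable (lebesgue_on (half_space k))"
    and b: "\<phi>b \<in> borel_measurable (bdry_measure k)"
  shows "dyn_op_nn k t \<phi>i \<phi>b \<in> borel_measurable borel"
proof -
  obtain \<phi> where [measurable]: "\<phi> \<in> borel_measurable borel"
    and \<phi>: "AE y in lebesgue_on (half_space k). \<phi>i y = \<phi> y" "AE y in bdry_measure k. \<phi>b y = \<phi> y"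
    by (rule borel_representative[OF i b])
  have "dyn_op_nn k t \<phi>i \<phi>b = (\<lambda>x. closed_integral k (\<lambda>y. ennreal (dyn_kernel k x y t) * \<phi> y))"
    using dyn_op_nn_eq_closed_integral[OF _ \<phi>] by auto
  then show ?thesis by simp
qed

lemma dyn_op_nn_semigroup:
  fixes \<phi>i \<phi>b :: "real ^ 'n::finite \<Rightarrow> ennreal"
  assumes i: "\<phi>i \<in> borel_measurable (lebesgue_on (half_space k))"
    and b: "\<phi>b \<in> borel_measurable (bdry_measure k)"
    and x: "x \<in> closure (half_space k)" and t: "0 < t" and s: "0 < s"
  shows "dyn_op_nn k t (dyn_op_nn k s \<phi>i \<phi>b) (dyn_op_nn k s \<phi>i \<phi>b) x = dyn_op_nn k (t + s) \<phi>i \<phi>b x"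
proof -
  obtain \<phi> where [measurable]: "\<phi> \<in> borel_measurable borel"
    and \<phi>: "AE y in lebesgue_on (half_space k). \<phi>i y = \<phi> y" "AE y in bdry_measure k. \<phi>b y = \<phi> y"
    by (rule borel_representative[OF i b])
  have eq: "dyn_op_nn k r \<phi>i \<phi>b z = closed_integral k (\<lambda>y. ennreal (dyn_kernel k z y r) * \<phi> y)" for r z
    by (rule dyn_op_nn_eq_closed_integral[OF _ \<phi>]) measurable
  have "dyn_op_nn k t (dyn_op_nn k s \<phi>i \<phi>b) (dyn_op_nn k s \<phi>i \<phi>b) x
      = closed_integral k (\<lambda>z. ennreal (dyn_kernel k x z t) * dyn_op_nn k s \<phi>i \<phi>b z)"
    \<comment> \<open>The inner function is Borel already and serves as its own representative on
      both parts.\<close>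
    by (rule dyn_op_nn_eq_closed_integral[OF dyn_op_nn_borel[OF i b]]) auto
  also have "\<dots> = closed_integral k (\<lambda>z. closed_integral k (\<lambda>y.
      ennreal (dyn_kernel k x z t) * (ennreal (dyn_kernel k z y s) * \<phi> y)))"
    unfolding eq by (subst closed_integral_cmult) auto
  also have "\<dots> = closed_integral k (\<lambda>y. closed_integral k (\<lambda>z.
      ennreal (dyn_kernel k x z t) * (ennreal (dyn_kernel k z y s) * \<phi> y)))"
    by (rule closed_integral_swap) measurable
  also have "\<dots> = closed_integral k (\<lambda>y. ennreal (dyn_kernel k x y (t + s)) * \<phi> y)"
  proof (rule closed_integral_cong)
    fix y assume y: "y \<in> closure (half_space k)"
    have "closed_integral k (\<lambda>z. ennreal (dyn_kernel k x z t) * (ennreal (dyn_kernel k z y s) * \<phi> y))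
        = closed_integral k (\<lambda>z. \<phi> y * (ennreal (dyn_kernel k x z t) * ennreal (dyn_kernel k z y s)))"
      by (simp add: ac_simps)
    also have "\<dots> = \<phi> y * closed_integral k (\<lambda>z. ennreal (dyn_kernel k x z t) * ennreal (dyn_kernel k z y s))"
      by (rule closed_integral_cmult) measurable
    also have "\<dots> = ennreal (dyn_kernel k x y (t + s)) * \<phi> y"
      unfolding chapman_kolmogorov[OF x y t s] by (rule mult.commute)
    finally show "closed_integral k (\<lambda>z. ennreal (dyn_kernel k x z t) * (ennreal (dyn_kernel k z y s) * \<phi> y))
        = ennreal (dyn_kernel k x y (t + s)) * \<phi> y" .
  qed
  finally show ?thesis by (simp only: eq)
qed

section \<open>Signed data\<close>

lemma integral_mult_diff_enn2real:
  fixes K :: "'a \<Rightarrow> real" and p m :: "'a \<Rightarrow> ennreal"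
  assumes K [measurable]: "K \<in> borel_measurable M" and K0: "\<And>y. y \<in> space M \<Longrightarrow> 0 \<le> K y"
    and [measurable]: "p \<in> borel_measurable M" "m \<in> borel_measurable M"
    and pfin: "\<And>y. y \<in> space M \<Longrightarrow> p y < \<infinity>" and mfin: "\<And>y. y \<in> space M \<Longrightarrow> m y < \<infinity>"
    and p: "(\<integral>\<^sup>+y. ennreal (K y) * p y \<partial>M) < \<infinity>" and m: "(\<integral>\<^sup>+y. ennreal (K y) * m y \<partial>M) < \<infinity>"
    and f: "\<And>y. y \<in> space M \<Longrightarrow> f y = enn2real (p y) - enn2real (m y)"
  shows "integrable M (\<lambda>y. K y * f y)"
    and "(\<integral>y. K y * f y \<partial>M) = enn2real (\<integral>\<^sup>+y. ennreal (K y) * p y \<partial>M) - enn2real (\<integral>\<^sup>+y. ennreal (K y) * m y \<partial>M)"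
proof -
  have *: "integrable M (\<lambda>y. K y * enn2real (q y))"
      "(\<integral>y. K y * enn2real (q y) \<partial>M) = enn2real (\<integral>\<^sup>+y. ennreal (K y) * q y \<partial>M)"
    if [measurable]: "q \<in> borel_measurable M" and fin: "\<And>y. y \<in> space M \<Longrightarrow> q y < \<infinity>"
      and q: "(\<integral>\<^sup>+y. ennreal (K y) * q y \<partial>M) < \<infinity>" for q
  proof -
    have eq: "(\<integral>\<^sup>+y. ennreal (K y * enn2real (q y)) \<partial>M) = (\<integral>\<^sup>+y. ennreal (K y) * q y \<partial>M)"
      using fin K0 by (intro nn_integral_cong) (simp add: ennreal_mult)
    show "integrable M (\<lambda>y. K y * enn2real (q y))"
      using q K0 by (intro integrableI_nonneg) (auto simp: eq)
    show "(\<integral>y. K y * enn2real (q y) \<partial>M) = enn2real (\<integral>\<^sup>+y. ennreal (K y) * q y \<partial>M)"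
      using K0 by (subst integral_eq_nn_integral) (auto simp: eq)
  qed
  have f': "K y * f y = K y * enn2real (p y) - K y * enn2real (m y)" if "y \<in> space M" for y
    using f[OF that] by (simp add: right_diff_distrib)
  note P = *[of p, OF _ pfin p] and Q = *[of m, OF _ mfin m]
  have "integrable M (\<lambda>y. K y * enn2real (p y) - K y * enn2real (m y))"
    using P(1) Q(1) by auto
  then show "integrable M (\<lambda>y. K y * f y)"
    by (subst Bochner_Integration.integrable_cong[OF refl f'])
  have "(\<integral>y. K y * f y \<partial>M) = (\<integral>y. K y * enn2real (p y) - K y * enn2real (m y) \<partial>M)"
    by (rule Bochner_Integration.integral_cong[OF refl f'])
  also have "\<dots> = enn2real (\<integral>\<^sup>+y. ennreal (K y) * p y \<partial>M) - enn2real (\<integral>\<^sup>+y. ennreal (K y) * m y \<partial>M)"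
    using P Q by simp
  finally show "(\<integral>y. K y * f y \<partial>M) = enn2real (\<integral>\<^sup>+y. ennreal (K y) * p y \<partial>M) - enn2real (\<integral>\<^sup>+y. ennreal (K y) * m y \<partial>M)" .
qed

text \<open>An arbitrary finite decomposition is allowed instead of positive and negative parts: in
  the second application it is the difference of the images of these parts, which need not have
  disjoint supports.\<close>

lemma dyn_op_eq_diff:
  fixes ui ub vi vb :: "real ^ 'n::finite \<Rightarrow> ennreal"
  assumes x: "x \<in> closure (half_space k)" and t: "0 < t"
    and meas: "ui \<in> borel_measurable (lebesgue_on (half_space k))" "vi \<in> borel_measurable (lebesgue_on (half_space k))"
      "ub \<in> borel_measurable (bdry_measure k)" "vb \<in> borel_measurable (bdry_measure k)"
    and fin: "\<And>y. y \<in> closure (half_space k) \<Longrightarrow> ui y < \<infinity>" "\<And>y. y \<in> closure (half_space k) \<Longrightarrow> vi y < \<infinity>"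
      "\<And>y. y \<in> closure (half_space k) \<Longrightarrow> ub y < \<infinity>" "\<And>y. y \<in> closure (half_space k) \<Longrightarrow> vb y < \<infinity>"
    and p: "dyn_op_nn k t ui ub x < \<infinity>" and m: "dyn_op_nn k t vi vb x < \<infinity>"
    and i: "\<And>y. y \<in> closure (half_space k) \<Longrightarrow> \<phi>i y = enn2real (ui y) - enn2real (vi y)"
    and b: "\<And>y. y \<in> closure (half_space k) \<Longrightarrow> \<phi>b y = enn2real (ub y) - enn2real (vb y)"
  shows "dyn_op_defined k t \<phi>i \<phi>b x"
    and "dyn_op k t \<phi>i \<phi>b x = enn2real (dyn_op_nn k t ui ub x) - enn2real (dyn_op_nn k t vi vb x)"
proof -
  have K: "(\<lambda>y. dyn_kernel k x y t) \<in> borel_measurable borel" by measurable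
  have cl: "y \<in> closure (half_space k)"
    if "y \<in> space (lebesgue_on (half_space k)) \<or> y \<in> space (bdry_measure k)" for y
    using that half_space_subset_closure[of k] frontier_subset_closure[of k]
    unfolding space_lebesgue_on_half_space space_bdry_measure by auto
  have K0: "0 \<le> dyn_kernel k x y t"
    if "y \<in> space (lebesgue_on (half_space k)) \<or> y \<in> space (bdry_measure k)" for y
    using dyn_kernel_nonneg[OF x cl[OF that] t] .
  have fins: "(\<integral>\<^sup>+y. ennreal (dyn_kernel k x y t) * ui y \<partial>lebesgue_on (half_space k)) < \<infinity>"
    "(\<integral>\<^sup>+y. ennreal (dyn_kernel k x y t) * ub y \<partial>bdry_measure k) < \<infinity>"
    "(\<integral>\<^sup>+y. ennreal (dyn_kernel k x y t) * vi y \<partial>lebesgue_on (half_space k)) < \<infinity>"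
    "(\<integral>\<^sup>+y. ennreal (dyn_kernel k x y t) * vb y \<partial>bdry_measure k) < \<infinity>"
    using p m unfolding dyn_op_nn_def by simp_all
  note I = integral_mult_diff_enn2real[OF measurable_lebesgue_on_half_space[OF K] K0[OF disjI1] meas(1,2)
      fin(1)[OF cl[OF disjI1]] fin(2)[OF cl[OF disjI1]] fins(1,3) i[OF cl[OF disjI1]]]
  note B = integral_mult_diff_enn2real[OF measurable_bdry_measure[OF K] K0[OF disjI2] meas(3,4)
      fin(3)[OF cl[OF disjI2]] fin(4)[OF cl[OF disjI2]] fins(2,4) b[OF cl[OF disjI2]]]
  show "dyn_op_defined k t \<phi>i \<phi>b x"
    unfolding dyn_op_defined_def using I(1) B(1) by simp
  show "dyn_op k t \<phi>i \<phi>b x = enn2real (dyn_op_nn k t ui ub x) - enn2real (dyn_op_nn k t vi vb x)"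
    using I(2) B(2) fins by (simp add: dyn_op_def dyn_op_nn_def enn2real_plus)
qed

text \<open>Instead of Hoelder's inequality: \<open>|\<phi>| \<le> 1 + |\<phi>|^q\<close>, and \<open>K\<close> is both bounded and integrable.\<close>

lemma in_Lq_nn_integral_finite:
  assumes K [measurable]: "K \<in> borel_measurable M" and C: "\<And>y. y \<in> space M \<Longrightarrow> K y \<le> C"
    and K1: "(\<integral>\<^sup>+y. ennreal (K y) \<partial>M) < \<infinity>"
    and q: "1 \<le> q" and \<phi>: "in_Lq q M \<phi>"
  shows "(\<integral>\<^sup>+y. ennreal (K y) * ennreal \<bar>\<phi> y\<bar> \<partial>M) < \<infinity>"
proof (cases "q = \<infinity>")
  case True
  have [measurable]: "\<phi> \<in> borel_measurable M" using \<phi> by (simp add: in_Lq_def)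
  obtain B where B: "AE y in M. \<bar>\<phi> y\<bar> \<le> B" using \<phi> True by (auto simp: in_Lq_def)
  have "(\<integral>\<^sup>+y. ennreal (K y) * ennreal \<bar>\<phi> y\<bar> \<partial>M) \<le> (\<integral>\<^sup>+y. ennreal (K y) * ennreal B \<partial>M)"
    by (rule nn_integral_mono_AE, use B in eventually_elim) (auto intro!: mult_left_mono ennreal_leI)
  also have "\<dots> < \<infinity>" using K1 by (simp add: nn_integral_multc ennreal_mult_less_top)
  finally show ?thesis .
next
  case False
  have [measurable]: "\<phi> \<in> borel_measurable M" using \<phi> by (simp add: in_Lq_def)
  define r where "r = enn2real q"
  have fin: "(\<integral>\<^sup>+y. ennreal (\<bar>\<phi> y\<bar> powr r) \<partial>M) < \<infinity>"
    using \<phi> False by (simp add: in_Lq_def r_def)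
  have r: "1 \<le> r"
    using enn2real_mono[OF q] False by (simp add: r_def top.not_eq_extremum)
  have le: "\<bar>z\<bar> \<le> 1 + \<bar>z\<bar> powr r" for z
  proof (cases "\<bar>z\<bar> \<le> 1")
    case False
    then have "\<bar>z\<bar> powr 1 \<le> \<bar>z\<bar> powr r" using r by (intro powr_mono) auto
    then show ?thesis using False by simp
  qed (use powr_ge_zero[of "\<bar>z\<bar>" r] in linarith)
  have "(\<integral>\<^sup>+y. ennreal (K y) * ennreal \<bar>\<phi> y\<bar> \<partial>M)
      \<le> (\<integral>\<^sup>+y. ennreal (K y) + ennreal C * ennreal (\<bar>\<phi> y\<bar> powr r) \<partial>M)"
  proof (rule nn_integral_mono)
    fix y assume y: "y \<in> space M"
    have "ennreal (K y) * ennreal \<bar>\<phi> y\<bar> \<le> ennreal (K y) * (1 + ennreal (\<bar>\<phi> y\<bar> powr r))"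
      using ennreal_leI[OF le[of "\<phi> y"]] by (intro mult_left_mono) auto
    also have "\<dots> \<le> ennreal (K y) + ennreal C * ennreal (\<bar>\<phi> y\<bar> powr r)"
      unfolding distrib_left using C[OF y] by (intro add_mono mult_right_mono ennreal_leI) auto
    finally show "ennreal (K y) * ennreal \<bar>\<phi> y\<bar> \<le> ennreal (K y) + ennreal C * ennreal (\<bar>\<phi> y\<bar> powr r)" .
  qed
  also have "\<dots> = (\<integral>\<^sup>+y. ennreal (K y) \<partial>M) + ennreal C * (\<integral>\<^sup>+y. ennreal (\<bar>\<phi> y\<bar> powr r) \<partial>M)"
    by (simp add: nn_integral_add nn_integral_cmult)
  also have "\<dots> < \<infinity>" using K1 fin by (simp add: ennreal_mult_less_top)
  finally show ?thesis .
qed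

lemma dyn_op_nn_finite:
  fixes \<phi>i \<phi>b :: "real ^ 'n::finite \<Rightarrow> real"
  assumes x: "x \<in> closure (half_space k)" and t: "0 < t" and q: "1 \<le> q"
    and i: "in_Lq q (lebesgue_on (half_space k)) \<phi>i" and b: "in_Lq q (bdry_measure k) \<phi>b"
    and le: "\<And>y. ui y \<le> ennreal \<bar>\<phi>i y\<bar>" "\<And>y. ub y \<le> ennreal \<bar>\<phi>b y\<bar>"
  shows "dyn_op_nn k t ui ub x < \<infinity>"
proof -
  have K: "(\<lambda>y. dyn_kernel k x y t) \<in> borel_measurable borel" by measurable
  obtain C where C: "\<And>y. y \<in> closure (half_space k) \<Longrightarrow> dyn_kernel k x y t \<le> C"
    using dyn_kernel_bounded[OF t, of k] x by blast
  have "(\<integral>\<^sup>+y. ennreal (dyn_kernel k x y t) \<partial>lebesgue_on (half_space k)) + (\<integral>\<^sup>+y. ennreal (dyn_kernel k x y t) \<partial>bdry_measure k) < \<infinity>"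
    using closed_integral_dyn_kernel_finite[OF x t] by (subst closed_integral_eq_sum) auto
  then have fin: "(\<integral>\<^sup>+y. ennreal (dyn_kernel k x y t) \<partial>lebesgue_on (half_space k)) < \<infinity>"
    "(\<integral>\<^sup>+y. ennreal (dyn_kernel k x y t) \<partial>bdry_measure k) < \<infinity>"
    by auto
  have "(\<integral>\<^sup>+y. ennreal (dyn_kernel k x y t) * ui y \<partial>lebesgue_on (half_space k))
      \<le> (\<integral>\<^sup>+y. ennreal (dyn_kernel k x y t) * ennreal \<bar>\<phi>i y\<bar> \<partial>lebesgue_on (half_space k))"
    by (intro nn_integral_mono mult_left_mono le) auto
  also have "\<dots> < \<infinity>"
    using half_space_subset_closure[of k]
    by (intro in_Lq_nn_integral_finite[OF measurable_lebesgue_on_half_space[OF K] C fin(1) q i])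
      (auto simp: space_restrict_space)
  finally have 1: "(\<integral>\<^sup>+y. ennreal (dyn_kernel k x y t) * ui y \<partial>lebesgue_on (half_space k)) < \<infinity>" .
  have "(\<integral>\<^sup>+y. ennreal (dyn_kernel k x y t) * ub y \<partial>bdry_measure k)
      \<le> (\<integral>\<^sup>+y. ennreal (dyn_kernel k x y t) * ennreal \<bar>\<phi>b y\<bar> \<partial>bdry_measure k)"
    by (intro nn_integral_mono mult_left_mono le) auto
  also have "\<dots> < \<infinity>"
    using frontier_subset_closure[of k]
    by (intro in_Lq_nn_integral_finite[OF measurable_bdry_measure[OF K] C fin(2) q b])
      (auto simp: space_bdry_measure)
  finally show ?thesis using 1 by (simp add: dyn_op_nn_def)
qed

lemma dyn_op_semigroup:
  fixes \<phi>i \<phi>b :: "real ^ 'n::finite \<Rightarrow> real"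
  assumes q: "1 \<le> q" and i: "in_Lq q (lebesgue_on (half_space k)) \<phi>i" and b: "in_Lq q (bdry_measure k) \<phi>b"
    and t: "0 < t" and s: "0 < s" and x: "x \<in> closure (half_space k)"
  shows "dyn_op_defined k s \<phi>i \<phi>b x"
    and "dyn_op_defined k t (dyn_op k s \<phi>i \<phi>b) (dyn_op k s \<phi>i \<phi>b) x"
    and "dyn_op k t (dyn_op k s \<phi>i \<phi>b) (dyn_op k s \<phi>i \<phi>b) x = dyn_op k (t + s) \<phi>i \<phi>b x"
proof -
  \<comment> \<open>\<open>ennreal\<close> truncates at 0, so these four functions are the positive
    and negative parts of the data.\<close>
  define ui where "ui = (\<lambda>y. ennreal (\<phi>i y))"
  define ub where "ub = (\<lambda>y. ennreal (\<phi>b y))"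
  define vi where "vi = (\<lambda>y. ennreal (- \<phi>i y))"
  define vb where "vb = (\<lambda>y. ennreal (- \<phi>b y))"
  have [measurable]: "\<phi>i \<in> borel_measurable (lebesgue_on (half_space k))" "\<phi>b \<in> borel_measurable (bdry_measure k)"
    using i b by (auto simp: in_Lq_def)
  have meas: "ui \<in> borel_measurable (lebesgue_on (half_space k))" "vi \<in> borel_measurable (lebesgue_on (half_space k))"
      "ub \<in> borel_measurable (bdry_measure k)" "vb \<in> borel_measurable (bdry_measure k)"
    unfolding ui_def ub_def vi_def vb_def by measurable
  have nn_fin: "dyn_op_nn k r ui ub z < \<infinity>" "dyn_op_nn k r vi vb z < \<infinity>"
    if "z \<in> closure (half_space k)" "0 < r" for z r
    by (rule dyn_op_nn_finite[OF that q i b]; auto simp: ui_def ub_def vi_def vb_def intro!: ennreal_leI)+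
  have diff: "z = enn2real (ennreal z) - enn2real (ennreal (- z))" for z
    by (cases "0 \<le> z") (auto simp: ennreal_neg)
  have op: "dyn_op_defined k r \<phi>i \<phi>b z"
    "dyn_op k r \<phi>i \<phi>b z = enn2real (dyn_op_nn k r ui ub z) - enn2real (dyn_op_nn k r vi vb z)"
    if z: "z \<in> closure (half_space k)" and r: "0 < r" for z r
    by (rule dyn_op_eq_diff[OF z r meas _ _ _ _ nn_fin[OF z r]];
        simp add: ui_def ub_def vi_def vb_def diff[symmetric])+
  show "dyn_op_defined k s \<phi>i \<phi>b x" by (rule op(1)[OF x s])
  have P: "dyn_op_nn k t (dyn_op_nn k s ui ub) (dyn_op_nn k s ui ub) x = dyn_op_nn k (t + s) ui ub x"
    by (rule dyn_op_nn_semigroup[OF meas(1,3) x t s])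
  have M: "dyn_op_nn k t (dyn_op_nn k s vi vb) (dyn_op_nn k s vi vb) x = dyn_op_nn k (t + s) vi vb x"
    by (rule dyn_op_nn_semigroup[OF meas(2,4) x t s])
  have ts: "0 < t + s" using t s by simp
  \<comment> \<open>Finiteness of the iterated operator on each part is not estimated anew: by
    \<open>P\<close> and \<open>M\<close> it is finiteness at time \<open>t + s\<close>.\<close>
  note I = dyn_op_eq_diff[OF x t
      measurable_lebesgue_on_half_space[OF dyn_op_nn_borel[OF meas(1,3)]]
      measurable_lebesgue_on_half_space[OF dyn_op_nn_borel[OF meas(2,4)]]
      measurable_bdry_measure[OF dyn_op_nn_borel[OF meas(1,3)]]
      measurable_bdry_measure[OF dyn_op_nn_borel[OF meas(2,4)]]
      nn_fin(1)[OF _ s] nn_fin(2)[OF _ s] nn_fin(1)[OF _ s] nn_fin(2)[OF _ s]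
      nn_fin(1)[OF x ts, folded P] nn_fin(2)[OF x ts, folded M] op(2)[OF _ s] op(2)[OF _ s]]
  show "dyn_op_defined k t (dyn_op k s \<phi>i \<phi>b) (dyn_op k s \<phi>i \<phi>b) x"
    by (rule I(1))
  show "dyn_op k t (dyn_op k s \<phi>i \<phi>b) (dyn_op k s \<phi>i \<phi>b) x = dyn_op k (t + s) \<phi>i \<phi>b x"
    unfolding op(2)[OF x ts] P[symmetric] M[symmetric] by (rule I(2))
qed

lemma chapman_kolmogorov_integral:
  fixes k :: "'n::finite"
  assumes x: "x \<in> closure (half_space k)" and y: "y \<in> closure (half_space k)" and t: "0 < t" and s: "0 < s"
  defines "f \<equiv> \<lambda>z. dyn_kernel k x z t * dyn_kernel k z y s"
  shows "integrable (lebesgue_on (half_space k)) f" and "integrable (bdry_measure k) f"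
    and "dyn_kernel k x y (t + s) = (\<integral>z. f z \<partial>lebesgue_on (half_space k)) + (\<integral>z. f z \<partial>bdry_measure k)"
proof -
  have f: "f \<in> borel_measurable borel" unfolding f_def by measurable
  have f_eq: "ennreal (f z) = ennreal (dyn_kernel k x z t) * ennreal (dyn_kernel k z y s)" and f0: "0 \<le> f z"
    if "z \<in> closure (half_space k)" for z
    using dyn_kernel_nonneg[OF x that t] dyn_kernel_nonneg[OF that y s] by (auto simp: f_def ennreal_mult)
  have f0': "AE z in lebesgue_on (half_space k). 0 \<le> f z" "AE z in bdry_measure k. 0 \<le> f z"
    using half_space_subset_closure[of k] frontier_subset_closure[of k]
    by (auto intro!: AE_I2 f0 simp: space_restrict_space space_bdry_measure)
  have "closed_integral k (\<lambda>z. ennreal (f z)) = ennreal (dyn_kernel k x y (t + s))"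
    unfolding chapman_kolmogorov[OF x y t s, symmetric] by (rule closed_integral_cong) (rule f_eq)
  then have sum: "(\<integral>\<^sup>+z. ennreal (f z) \<partial>lebesgue_on (half_space k)) + (\<integral>\<^sup>+z. ennreal (f z) \<partial>bdry_measure k)
      = ennreal (dyn_kernel k x y (t + s))"
    using f by (subst closed_integral_eq_sum) auto
  \<comment> \<open>The right-hand side of \<open>sum\<close> is the image of a real number, so both
    integrals are finite; this is the source of the integrability claims.\<close>
  have fin: "(\<integral>\<^sup>+z. ennreal (f z) \<partial>lebesgue_on (half_space k)) < \<infinity>" "(\<integral>\<^sup>+z. ennreal (f z) \<partial>bdry_measure k) < \<infinity>"
    using ennreal_less_top[of "dyn_kernel k x y (t + s)"] unfolding sum[symmetric] by auto
  show I: "integrable (lebesgue_on (half_space k)) f"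
    by (rule integrableI_nonneg[OF measurable_lebesgue_on_half_space[OF f] f0'(1)]) (use fin in simp)
  show B: "integrable (bdry_measure k) f"
    by (rule integrableI_nonneg[OF measurable_bdry_measure[OF f] f0'(2)]) (use fin in simp)
  have "ennreal (dyn_kernel k x y (t + s)) = ennreal ((\<integral>z. f z \<partial>lebesgue_on (half_space k)) + (\<integral>z. f z \<partial>bdry_measure k))"
    unfolding sum[symmetric] nn_integral_eq_integral[OF I f0'(1)] nn_integral_eq_integral[OF B f0'(2)]
    using f0' by (simp add: integral_nonneg_AE)
  then show "dyn_kernel k x y (t + s) = (\<integral>z. f z \<partial>lebesgue_on (half_space k)) + (\<integral>z. f z \<partial>bdry_measure k)"
    using dyn_kernel_nonneg[OF x y, of "t + s"] t s f0' by (subst (asm) ennreal_inj) (auto intro!: add_nonneg_nonneg integral_nonneg_AE)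
qed

theorem corollary1p2:
  fixes k :: "'n::finite"
  shows
    "(\<forall>x \<in> closure (half_space k). \<forall>y \<in> closure (half_space k). \<forall>t > 0. \<forall>s > 0.
        integrable (lebesgue_on (half_space k)) (\<lambda>z. dyn_kernel k x z t * dyn_kernel k z y s)
        \<and> integrable (bdry_measure k) (\<lambda>z. dyn_kernel k x z t * dyn_kernel k z y s)
        \<and> dyn_kernel k x y (t + s)
          = (\<integral> z. dyn_kernel k x z t * dyn_kernel k z y s \<partial>lebesgue_on (half_space k))
            + (\<integral> z. dyn_kernel k x z t * dyn_kernel k z y s \<partial>bdry_measure k))
     \<and>
     (\<forall>(\<phi>i :: real ^ 'n \<Rightarrow> ennreal) (\<phi>b :: real ^ 'n \<Rightarrow> ennreal).
        \<phi>i \<in> borel_measurable (lebesgue_on (half_space k))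
        \<and> \<phi>b \<in> borel_measurable (bdry_measure k) \<longrightarrow>
        (\<forall>t > 0. \<forall>s > 0.
           dyn_op_nn k s \<phi>i \<phi>b \<in> borel_measurable (lebesgue_on (half_space k))
           \<and> dyn_op_nn k s \<phi>i \<phi>b \<in> borel_measurable (bdry_measure k)
           \<and> (\<forall>x \<in> closure (half_space k).
                dyn_op_nn k t (dyn_op_nn k s \<phi>i \<phi>b) (dyn_op_nn k s \<phi>i \<phi>b) x
                = dyn_op_nn k (t + s) \<phi>i \<phi>b x)))
     \<and>
     (\<forall>(q :: ennreal) (\<phi>i :: real ^ 'n \<Rightarrow> real) (\<phi>b :: real ^ 'n \<Rightarrow> real).
        1 \<le> q \<and> in_Lq q (lebesgue_on (half_space k)) \<phi>i \<and> in_Lq q (bdry_measure k) \<phi>b \<longrightarrow>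
        (\<forall>t > 0. \<forall>s > 0. \<forall>x \<in> closure (half_space k).
           dyn_op_defined k s \<phi>i \<phi>b x
           \<and> dyn_op_defined k t (dyn_op k s \<phi>i \<phi>b) (dyn_op k s \<phi>i \<phi>b) x
           \<and> dyn_op_defined k (t + s) \<phi>i \<phi>b x
           \<and> dyn_op k t (dyn_op k s \<phi>i \<phi>b) (dyn_op k s \<phi>i \<phi>b) x
             = dyn_op k (t + s) \<phi>i \<phi>b x))"
proof (intro conjI allI ballI impI; (elim conjE)?)
  fix x y :: "real ^ 'n" and t s :: real
  assume "x \<in> closure (half_space k)" "y \<in> closure (half_space k)" "0 < t" "0 < s"
  note CK = chapman_kolmogorov_integral[OF this]
  show "integrable (lebesgue_on (half_space k)) (\<lambda>z. dyn_kernel k x z t * dyn_kernel k z y s)"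
    "integrable (bdry_measure k) (\<lambda>z. dyn_kernel k x z t * dyn_kernel k z y s)"
    "dyn_kernel k x y (t + s)
      = (\<integral> z. dyn_kernel k x z t * dyn_kernel k z y s \<partial>lebesgue_on (half_space k))
        + (\<integral> z. dyn_kernel k x z t * dyn_kernel k z y s \<partial>bdry_measure k)"
    by (fact CK)+
next
  fix \<phi>i \<phi>b :: "real ^ 'n \<Rightarrow> ennreal" and t s :: real
  assume \<phi>: "\<phi>i \<in> borel_measurable (lebesgue_on (half_space k))" "\<phi>b \<in> borel_measurable (bdry_measure k)"
    and ts: "0 < t" "0 < s"
  show "dyn_op_nn k s \<phi>i \<phi>b \<in> borel_measurable (lebesgue_on (half_space k))"
    by (rule measurable_lebesgue_on_half_space[OF dyn_op_nn_borel[OF \<phi>]])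
  show "dyn_op_nn k s \<phi>i \<phi>b \<in> borel_measurable (bdry_measure k)"
    by (rule measurable_bdry_measure[OF dyn_op_nn_borel[OF \<phi>]])
  show "dyn_op_nn k t (dyn_op_nn k s \<phi>i \<phi>b) (dyn_op_nn k s \<phi>i \<phi>b) x = dyn_op_nn k (t + s) \<phi>i \<phi>b x"
    if "x \<in> closure (half_space k)" for x
    by (rule dyn_op_nn_semigroup[OF \<phi> that ts])
next
  fix q :: ennreal and \<phi>i \<phi>b :: "real ^ 'n \<Rightarrow> real" and t s :: real and x :: "real ^ 'n"
  assume L: "1 \<le> q" "in_Lq q (lebesgue_on (half_space k)) \<phi>i" "in_Lq q (bdry_measure k) \<phi>b"
    and ts: "0 < t" "0 < s" and x: "x \<in> closure (half_space k)"
  then have "0 < t + s" by simp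
  then show "dyn_op_defined k (t + s) \<phi>i \<phi>b x"
    using dyn_op_semigroup(1)[OF L ts(1) _ x] by blast
  show "dyn_op_defined k s \<phi>i \<phi>b x"
    "dyn_op_defined k t (dyn_op k s \<phi>i \<phi>b) (dyn_op k s \<phi>i \<phi>b) x"
    "dyn_op k t (dyn_op k s \<phi>i \<phi>b) (dyn_op k s \<phi>i \<phi>b) x = dyn_op k (t + s) \<phi>i \<phi>b x"
    by (fact dyn_op_semigroup[OF L ts x])+
qed

end
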